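(* Let $d \geq 2$ be an integer, let $1 < \beta < \alpha< 2$ and let $\gamma \in [1,d]$ be such that $\gamma > d+2-2\alpha$. Let $\mu_\alpha$ be a symmetric non-degenerate $\alpha$-stable probability measure on $\mathbb{R}^d$ whose L\'evy measure $\nu_\alpha$, with spherical component $\sigma$, is a $\gamma$-measure. Let $\psi_\alpha,\psi_\beta$ be the L\'evy--Khintchine exponents of orders $\alpha$ and $\beta$ with the spherical component $\sigma$, and let $T_{\alpha,\beta}$ be the linear Fourier multiplier operator defined, for all $f\in\mathcal{S}(\mathbb{R}^d)$ and all $x\in\mathbb{R}^d$, by $$T_{\alpha,\beta}(f)(x)=\frac{1}{(2\pi)^d}\int_{\mathbb{R}^d}\mathcal{F}(f)(\xi)e^{i\langle\xi;x\rangle}\,\frac{(1-\psi_\beta(\xi))^{\frac{\beta-1}{\beta}}}{(1-\psi_\alpha(\xi))^{\frac{\alpha-1}{\alpha}}}\,d\xi.$$ Then, for all $p \in (1,+\infty)$, $T_{\alpha,\beta}$ is $L^p(\mathbb{R}^d,dx)$-bounded, i.e. there is a finite constant $C$ such that $\|T_{\alpha,\beta}(f)\|_{L^p(\mathbb{R}^d,dx)}\leq C\|f\|_{L^p(\mathbb{R}^d,dx)}$ for all $f\in\mathcal{S}(\mathbb{R}^d)$.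
   Context: $\|\cdot\|$ and $\langle\cdot;\cdot\rangle$ are the Euclidean norm and inner product on $\mathbb{R}^d$, and $\mathbb{S}^{d-1}$ the Euclidean unit sphere. For $\alpha\in(1,2)$ and a finite positive symmetric ($\sigma(B)=\sigma(-B)$) Borel measure $\sigma$ on $\mathbb{S}^{d-1}$, the symmetric $\alpha$-stable L\'evy measure with spherical component $\sigma$ is $\nu_\alpha(B)=\int_{\mathbb{S}^{d-1}}\int_0^{+\infty} \mathbf{1}_B(ry)\,\frac{dr}{r^{\alpha+1}}\,\sigma(dy)$. Its spectral measure is $\lambda_1^{(\alpha)} = -\cos(\alpha\pi/2)\frac{\Gamma(2-\alpha)}{\alpha(\alpha-1)}\sigma$, and its exponent is $\psi_\alpha(\xi)=-\int_{\mathbb{S}^{d-1}}|\langle\xi;y\rangle|^\alpha\lambda_1^{(\alpha)}(dy)$; $\psi_\beta$ is defined in the same way with $\beta$ in place of $\alpha$. Non-degeneracy means $\inf_{y\in\mathbb{S}^{d-1}}\int_{\mathbb{S}^{d-1}}|\langle y;x\rangle|^\alpha\lambda^{(\alpha)}_1(dx)>0$. $\mu_\alpha$ is the probability measure with $\int e^{i\langle y;\xi\rangle}\mu_\alpha(dy)=e^{\psi_\alpha(\xi)}$. A Borel measure $\nu$ on $\mathbb{R}^d$ is a $\gamma$-measure, $\gamma\in[1,d]$, if there is $c>0$ with $\nu(B(x,r))\leq cr^\gamma$ for all $x$ with $\|x\|=1$ and all $r\in(0,1/2)$. $\mathcal{F}(f)(\xi)=\int_{\mathbb{R}^d}f(x)e^{-i\langle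 x;\xi\rangle}dx$. *)

theory Defs
  imports "HOL-Probability.Probability"
begin

text \<open>The role of \<open>\<real>\<^sup>d\<close> is played by a type \<open>'a :: euclidean_space\<close>, with
  \<open>d = DIM('a)\<close>. A spherical component \<open>\<sigma>\<close> is a measure on the Borel
  sets of the unit sphere, so \<open>space \<sigma> = sphere 0 1\<close>.\<close>

definition spherical_component :: "'a::euclidean_space measure \<Rightarrow> bool" where
  "spherical_component \<sigma> \<longleftrightarrow>
     sets \<sigma> = sets (restrict_space borel (sphere 0 1)) \<and>
     finite_measure \<sigma> \<and>
     (\<forall>B \<in> sets \<sigma>. emeasure \<sigma> B = emeasure \<sigma> (uminus ` B))"

definition levy_measure :: "real \<Rightarrow> 'a::euclidean_space measure \<Rightarrow> 'a measure" where
  "levy_measure \<alpha> \<sigma> =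
     measure_of UNIV (sets borel)
       (\<lambda>B. \<integral>\<^sup>+ y. (\<integral>\<^sup>+ r \<in> {0<..}. indicator B (r *\<^sub>R y) * ennreal (1 / r powr (\<alpha> + 1)) \<partial>lborel) \<partial>\<sigma>)"

text \<open>The set function above is countably additive, so \<open>measure_of\<close> does not
  degenerate to the zero measure.\<close>

lemma sets_levy_measure [simp]: "sets (levy_measure \<alpha> \<sigma>) = sets borel"
  using sets.sigma_sets_eq[of "borel :: 'a measure"]
  by (simp add: levy_measure_def)

lemma emeasure_levy_measure:
  fixes \<sigma> :: "'a::euclidean_space measure"
  assumes \<sigma>: "sets \<sigma> = sets (restrict_space borel (sphere 0 1))"
    and B: "B \<in> sets borel"
  shows "emeasure (levy_measure \<alpha> \<sigma>) B =
    (\<integral>\<^sup>+ y. (\<integral>\<^sup>+ r \<in> {0<..}. indicator B (r *\<^sub>R y) * ennreal (1 / r powr (\<alpha> + 1)) \<partial>lborel) \<partial>\<sigma>)"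
proof -
  define g where "g B y r = indicator B (r *\<^sub>R y) * ennreal (1 / r powr (\<alpha> + 1)) * indicator {0<..} r"
    for B and y :: 'a and r :: real
  define F where "F B = (\<integral>\<^sup>+ y. (\<integral>\<^sup>+ r. g B y r \<partial>lborel) \<partial>\<sigma>)" for B
  have [measurable_cong]: "sets \<sigma> = sets (restrict_space borel (sphere 0 1))"
    by (rule \<sigma>)
  have id [measurable]: "(\<lambda>y. y) \<in> borel_measurable \<sigma>"
    using measurable_restrict_space1[of "\<lambda>y. y" borel borel "sphere 0 1 :: 'a set"]
    by (simp add: measurable_cong_sets[OF \<sigma> refl])
  have sc: "(\<lambda>p. snd p *\<^sub>R fst p) \<in> borel_measurable (\<sigma> \<Otimes>\<^sub>M lborel)"
    by (intro borel_measurable_scaleR measurable_compose[OF measurable_fst id]) simp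
  have gm: "(\<lambda>p. g A (fst p) (snd p)) \<in> borel_measurable (\<sigma> \<Otimes>\<^sub>M lborel)"
    if [measurable]: "A \<in> sets borel" for A
    unfolding g_def
    by (intro borel_measurable_times_ennreal measurable_compose[OF sc]) measurable
  have m1: "(\<lambda>y. \<integral>\<^sup>+ r. g A y r \<partial>lborel) \<in> borel_measurable \<sigma>" if "A \<in> sets borel" for A
    using sigma_finite_measure.borel_measurable_nn_integral_fst[OF sigma_finite_lborel gm[OF that]] by simp
  have m2: "g A y \<in> borel_measurable lborel" if [measurable]: "A \<in> sets borel" for A y
    unfolding g_def by measurable
  have "emeasure (measure_of UNIV (sets borel) F) B = F B"
  proof (rule emeasure_measure_of_sigma)
    show "sigma_algebra UNIV (sets borel :: 'a set set)"
      using sets.sigma_algebra_axioms[of "borel :: 'a measure"] by simp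
    show "positive (sets borel) F"
      by (simp add: positive_def F_def g_def)
    show "countably_additive (sets borel) F"
      unfolding countably_additive_def
    proof (intro allI impI)
      fix A :: "nat \<Rightarrow> 'a set"
      assume A: "range A \<subseteq> sets borel" "disjoint_family A"
      have g: "g (\<Union> (range A)) y r = (\<Sum>i. g (A i) y r)" for y r
        unfolding g_def by (simp add: suminf_indicator[OF A(2), symmetric])
      have "F (\<Union> (range A)) = (\<integral>\<^sup>+ y. (\<Sum>i. \<integral>\<^sup>+ r. g (A i) y r \<partial>lborel) \<partial>\<sigma>)"
        unfolding F_def g using A(1) m2 by (subst nn_integral_suminf) auto
      also have "\<dots> = (\<Sum>i. F (A i))"
        unfolding F_def using A(1) m1 by (subst nn_integral_suminf) auto
      finally show "(\<Sum>i. F (A i)) = F (\<Union> (range A))" by simp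
    qed
  qed (rule B)
  then show ?thesis
    by (simp add: levy_measure_def F_def[abs_def] g_def[abs_def])
qed

definition gamma_measure :: "real \<Rightarrow> 'a::euclidean_space measure \<Rightarrow> bool" where
  "gamma_measure \<gamma> \<nu> \<longleftrightarrow>
     sets \<nu> = sets borel \<and>
     (\<exists>c>0. \<forall>x r. norm x = 1 \<longrightarrow> 0 < r \<longrightarrow> r < 1 / 2 \<longrightarrow>
        emeasure \<nu> (ball x r) \<le> ennreal (c * r powr \<gamma>))"

definition spectral_measure :: "real \<Rightarrow> 'a::euclidean_space measure \<Rightarrow> 'a measure" where
  "spectral_measure \<alpha> \<sigma> =
     scale_measure (ennreal (- cos (\<alpha> * pi / 2) * (Gamma (2 - \<alpha>) / (\<alpha> * (\<alpha> - 1))))) \<sigma>"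

definition stable_exponent :: "real \<Rightarrow> 'a::euclidean_space measure \<Rightarrow> 'a \<Rightarrow> real" where
  "stable_exponent \<alpha> \<sigma> \<xi> = - (LINT y|spectral_measure \<alpha> \<sigma>. \<bar>\<xi> \<bullet> y\<bar> powr \<alpha>)"

definition non_degenerate :: "real \<Rightarrow> 'a::euclidean_space measure \<Rightarrow> bool" where
  "non_degenerate \<alpha> \<sigma> \<longleftrightarrow>
     (INF y \<in> sphere 0 1. LINT x|spectral_measure \<alpha> \<sigma>. \<bar>y \<bullet> x\<bar> powr \<alpha>) > 0"

definition symmetric_stable_law ::
    "real \<Rightarrow> 'a::euclidean_space measure \<Rightarrow> 'a measure \<Rightarrow> bool" where
  "symmetric_stable_law \<alpha> \<sigma> \<mu> \<longleftrightarrow>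
     prob_space \<mu> \<and> sets \<mu> = sets borel \<and>
     (\<forall>\<xi>. (CLINT y|\<mu>. iexp (y \<bullet> \<xi>)) = exp (complex_of_real (stable_exponent \<alpha> \<sigma> \<xi>)))"

text \<open>Iterated directional derivatives; for lists over \<open>Basis\<close> these are the
  partial derivatives. \<open>frechet_derivative\<close> is only meaningful where the function is
  differentiable, which is required at every order in the Schwartz space.\<close>

primrec iterated_partial ::
    "'a::euclidean_space list \<Rightarrow> ('a \<Rightarrow> complex) \<Rightarrow> 'a \<Rightarrow> complex" where
  "iterated_partial [] f = f"
| "iterated_partial (b # bs) f = (\<lambda>x. frechet_derivative (iterated_partial bs f) (at x) b)"

definition schwartz_space :: "('a::euclidean_space \<Rightarrow> complex) set" where
  "schwartz_space = {f. \<forall>bs \<in> lists Basis.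
     (\<forall>x. iterated_partial bs f differentiable (at x)) \<and>
     (\<forall>k::nat. bounded (range (\<lambda>x. norm x ^ k *\<^sub>R iterated_partial bs f x)))}"

definition fourier :: "('a::euclidean_space \<Rightarrow> complex) \<Rightarrow> 'a \<Rightarrow> complex" where
  "fourier f \<xi> = (CLINT x|lborel. f x * iexp (- (x \<bullet> \<xi>)))"

definition T_op ::
    "real \<Rightarrow> real \<Rightarrow> 'a::euclidean_space measure \<Rightarrow> ('a \<Rightarrow> complex) \<Rightarrow> 'a \<Rightarrow> complex" where
  "T_op \<alpha> \<beta> \<sigma> f x =
     complex_of_real (1 / (2 * pi) ^ DIM('a)) *
     (CLINT \<xi>|lborel. fourier f \<xi> * iexp (\<xi> \<bullet> x) *
        complex_of_real
          ((1 - stable_exponent \<beta> \<sigma> \<xi>) powr ((\<beta> - 1) / \<beta>) /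
           (1 - stable_exponent \<alpha> \<sigma> \<xi>) powr ((\<alpha> - 1) / \<alpha>)))"

text \<open>The \<open>L\<^sup>p\<close> norm takes the value \<open>\<infinity>\<close> exactly when \<open>f\<close> is not an
  element of \<open>L\<^sup>p\<close>, non-measurable functions included.\<close>

definition Lp_norm :: "real \<Rightarrow> ('a::euclidean_space \<Rightarrow> complex) \<Rightarrow> ennreal" where
  "Lp_norm p f =
     (let I = (\<integral>\<^sup>+ x. ennreal (norm (f x) powr p) \<partial>lborel)
      in if f \<in> borel_measurable lborel \<and> I < \<infinity> then ennreal (enn2real I powr (1 / p)) else \<infinity>)"

end

(* The multiplier is the Fourier transform of a finite signed measure, so the operator is a
   convolution that is bounded on every L^p.

   Write lam_a for the negative of the exponent of order a and h_t = exp(-t lam_alpha). The norm of m is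
   the best constant C in |int phi m| <= C sup |F phi|, which makes no reference to a measure and is
   visibly stable under products, pointwise limits and mixtures. Let d be the dimension.

   (1) ||(1 - e^{i<v,.>}) h_1|| = O(|v|^{1/(d+1)}): cut the law in space at radius R with a Gaussian. The
   near part has a density of size int |xi| h_1 times |v|, integrated over a ball of volume R^d; the far
   part is O(1/R). Take R = |v|^{-1/(d+1)}. Writing h_1 as a power of h_{1/(2d+2)} and multiplying,
   ||(1 - cos<v,.>)^{d+1} h_1|| = O(|v|^2).
   (2) lam_beta is a positive combination of the functions (1 - cos<ry,.>)^{d+1} with weight
   r^{-1-beta} dr, so lam_beta h_1 has finite norm D, and ||lam_beta h_t|| <= D t^{-beta/alpha} by scaling.
   (3) ||1/(v + lam_beta)|| <= 1/v. With L = 1 + lam_beta, L^s is a mixture of L/(u + L) with weight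
   u^{s-1} du, and ||L/(u + L) h_t|| <= min(2, A/u) for A = 1 + D t^{-beta/alpha}, so
   ||L^s h_t|| = O(A^s).
   (4) (1 + lam_alpha)^{-(alpha-1)/alpha} is a Gamma mixture of e^{-t} h_t. For s = (beta-1)/beta the
   resulting t-integral converges at 0 because beta < alpha. *)

theory Submission
  imports Defs
begin


section \<open>Functions with bounded Fourier--Stieltjes norm\<close>

text \<open>The multiplier is O(|\<xi>|^(\<beta> - \<alpha>)) at infinity, so the obstacle is not
  growth but roughness: for a general \<sigma> the exponents have little smoothness away from the
  origin, and conditions on derivatives of the symbol are avoided. Positivity, homogeneity and the
  comparison of lam_alpha with |\<xi>|^\<alpha> take their place.

  The power d + 1 is forced by the crude gain |v|^(1/(d+1)) of one difference. As 1 - cos is half a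
  product of two differences, it gains only |v|^(2/(d+1)), which r^(-1-\<beta>) dr does not
  integrate at 0 when d \<ge> 2; its power d + 1 gains |v|^2, and \<beta> < 2 suffices. The change
  of kernel is harmless: by homogeneity the radial integral is still a multiple of
  |<\<xi>,y>|^\<beta>.

  The fractional power is the second difficulty, since lam_beta alone is unbounded and only its
  product with h_t has finite norm. Splitting L^s over u lets each u choose between a bound ignoring
  the smoothing, 2, and one using it, A/u; the crossover near u = A produces A^s. Near t = 0 this is
  t^(-(\<beta>-1)/\<alpha>) against t^((\<alpha>-1)/\<alpha> - 1) dt.\<close>

lemma integral_swap_product_bound:
  fixes f :: "'x \<Rightarrow> 'y \<Rightarrow> 'c::{banach, second_countable_topology}"
  assumes "sigma_finite_measure M" "sigma_finite_measure N"
    and f: "(\<lambda>p. f (fst p) (snd p)) \<in> borel_measurable (M \<Otimes>\<^sub>M N)"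
    and a: "integrable M a" and b: "integrable N b"
    and le: "\<And>x y. x \<in> space M \<Longrightarrow> y \<in> space N \<Longrightarrow> norm (f x y) \<le> a x * b y"
  shows "(\<integral>x. (\<integral>y. f x y \<partial>N) \<partial>M) = (\<integral>y. (\<integral>x. f x y \<partial>M) \<partial>N)"
    and "integrable M (\<lambda>x. \<integral>y. f x y \<partial>N)"
    and "integrable N (\<lambda>y. \<integral>x. f x y \<partial>M)"
proof -
  interpret M: sigma_finite_measure M by fact
  interpret N: sigma_finite_measure N by fact
  interpret P: pair_sigma_finite M N ..
  have [measurable]: "a \<in> borel_measurable M" "b \<in> borel_measurable N"
    using a b by auto
  have ab: "integrable (M \<Otimes>\<^sub>M N) (\<lambda>p. a (fst p) * b (snd p))"
  proof (rule P.Fubini_integrable)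
    show "AE x in M. integrable N (\<lambda>y. a (fst (x, y)) * b (snd (x, y)))"
      using b by simp
    show "integrable M (\<lambda>x. \<integral>y. norm (a (fst (x, y)) * b (snd (x, y))) \<partial>N)"
      using a by (simp add: norm_mult abs_mult)
  qed measurable
  have int: "integrable (M \<Otimes>\<^sub>M N) (\<lambda>(x, y). f x y)"
    unfolding case_prod_unfold
    by (rule Bochner_Integration.integrable_bound[OF ab f])
       (auto intro!: AE_I2 order_trans[OF le] abs_ge_self simp: space_pair_measure)
  show "(\<integral>x. (\<integral>y. f x y \<partial>N) \<partial>M) = (\<integral>y. (\<integral>x. f x y \<partial>M) \<partial>N)"
    using P.Fubini_integral[OF int] by simp
  show "integrable M (\<lambda>x. \<integral>y. f x y \<partial>N)"
    using P.integrable_fst'[OF int] by simp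
  show "integrable N (\<lambda>y. \<integral>x. f x y \<partial>M)"
    using P.integrable_snd[OF int] by simp
qed

text \<open>Dual form of: \<open>m\<close> is the Fourier transform of a complex measure of total variation
  at most \<open>C\<close>.\<close>

definition fs_bound :: "real \<Rightarrow> ('a::euclidean_space \<Rightarrow> complex) \<Rightarrow> bool" where
  "fs_bound C m \<longleftrightarrow>
     0 \<le> C \<and> m \<in> borel_measurable borel \<and> (\<forall>\<xi>. cmod (m \<xi>) \<le> C) \<and>
     (\<forall>\<phi> S. integrable lborel \<phi> \<longrightarrow> (\<forall>y. cmod (fourier \<phi> y) \<le> S) \<longrightarrow>
        cmod (CLINT \<xi>|lborel. \<phi> \<xi> * m \<xi>) \<le> C * S)"

text \<open>Every admissible \<open>S\<close> dominates a modulus, so \<open>0 \<le> S\<close> comes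
  for free and may be assumed when a bound is established. The pointwise bound is a separate
  requirement because the duality condition sees \<open>m\<close> only up to null sets.\<close>

lemma fs_boundI:
  assumes "0 \<le> C" "m \<in> borel_measurable borel" "\<And>\<xi>. cmod (m \<xi>) \<le> C"
    and "\<And>\<phi> S. integrable lborel \<phi> \<Longrightarrow> 0 \<le> S \<Longrightarrow> (\<And>y. cmod (fourier \<phi> y) \<le> S) \<Longrightarrow>
        cmod (CLINT \<xi>|lborel. \<phi> \<xi> * m \<xi>) \<le> C * S"
  shows "fs_bound C m"
  unfolding fs_bound_def using assms order_trans[OF norm_ge_zero] by blast

lemma
  assumes "fs_bound C m"
  shows fs_bound_nonneg: "0 \<le> C"
    and fs_bound_measurable: "m \<in> borel_measurable borel"
    and fs_bound_cmod: "cmod (m \<xi>) \<le> C"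
    and fs_bound_integral: "integrable lborel \<phi> \<Longrightarrow> (\<And>y. cmod (fourier \<phi> y) \<le> S) \<Longrightarrow>
        cmod (CLINT \<xi>|lborel. \<phi> \<xi> * m \<xi>) \<le> C * S"
  using assms unfolding fs_bound_def by auto

lemma integrable_mult_bounded:
  fixes \<phi> m :: "'a::euclidean_space \<Rightarrow> complex"
  assumes \<phi>: "integrable lborel \<phi>" and m[measurable]: "m \<in> borel_measurable borel"
    and le: "\<And>\<xi>. cmod (m \<xi>) \<le> C"
  shows "integrable lborel (\<lambda>\<xi>. \<phi> \<xi> * m \<xi>)"
proof -
  have [measurable]: "\<phi> \<in> borel_measurable borel" using \<phi> by auto
  have "integrable lborel (\<lambda>\<xi>. C * cmod (\<phi> \<xi>))" using \<phi> by auto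
  then show ?thesis
    by (rule Bochner_Integration.integrable_bound)
       (auto intro!: AE_I2 order_trans[OF _ abs_ge_self] mult_left_mono le simp: norm_mult mult.commute[of C])
qed

lemma fs_bound_integrable:
  "integrable lborel \<phi> \<Longrightarrow> fs_bound C m \<Longrightarrow> integrable lborel (\<lambda>\<xi>. \<phi> \<xi> * m \<xi>)"
  using integrable_mult_bounded fs_bound_measurable fs_bound_cmod by blast

lemma integrable_mult_iexp:
  fixes \<phi> :: "'a::euclidean_space \<Rightarrow> complex"
  assumes "integrable lborel \<phi>"
  shows "integrable lborel (\<lambda>\<xi>. \<phi> \<xi> * iexp (\<xi> \<bullet> y))"
  by (rule integrable_mult_bounded[OF assms, of _ 1]) auto

lemma fourier_mult_iexp: "fourier (\<lambda>\<xi>. \<phi> \<xi> * iexp (\<xi> \<bullet> z)) y = fourier \<phi> (y - z)"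
  unfolding fourier_def by (simp add: inner_diff_right mult_exp_exp algebra_simps)

lemma fs_bound_mono: "fs_bound C m \<Longrightarrow> C \<le> D \<Longrightarrow> fs_bound D m"
  by (rule fs_boundI)
     (auto intro: order_trans[OF fs_bound_cmod] order_trans[OF fs_bound_integral] mult_right_mono
        order_trans[OF fs_bound_nonneg] dest: fs_bound_measurable)

text \<open>The case of a Dirac mass: pairing with a character evaluates
  \<open>fourier \<phi>\<close> at one point.\<close>

lemma fs_bound_iexp: "fs_bound 1 (\<lambda>\<xi>. iexp (\<xi> \<bullet> y))"
proof (rule fs_boundI)
  fix \<phi> :: "'a \<Rightarrow> complex" and S
  assume "\<And>y. cmod (fourier \<phi> y) \<le> S"
  from this[of "-y"] show "cmod (CLINT \<xi>|lborel. \<phi> \<xi> * iexp (\<xi> \<bullet> y)) \<le> 1 * S"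
    by (simp add: fourier_def)
qed auto

lemma fs_bound_add:
  assumes "fs_bound C m" "fs_bound D n"
  shows "fs_bound (C + D) (\<lambda>\<xi>. m \<xi> + n \<xi>)"
proof (rule fs_boundI)
  show "cmod (m \<xi> + n \<xi>) \<le> C + D" for \<xi>
    using fs_bound_cmod[OF assms(1)] fs_bound_cmod[OF assms(2)]
    by (meson add_mono norm_triangle_ineq order_trans)
  fix \<phi> :: "'a \<Rightarrow> complex" and S
  assume \<phi>: "integrable lborel \<phi>" "\<And>y. cmod (fourier \<phi> y) \<le> S"
  have "(CLINT \<xi>|lborel. \<phi> \<xi> * (m \<xi> + n \<xi>)) = (CLINT \<xi>|lborel. \<phi> \<xi> * m \<xi>) + (CLINT \<xi>|lborel. \<phi> \<xi> * n \<xi>)"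
    using fs_bound_integrable[OF \<phi>(1) assms(1)] fs_bound_integrable[OF \<phi>(1) assms(2)] by (simp add: distrib_left)
  also have "cmod \<dots> \<le> C * S + D * S"
    using fs_bound_integral[OF assms(1) \<phi>] fs_bound_integral[OF assms(2) \<phi>]
    by (meson add_mono norm_triangle_ineq order_trans)
  finally show "cmod (CLINT \<xi>|lborel. \<phi> \<xi> * (m \<xi> + n \<xi>)) \<le> (C + D) * S"
    by (simp add: algebra_simps)
qed (use assms in \<open>auto intro: add_nonneg_nonneg borel_measurable_add fs_bound_nonneg fs_bound_measurable\<close>)

text \<open>Convolution of measures in dual form. Modulating \<open>\<phi>\<close> only translates
  \<open>fourier \<phi>\<close>, so the bound for \<open>n\<close> holds at every point of the
  transform of \<open>\<phi> * n\<close>; the bound for \<open>m\<close> is then applied to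
  \<open>\<phi> * n\<close> as test function.\<close>

lemma fs_bound_mult:
  assumes "fs_bound C m" "fs_bound D n"
  shows "fs_bound (C * D) (\<lambda>\<xi>. m \<xi> * n \<xi>)"
proof (rule fs_boundI)
  show "cmod (m \<xi> * n \<xi>) \<le> C * D" for \<xi>
    using fs_bound_cmod[OF assms(1)] fs_bound_cmod[OF assms(2)] fs_bound_nonneg[OF assms(1)]
    by (simp add: norm_mult mult_mono)
  fix \<phi> :: "'a \<Rightarrow> complex" and S
  assume \<phi>: "integrable lborel \<phi>" "\<And>y. cmod (fourier \<phi> y) \<le> S"
  have "cmod (fourier (\<lambda>\<xi>. \<phi> \<xi> * n \<xi>) y) \<le> D * S" for y
  proof -
    have "fourier (\<lambda>\<xi>. \<phi> \<xi> * n \<xi>) y = (CLINT \<xi>|lborel. (\<phi> \<xi> * iexp (\<xi> \<bullet> (- y))) * n \<xi>)"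
      unfolding fourier_def by (simp add: ac_simps)
    also have "cmod \<dots> \<le> D * S"
      using assms(2) integrable_mult_iexp[OF \<phi>(1)]
      by (rule fs_bound_integral) (simp only: fourier_mult_iexp \<phi>)
    finally show ?thesis .
  qed
  with assms(1) fs_bound_integrable[OF \<phi>(1) assms(2)]
  have "cmod (CLINT \<xi>|lborel. (\<phi> \<xi> * n \<xi>) * m \<xi>) \<le> C * (D * S)"
    by (rule fs_bound_integral)
  then show "cmod (CLINT \<xi>|lborel. \<phi> \<xi> * (m \<xi> * n \<xi>)) \<le> C * D * S"
    by (simp add: ac_simps)
qed (use assms in \<open>auto intro: mult_nonneg_nonneg borel_measurable_times fs_bound_nonneg fs_bound_measurable\<close>)

lemma fs_bound_const: "fs_bound (cmod c) (\<lambda>\<xi>. c)"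
proof (rule fs_boundI)
  fix \<phi> :: "'a \<Rightarrow> complex" and S
  assume "\<And>y. cmod (fourier \<phi> y) \<le> S"
  from this[of 0] show "cmod (CLINT \<xi>|lborel. \<phi> \<xi> * c) \<le> cmod c * S"
    
    using mult_left_mono[OF _ norm_ge_zero[of c]] by (simp add: fourier_def norm_mult mult.commute[of _ "cmod c"])
qed auto

lemma fs_bound_zero: "fs_bound 0 (\<lambda>\<xi>. 0)"
  using fs_bound_const[of 0] by simp

lemma fs_bound_cmult: "fs_bound C m \<Longrightarrow> fs_bound (cmod c * C) (\<lambda>\<xi>. c * m \<xi>)"
  by (rule fs_bound_mult[OF fs_bound_const])

lemma fs_bound_one: "fs_bound 1 (\<lambda>\<xi>. 1)"
  using fs_bound_const[of 1] by simp

lemma fs_bound_diff: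
  assumes "fs_bound C m" "fs_bound D n"
  shows "fs_bound (C + D) (\<lambda>\<xi>. m \<xi> - n \<xi>)"
  using fs_bound_add[OF assms(1) fs_bound_cmult[OF assms(2), of "-1"]] by simp

lemma fs_bound_power: "fs_bound C m \<Longrightarrow> fs_bound (C ^ k) (\<lambda>\<xi>. m \<xi> ^ k)"
  by (induction k) (auto intro: fs_bound_one fs_bound_mult)

lemma fs_bound_sum:
  "(\<And>i. i \<in> I \<Longrightarrow> fs_bound (C i) (m i)) \<Longrightarrow> fs_bound (\<Sum>i\<in>I. C i) (\<lambda>\<xi>. \<Sum>i\<in>I. m i \<xi>)"
proof (induction I rule: infinite_finite_induct)
  case (insert x F)
  then show ?case using fs_bound_add[of "C x" "m x"] by simp
qed (use fs_bound_const[of 0] in auto)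

text \<open>Against a fixed \<open>\<phi>\<close> the pairings converge by dominated convergence
  with majorant \<open>C * cmod (\<phi> \<xi>)\<close>. This replaces weak compactness of
  measures.\<close>

lemma fs_bound_lim:
  assumes m: "\<And>n::nat. fs_bound C (m n)" and lim: "\<And>\<xi>. (\<lambda>n. m n \<xi>) \<longlonglongrightarrow> l \<xi>"
  shows "fs_bound C l"
proof (rule fs_boundI)
  note m[THEN fs_bound_measurable, measurable]
  show l[measurable]: "l \<in> borel_measurable borel"
    by (rule borel_measurable_LIMSEQ_metric[OF _ lim]) measurable
  show "cmod (l \<xi>) \<le> C" for \<xi>
    by (rule LIMSEQ_le_const2[OF tendsto_norm[OF lim]]) (use fs_bound_cmod[OF m] in auto)
  fix \<phi> :: "'a \<Rightarrow> complex" and S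
  assume \<phi>: "integrable lborel \<phi>" "\<And>y. cmod (fourier \<phi> y) \<le> S"
  have [measurable]: "\<phi> \<in> borel_measurable borel" using \<phi> by auto
  have "(\<lambda>n. CLINT \<xi>|lborel. \<phi> \<xi> * m n \<xi>) \<longlonglongrightarrow> (CLINT \<xi>|lborel. \<phi> \<xi> * l \<xi>)"
  proof (rule integral_dominated_convergence[where w="\<lambda>\<xi>. cmod (\<phi> \<xi>) * C"])
    show "integrable lborel (\<lambda>\<xi>. cmod (\<phi> \<xi>) * C)" using \<phi> by auto
    show "AE \<xi> in lborel. (\<lambda>n. \<phi> \<xi> * m n \<xi>) \<longlonglongrightarrow> \<phi> \<xi> * l \<xi>"
      by (auto intro!: tendsto_mult lim)
    show "AE \<xi> in lborel. norm (\<phi> \<xi> * m n \<xi>) \<le> cmod (\<phi> \<xi>) * C" for n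
      by (auto simp: norm_mult intro!: mult_left_mono fs_bound_cmod[OF m])
  qed auto
  from tendsto_norm[OF this] show "cmod (CLINT \<xi>|lborel. \<phi> \<xi> * l \<xi>) \<le> C * S"
    by (rule LIMSEQ_le_const2) (use fs_bound_integral[OF m \<phi>] in auto)
qed (use fs_bound_nonneg[OF m] in auto)

lemma fs_bound_mixture:
  fixes m :: "'t \<Rightarrow> 'a::euclidean_space \<Rightarrow> complex"
  assumes M: "sigma_finite_measure M"
    and m: "\<And>t. t \<in> space M \<Longrightarrow> fs_bound (c t) (m t)"
    and meas[measurable]: "(\<lambda>p. m (fst p) (snd p)) \<in> borel_measurable (M \<Otimes>\<^sub>M borel)"
    and c: "integrable M c"
  shows "fs_bound (\<integral>t. c t \<partial>M) (\<lambda>\<xi>. \<integral>t. m t \<xi> \<partial>M)"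
proof (rule fs_boundI)
  interpret M: sigma_finite_measure M by fact
  have meas'[measurable]: "(\<lambda>(x, t). m t x) \<in> borel_measurable (borel \<Otimes>\<^sub>M M)"
    using measurable_compose[OF measurable_pair_swap' meas] by (simp add: case_prod_unfold)
  show "(\<lambda>\<xi>. \<integral>t. m t \<xi> \<partial>M) \<in> borel_measurable borel"
    by (rule M.borel_measurable_lebesgue_integral) measurable
  show "0 \<le> (\<integral>t. c t \<partial>M)"
    by (rule integral_nonneg_AE) (use fs_bound_nonneg[OF m] in auto)
  \<comment> \<open>Applied twice: at a fixed frequency with \<open>S = 1\<close>, where
    \<open>h\<close> is known to be measurable, and to the pairings with \<open>\<phi>\<close>,
    where Fubini supplies integrability. Hence the disjunction.\<close>
  have bnd: "norm (\<integral>t. h t \<partial>M) \<le> (\<integral>t. c t * S \<partial>M)"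
    if "\<And>t. t \<in> space M \<Longrightarrow> norm (h t) \<le> c t * S" "integrable M h \<or> h \<in> borel_measurable M"
    for h :: "'t \<Rightarrow> complex" and S
  proof -
    have h: "integrable M h"
      by (rule Bochner_Integration.integrable_bound[of M "\<lambda>t. c t * S"])
         (use c that in \<open>auto intro!: AE_I2 intro: order_trans[OF _ abs_ge_self]\<close>)
    have "norm (\<integral>t. h t \<partial>M) \<le> (\<integral>t. norm (h t) \<partial>M)" by simp
    also have "\<dots> \<le> (\<integral>t. c t * S \<partial>M)"
      by (rule integral_mono) (use h c that in auto)
    finally show ?thesis .
  qed
  show "cmod (\<integral>t. m t \<xi> \<partial>M) \<le> (\<integral>t. c t \<partial>M)" for \<xi>
    using bnd[of "\<lambda>t. m t \<xi>" 1] fs_bound_cmod[OF m, of _ \<xi>] by auto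
  fix \<phi> :: "'a \<Rightarrow> complex" and S
  assume \<phi>: "integrable lborel \<phi>" "\<And>y. cmod (fourier \<phi> y) \<le> S"
  have [measurable]: "\<phi> \<in> borel_measurable borel" using \<phi> by auto
  have meas2: "(\<lambda>p. \<phi> (fst p) * m (snd p) (fst p)) \<in> borel_measurable (lborel \<Otimes>\<^sub>M M)"
  proof -
    have "(\<lambda>p. \<phi> (fst p) * (\<lambda>(x, t). m t x) p) \<in> borel_measurable (borel \<Otimes>\<^sub>M M)"
      by (rule borel_measurable_times[OF _ meas']) measurable
    then show ?thesis by (simp add: case_prod_unfold cong: measurable_cong_sets sets_pair_measure_cong)
  qed
  note sw = integral_swap_product_bound[OF sigma_finite_lborel M meas2, of "\<lambda>\<xi>. cmod (\<phi> \<xi>)" c]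
  have "(CLINT \<xi>|lborel. \<phi> \<xi> * (\<integral>t. m t \<xi> \<partial>M)) = (CLINT \<xi>|lborel. \<integral>t. \<phi> \<xi> * m t \<xi> \<partial>M)"
    by simp
  also have "\<dots> = (\<integral>t. (CLINT \<xi>|lborel. \<phi> \<xi> * m t \<xi>) \<partial>M)"
    by (rule sw) (use \<phi> c in \<open>auto simp: norm_mult intro!: mult_left_mono fs_bound_cmod[OF m]\<close>)
  also have "cmod \<dots> \<le> (\<integral>t. c t * S \<partial>M)"
  proof (rule bnd)
    have "integrable M (\<lambda>t. CLINT \<xi>|lborel. \<phi> \<xi> * m t \<xi>)"
      by (rule sw) (use \<phi> c in \<open>auto simp: norm_mult intro!: mult_left_mono fs_bound_cmod[OF m]\<close>)
    then show "integrable M (\<lambda>t. CLINT \<xi>|lborel. \<phi> \<xi> * m t \<xi>) \<or>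
      (\<lambda>t. CLINT \<xi>|lborel. \<phi> \<xi> * m t \<xi>) \<in> borel_measurable M" by simp
  qed (use fs_bound_integral[OF m \<phi>] in auto)
  finally show "cmod (CLINT \<xi>|lborel. \<phi> \<xi> * (\<integral>t. m t \<xi> \<partial>M)) \<le> (\<integral>t. c t \<partial>M) * S"
    by simp
qed

section \<open>Invariance under dilations\<close>

lemma
  fixes f :: "'a::euclidean_space \<Rightarrow> 'c::{banach, second_countable_topology}"
  assumes "c \<noteq> 0"
  shows integrable_lborel_scaleR: "integrable lborel f \<Longrightarrow> integrable lborel (\<lambda>x. f (c *\<^sub>R x))"
    and integral_lborel_scaleR: "f \<in> borel_measurable borel \<Longrightarrow>
      (\<integral>x. f x \<partial>lborel) = \<bar>c\<bar> ^ DIM('a) *\<^sub>R (\<integral>x. f (c *\<^sub>R x) \<partial>lborel)"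
proof -
  have eq: "lborel = density (distr lborel borel (\<lambda>x::'a. c *\<^sub>R x)) (\<lambda>_. ennreal (\<bar>c\<bar>^DIM('a)))"
    using lborel_affine[OF assms, of "0::'a"] by simp
  have 1: "integrable lborel f \<longleftrightarrow> integrable lborel (\<lambda>x. \<bar>c\<bar>^DIM('a) *\<^sub>R f (c *\<^sub>R x))"
    if [measurable]: "f \<in> borel_measurable borel"
    by (subst (1) eq) (simp add: integrable_density integrable_distr_eq)
  show "integrable lborel (\<lambda>x. f (c *\<^sub>R x))" if f: "integrable lborel f"
  proof -
    have [measurable]: "f \<in> borel_measurable borel" using f by auto
    from 1 f have "integrable lborel (\<lambda>x. \<bar>c\<bar>^DIM('a) *\<^sub>R f (c *\<^sub>R x))" by simp
    from integrable_scaleR_right[OF this, of "1 / \<bar>c\<bar>^DIM('a)"] show ?thesis using assms by simp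
  qed
  show "(\<integral>x. f x \<partial>lborel) = \<bar>c\<bar> ^ DIM('a) *\<^sub>R (\<integral>x. f (c *\<^sub>R x) \<partial>lborel)"
    if [measurable]: "f \<in> borel_measurable borel"
    by (subst (1) eq) (simp add: integral_density integral_distr)
qed

text \<open>The Jacobian \<open>k\<close> enters the pairing and the transform of the rescaled test
  function alike and cancels, so the constant does not depend on \<open>c\<close>. Together with
  homogeneity this carries bounds at time 1 to all times.\<close>

lemma fs_bound_dilate:
  fixes m :: "'a::euclidean_space \<Rightarrow> complex"
  assumes m: "fs_bound C m" and c: "c \<noteq> 0"
  shows "fs_bound C (\<lambda>\<xi>. m (c *\<^sub>R \<xi>))"
proof (rule fs_boundI)
  note [measurable] = fs_bound_measurable[OF m]
  show "(\<lambda>\<xi>. m (c *\<^sub>R \<xi>)) \<in> borel_measurable borel" by measurable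
  fix \<phi> :: "'a \<Rightarrow> complex" and S
  assume \<phi>: "integrable lborel \<phi>" "0 \<le> S" "\<And>y. cmod (fourier \<phi> y) \<le> S"
  define k where "k = \<bar>1 / c\<bar> ^ DIM('a)"
  have k: "k > 0" using c by (simp add: k_def)
  have [measurable]: "\<phi> \<in> borel_measurable borel" using \<phi> by auto
  define \<phi>' where "\<phi>' \<xi> = \<phi> ((1 / c) *\<^sub>R \<xi>)" for \<xi>
  have [measurable]: "\<phi>' \<in> borel_measurable borel" unfolding \<phi>'_def by measurable
  have i: "integrable lborel \<phi>'"
    unfolding \<phi>'_def by (rule integrable_lborel_scaleR) (use c \<phi> in auto)
  have eq: "(CLINT \<xi>|lborel. \<phi> \<xi> * g (c *\<^sub>R \<xi>)) = k *\<^sub>R (CLINT \<xi>|lborel. \<phi>' \<xi> * g \<xi>)"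
    if [measurable]: "g \<in> borel_measurable borel" for g
    unfolding k_def \<phi>'_def using c by (subst integral_lborel_scaleR[of "1/c"]) auto
  have "cmod (fourier \<phi>' y) \<le> S / k" for y
  proof -
    have "fourier \<phi> (c *\<^sub>R y) = k *\<^sub>R fourier \<phi>' y"
      using eq[of "\<lambda>\<xi>. iexp (- (\<xi> \<bullet> y))"] by (simp add: fourier_def)
    then have "k * cmod (fourier \<phi>' y) \<le> S"
      using \<phi>(3)[of "c *\<^sub>R y"] k by simp
    then show ?thesis using k by (simp add: field_simps)
  qed
  from fs_bound_integral[OF m i this] show "cmod (CLINT \<xi>|lborel. \<phi> \<xi> * m (c *\<^sub>R \<xi>)) \<le> C * S"
    using k by (subst eq) (auto simp: field_simps)
qed (use assms in \<open>auto dest: fs_bound_nonneg fs_bound_cmod\<close>)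

section \<open>Gaussian regularisation and the transfer to Lebesgue spaces\<close>

lemma
  fixes f :: "'a::euclidean_space \<Rightarrow> real \<Rightarrow> complex"
  assumes f: "\<And>b. b \<in> Basis \<Longrightarrow> integrable lborel (f b)"
  shows integrable_lborel_prod: "integrable lborel (\<lambda>x. \<Prod>b\<in>Basis. f b (x \<bullet> b))"
    and integral_lborel_prod:
      "(\<integral>x. (\<Prod>b\<in>Basis. f b (x \<bullet> b)) \<partial>lborel) = (\<Prod>b\<in>Basis. \<integral>x. f b x \<partial>lborel)"
proof -
  interpret product_sigma_finite "\<lambda>_::'a. lborel :: real measure" by standard
  have [measurable]: "b \<in> Basis \<Longrightarrow> f b \<in> borel_measurable borel" for b using f by force
  have m[measurable]: "(\<lambda>x. \<Prod>b\<in>Basis. f b (x \<bullet> b)) \<in> borel_measurable borel" by measurable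
  have t[measurable]: "(\<lambda>g. \<Sum>b\<in>Basis. g b *\<^sub>R b) \<in> (\<Pi>\<^sub>M b\<in>Basis. lborel) \<rightarrow>\<^sub>M (borel :: 'a measure)"
    by measurable
  have eq: "(\<Prod>b\<in>Basis. f b ((\<Sum>b\<in>Basis. g b *\<^sub>R b) \<bullet> b)) = (\<Prod>b\<in>Basis. f b (g b))" for g
    by (intro prod.cong) (auto simp: inner_sum_left inner_Basis if_distrib cong: if_cong)
  show "integrable lborel (\<lambda>x. \<Prod>b\<in>Basis. f b (x \<bullet> b))"
    unfolding lborel_eq[where 'a='a]
    by (subst integrable_distr_eq[OF t m]) (simp add: eq product_integrable_prod f)
  show "(\<integral>x. (\<Prod>b\<in>Basis. f b (x \<bullet> b)) \<partial>lborel) = (\<Prod>b\<in>Basis. \<integral>x. f b x \<partial>lborel)"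
    unfolding lborel_eq[where 'a='a]
    by (subst integral_distr[OF t m]) (simp add: eq product_integral_prod f)
qed

lemma norm_power2_Basis: "(norm (x::'a::euclidean_space))\<^sup>2 = (\<Sum>b\<in>Basis. (x \<bullet> b)\<^sup>2)"
  by (subst power2_norm_eq_inner, subst euclidean_inner) (simp add: power2_eq_square)

lemma std_gauss_integral_real:
  "has_bochner_integral lborel (\<lambda>u::real. complex_of_real (exp (- (u\<^sup>2) / 2)) * iexp (u * t))
     (complex_of_real (sqrt (2 * pi) * exp (- (t\<^sup>2) / 2)))"
proof -
  define c where "c = sqrt (2 * pi)"
  have c: "c > 0" by (simp add: c_def)
  have d: "c * std_normal_density u = exp (- (u\<^sup>2) / 2)" for u
    using c by (simp add: std_normal_density_def c_def)
  interpret N: prob_space std_normal_distribution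
    by (rule prob_space_normal_density) simp
  have i1: "integrable std_normal_distribution (\<lambda>u. iexp (t * u))"
    by (rule N.integrable_iexp) (simp_all del: of_real_mult)
  have "(CLINT u|std_normal_distribution. iexp (t * u)) = complex_of_real (exp (- (t\<^sup>2) / 2))"
    using fun_cong[OF char_std_normal_distribution, of t] by (simp add: char_def)
  with i1 have i2: "has_bochner_integral std_normal_distribution (\<lambda>u. iexp (t * u)) (complex_of_real (exp (- (t\<^sup>2) / 2)))"
    by (simp add: has_bochner_integral_iff)
  have "has_bochner_integral lborel (\<lambda>u. std_normal_density u *\<^sub>R iexp (t * u)) (complex_of_real (exp (- (t\<^sup>2) / 2)))"
    using i2 by (simp add: has_bochner_integral_iff integrable_density integral_density normal_density_nonneg)
  from has_bochner_integral_scaleR_right[OF this, of c] show ?thesis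
    unfolding c_def[symmetric] d[symmetric]
    by (simp add: scaleR_conv_of_real mult.commute[of "complex_of_real t"] mult.assoc)
qed

text \<open>The parameter is an inverse standard deviation and there is no normalising factor:
  \<open>gauss s\<close> tends to 1 pointwise as \<open>s\<close> tends to 0. It serves as
  summability factor in frequency and, with \<open>s = 1 / R\<close>, as smooth cutoff at radius
  \<open>R\<close> in space.\<close>

definition gauss :: "real \<Rightarrow> 'a::euclidean_space \<Rightarrow> real" where
  "gauss s x = exp (- (norm (s *\<^sub>R x))\<^sup>2 / 2)"

lemma gauss_pos: "0 < gauss s x" and gauss_le_1: "gauss s x \<le> 1"
  by (auto simp: gauss_def)

lemma borel_measurable_gauss[measurable]: "gauss s \<in> borel_measurable borel"
  unfolding gauss_def[abs_def] by measurable

lemma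
  fixes x :: "'a::euclidean_space"
  assumes s: "s > 0"
  shows gauss_integrable: "integrable lborel (gauss s :: 'a \<Rightarrow> real)"
    and gauss_transform: "(CLINT \<xi>|lborel. complex_of_real (gauss s \<xi>) * iexp (\<xi> \<bullet> x)) =
      complex_of_real ((sqrt (2 * pi) / s) ^ DIM('a) * gauss (1 / s) x)"
proof -
  have prodeq: "complex_of_real (gauss 1 \<xi>) * iexp (\<xi> \<bullet> x) =
      (\<Prod>b\<in>Basis. complex_of_real (exp (- ((\<xi> \<bullet> b)\<^sup>2) / 2)) * iexp ((\<xi> \<bullet> b) * (x \<bullet> b)))" for \<xi> x :: 'a
    unfolding gauss_def prod.distrib of_real_prod[symmetric] exp_sum[OF finite_Basis, symmetric]
    by (subst euclidean_inner) (simp add: norm_power2_Basis sum_negf sum_divide_distrib sum_distrib_left)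
  have i: "integrable lborel (\<lambda>u. complex_of_real (exp (- (u\<^sup>2) / 2)) * iexp (u * t))" for t
    using std_gauss_integral_real[of t] by (simp add: has_bochner_integral_iff)
  have I: "integrable lborel (\<lambda>\<xi>::'a. complex_of_real (gauss 1 \<xi>) * iexp (\<xi> \<bullet> x))" for x :: 'a
    unfolding prodeq by (rule integrable_lborel_prod) (rule i)
  have T: "(CLINT \<xi>|lborel. complex_of_real (gauss 1 \<xi>) * iexp (\<xi> \<bullet> x)) =
      complex_of_real (sqrt (2 * pi) ^ DIM('a) * gauss 1 x)" for x :: 'a
  proof -
    have "(CLINT \<xi>|lborel. complex_of_real (gauss 1 \<xi>) * iexp (\<xi> \<bullet> x)) =
        (\<Prod>b\<in>Basis. complex_of_real (sqrt (2 * pi) * exp (- ((x \<bullet> b)\<^sup>2) / 2)))"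
      unfolding prodeq
      by (subst integral_lborel_prod) (use i std_gauss_integral_real in \<open>auto simp: has_bochner_integral_iff\<close>)
    also have "\<dots> = complex_of_real (sqrt (2 * pi) ^ DIM('a) * gauss 1 x)"
      unfolding of_real_prod[symmetric] prod.distrib exp_sum[OF finite_Basis, symmetric] gauss_def
      by (simp add: norm_power2_Basis sum_negf sum_divide_distrib)
    finally show ?thesis .
  qed
  have gs: "gauss s x = gauss 1 (s *\<^sub>R x)" for x :: 'a by (simp add: gauss_def)
  have I0: "integrable lborel (\<lambda>\<xi>::'a. complex_of_real (gauss 1 \<xi>))" using I[of 0] by simp
  have "integrable lborel (\<lambda>\<xi>::'a. complex_of_real (gauss 1 (s *\<^sub>R \<xi>)))"
    using integrable_lborel_scaleR[OF _ I0, of s] s by simp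
  then show "integrable lborel (gauss s :: 'a \<Rightarrow> real)"
    by (simp add: gs[abs_def] complex_of_real_integrable_eq)
  have "(CLINT \<xi>|lborel. complex_of_real (gauss 1 \<xi>) * iexp (\<xi> \<bullet> (x /\<^sub>R s))) =
     s ^ DIM('a) *\<^sub>R (CLINT \<xi>|lborel. complex_of_real (gauss 1 (s *\<^sub>R \<xi>)) * iexp ((s *\<^sub>R \<xi>) \<bullet> (x /\<^sub>R s)))"
    using s by (subst integral_lborel_scaleR[of s]) auto
  also have "\<dots> = s ^ DIM('a) *\<^sub>R (CLINT \<xi>|lborel. complex_of_real (gauss s \<xi>) * iexp (\<xi> \<bullet> x))"
    using s by (simp add: gs field_simps)
  finally show "(CLINT \<xi>|lborel. complex_of_real (gauss s \<xi>) * iexp (\<xi> \<bullet> x)) =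
      complex_of_real ((sqrt (2 * pi) / s) ^ DIM('a) * gauss (1 / s) x)"
    using s unfolding T gs[of x] by (simp add: gauss_def scaleR_conv_of_real field_simps power_divide)
qed

lemma gauss_integral:
  assumes "s > 0"
  shows "(\<integral>x. gauss s x \<partial>(lborel :: 'a::euclidean_space measure)) = (sqrt (2 * pi) / s) ^ DIM('a)"
proof -
  have "complex_of_real (\<integral>x. gauss s x \<partial>(lborel :: 'a measure)) = complex_of_real ((sqrt (2 * pi) / s) ^ DIM('a))"
    using gauss_transform[OF assms, of "0::'a"] by (simp add: gauss_def)
  then show ?thesis using of_real_eq_iff by blast
qed

lemma
  fixes f :: "'a::euclidean_space \<Rightarrow> ennreal"
  assumes [measurable]: "f \<in> borel_measurable borel"
  shows nn_integral_lborel_diff_left: "(\<integral>\<^sup>+x. f (t - x) \<partial>lborel) = (\<integral>\<^sup>+x. f x \<partial>lborel)"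
    and nn_integral_lborel_diff_right: "(\<integral>\<^sup>+x. f (x - t) \<partial>lborel) = (\<integral>\<^sup>+x. f x \<partial>lborel)"
proof -
  have "(lborel :: 'a measure) = distr lborel borel (\<lambda>x. t - x)"
    using lborel_affine[of "-1" t] by (simp add: density_1)
  then have "(\<integral>\<^sup>+x. f x \<partial>lborel) = (\<integral>\<^sup>+x. f x \<partial>distr lborel borel (\<lambda>x. t - x))" by simp
  then show "(\<integral>\<^sup>+x. f (t - x) \<partial>lborel) = (\<integral>\<^sup>+x. f x \<partial>lborel)"
    by (simp add: nn_integral_distr)
  have "(lborel :: 'a measure) = distr lborel borel (\<lambda>x. x - t)"
    using lborel_affine[of 1 "-t"] by (simp add: density_1)
  then have "(\<integral>\<^sup>+x. f x \<partial>lborel) = (\<integral>\<^sup>+x. f x \<partial>distr lborel borel (\<lambda>x. x - t))" by simp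
  then show "(\<integral>\<^sup>+x. f (x - t) \<partial>lborel) = (\<integral>\<^sup>+x. f x \<partial>lborel)"
    by (simp add: nn_integral_distr)
qed

lemma nn_integral_gauss:
  assumes "s > 0"
  shows "(\<integral>\<^sup>+x. ennreal (gauss s x) \<partial>(lborel :: 'a::euclidean_space measure)) = ennreal ((sqrt (2 * pi) / s) ^ DIM('a))"
  using gauss_integrable[OF assms, where 'a='a] gauss_integral[OF assms, where 'a='a]
  by (subst nn_integral_eq_integral) (auto intro: less_imp_le gauss_pos)

section \<open>Passage from the dual norm to Lebesgue spaces\<close>

text \<open>The multiplication formula for Fourier transforms. The sign \<open>c\<close> covers
  \<open>fourier\<close> (\<open>c = -1\<close>) and the inverse transform (\<open>c = 1\<close>) at
  once.\<close>

lemma integral_kernel_swap: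
  fixes f R :: "'a::euclidean_space \<Rightarrow> complex"
  assumes f: "integrable lborel f" and R: "integrable lborel R"
  shows "(CLINT \<xi>|lborel. (CLINT x|lborel. f x * iexp (c * (x \<bullet> \<xi>))) * R \<xi>) =
    (CLINT x|lborel. f x * (CLINT \<xi>|lborel. R \<xi> * iexp (c * (x \<bullet> \<xi>))))"
proof -
  have [measurable]: "f \<in> borel_measurable borel" "R \<in> borel_measurable borel" using f R by auto
  have "(CLINT \<xi>|lborel. (CLINT x|lborel. f x * iexp (c * (x \<bullet> \<xi>))) * R \<xi>)
      = (CLINT \<xi>|lborel. CLINT x|lborel. f x * iexp (c * (x \<bullet> \<xi>)) * R \<xi>)"
    by simp
  also have "\<dots> = (CLINT x|lborel. CLINT \<xi>|lborel. f x * iexp (c * (x \<bullet> \<xi>)) * R \<xi>)"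
    by (rule integral_swap_product_bound[OF sigma_finite_lborel sigma_finite_lborel _
          integrable_norm[OF R] integrable_norm[OF f]])
       (auto simp: norm_mult ac_simps borel_prod)
  also have "\<dots> = (CLINT x|lborel. f x * (CLINT \<xi>|lborel. R \<xi> * iexp (c * (x \<bullet> \<xi>))))"
    by (subst integral_mult_right_zero[symmetric]) (simp add: ac_simps)
  finally show ?thesis .
qed

lemma norm_integral_le_nn_integral:
  fixes f :: "'x \<Rightarrow> 'c::{banach, second_countable_topology}"
  shows "ennreal (norm (\<integral>x. f x \<partial>M)) \<le> (\<integral>\<^sup>+x. ennreal (norm (f x)) \<partial>M)"
  by (cases "integrable M f") (auto simp: integral_norm_bound_ennreal not_integrable_integral_eq)

lemma borel_measurable_integral_iexp:
  fixes h :: "'a::euclidean_space \<Rightarrow> complex"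
  assumes h[measurable]: "h \<in> borel_measurable borel"
  shows "(\<lambda>y. CLINT \<xi>|lborel. h \<xi> * iexp (c * (\<xi> \<bullet> y))) \<in> borel_measurable (borel :: 'a measure)"
proof -
  have "(\<lambda>(y, \<xi>). h \<xi> * iexp (c * (\<xi> \<bullet> y))) \<in> borel_measurable ((borel :: 'a measure) \<Otimes>\<^sub>M lborel)"
    unfolding case_prod_unfold by measurable
  then show ?thesis by (rule lborel.borel_measurable_lebesgue_integral)
qed

lemma norm_integral_iexp_le:
  fixes h :: "'a::euclidean_space \<Rightarrow> complex"
  assumes "integrable lborel h"
  shows "cmod (CLINT \<xi>|lborel. h \<xi> * iexp (c * (\<xi> \<bullet> y))) \<le> (\<integral>\<xi>. cmod (h \<xi>) \<partial>lborel)"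
  by (rule order_trans[OF integral_norm_bound]) (simp add: norm_mult)


text \<open>The free parameter restores the strength of Hoelder's inequality: fitting
  \<open>\<delta>\<close> to the constant of the multiplier makes the resulting L^p bound exactly
  that constant.\<close>

lemma Youngs_inequality_scaled:
  fixes p q x y \<delta> :: real
  assumes "p > 1" "q > 1" "1 / p + 1 / q = 1" "x \<ge> 0" "y \<ge> 0" "\<delta> > 0"
  shows "x * y \<le> \<delta> powr p / p * x powr p + \<delta> powr (- q) / q * y powr q"
  using Youngs_inequality[of p q "\<delta> * x" "y / \<delta>"] assms
  by (simp add: powr_mult powr_divide powr_minus field_simps)

text \<open>Pairing the multiplier operator with a test function \<open>g\<close> and inserting a Gaussian
  factor turns it into the pairing of \<open>m\<close> with a function whose Fourier transform is a Gaussian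
  average of \<open>f(z) g(x)\<close>; Young's inequality replaces Hoelder's.\<close>

lemma fs_bound_pairing:
  fixes m f g :: "'a::euclidean_space \<Rightarrow> complex"
  assumes m: "fs_bound C m" and f: "integrable lborel f" and g: "integrable lborel g"
    and H: "integrable lborel (\<lambda>\<xi>. fourier f \<xi> * m \<xi>)"
    and pq: "p > 1" "q > 1" "1 / p + 1 / q = 1" and \<delta>: "\<delta> > 0"
    and F: "(\<integral>\<^sup>+x. ennreal (cmod (f x) powr p) \<partial>lborel) = ennreal F" "0 \<le> F"
    and J: "(\<integral>\<^sup>+x. ennreal (cmod (g x) powr q) \<partial>lborel) = ennreal J" "0 \<le> J"
  shows "cmod (CLINT x|lborel. g x * (CLINT \<xi>|lborel. fourier f \<xi> * m \<xi> * iexp (x \<bullet> \<xi>)))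
    \<le> C * (2 * pi) ^ DIM('a) * (\<delta> powr p / p * F + \<delta> powr (- q) / q * J)"
proof -
  note [measurable] = fs_bound_measurable[OF m]
  have fm[measurable]: "f \<in> borel_measurable borel" and gm[measurable]: "g \<in> borel_measurable borel"
    using f g by auto
  define a b where "a = \<delta> powr p / p" and "b = \<delta> powr (- q) / q"
  have ab: "a \<ge> 0" "b \<ge> 0" using pq by (auto simp: a_def b_def)
  define S where "S = (2 * pi) ^ DIM('a) * (a * F + b * J)"
  have S: "S \<ge> 0" using ab F J by (simp add: S_def)
  define G where "G \<xi> = (CLINT x|lborel. g x * iexp (1 * (x \<bullet> \<xi>)))" for \<xi>
  have Gm[measurable]: "G \<in> borel_measurable borel"
    unfolding G_def by (rule borel_measurable_integral_iexp) measurable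
  have Gle: "cmod (G \<xi>) \<le> (\<integral>x. cmod (g x) \<partial>lborel)" for \<xi>
    unfolding G_def by (rule norm_integral_iexp_le[OF g])
  have fouriereq: "fourier f \<xi> = (CLINT x|lborel. f x * iexp (- 1 * (x \<bullet> \<xi>)))" for f :: "'a \<Rightarrow> complex" and \<xi>
    unfolding fourier_def by simp
  have Fm[measurable]: "fourier f \<in> borel_measurable borel"
    unfolding fouriereq[abs_def] by (rule borel_measurable_integral_iexp) measurable
  have Fle: "cmod (fourier f \<xi>) \<le> (\<integral>x. cmod (f x) \<partial>lborel)" for \<xi>
    unfolding fouriereq by (rule norm_integral_iexp_le[OF f])
  have pair: "(CLINT x|lborel. g x * (CLINT \<xi>|lborel. fourier f \<xi> * m \<xi> * iexp (x \<bullet> \<xi>)))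
      = (CLINT \<xi>|lborel. G \<xi> * (fourier f \<xi> * m \<xi>))"
    unfolding G_def integral_kernel_swap[OF g H] by simp
  define s where "s j = 1 / real (Suc j)" for j
  have s: "s j > 0" for j by (simp add: s_def)
  \<comment> \<open>The product \<open>fourier f * G\<close> is bounded but need not be integrable,
    so it is no test function for \<open>fs_bound\<close>. The Gaussian damping makes it one and is
    removed at the end by dominated convergence, with \<open>fourier f * m\<close> supplying the
    majorant.\<close>
  define \<phi> where "\<phi> j \<xi> = fourier f \<xi> * G \<xi> * complex_of_real (gauss (s j) \<xi>)" for j \<xi>
  have GE: "integrable lborel (\<lambda>\<xi>. G \<xi> * complex_of_real (gauss (s j) \<xi>))" for j
    using integrable_mult_bounded[OF _ Gm Gle, of "\<lambda>\<xi>. complex_of_real (gauss (s j) \<xi>)"] gauss_integrable[OF s, where 'a='a]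
    by (simp add: complex_of_real_integrable_eq mult.commute)
  have \<phi>i: "integrable lborel (\<phi> j)" for j
    unfolding \<phi>_def using integrable_mult_bounded[OF GE Fm Fle] by (simp add: ac_simps)
  have "cmod (CLINT \<xi>|lborel. \<phi> j \<xi> * m \<xi>) \<le> C * S" for j
  proof (rule fs_bound_integral[OF m \<phi>i])
    fix y :: 'a
    define R where "R \<xi> = G \<xi> * complex_of_real (gauss (s j) \<xi>) * iexp (- 1 * (\<xi> \<bullet> y))" for \<xi>
    have R: "integrable lborel R"
      unfolding R_def by (rule integrable_mult_bounded[OF GE, of _ 1]) auto
    define c where "c = (sqrt (2 * pi) / s j) ^ DIM('a)"
    \<comment> \<open>The transform of the damping factor. Its mass (2 pi)^d does not depend on
      \<open>j\<close>, which makes the bound \<open>S\<close> uniform in \<open>j\<close>.\<close>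
    define K where "K w = c * gauss (1 / s j) w" for w :: 'a
    have c: "c > 0" using s by (simp add: c_def)
    have K0: "K w \<ge> 0" for w using c gauss_pos[of "1 / s j" w] by (simp add: K_def)
    have [measurable]: "K \<in> borel_measurable borel" unfolding K_def by measurable
    have Kint: "(\<integral>\<^sup>+w. ennreal (K w) \<partial>lborel) = ennreal ((2 * pi) ^ DIM('a))"
    proof -
      have "(\<integral>\<^sup>+w. ennreal (K w) \<partial>lborel) = ennreal c * (\<integral>\<^sup>+w. ennreal (gauss (1 / s j) w) \<partial>(lborel :: 'a measure))"
        unfolding K_def using c by (subst nn_integral_cmult[symmetric]) (auto simp: ennreal_mult' less_imp_le)
      also have "\<dots> = ennreal (c * (sqrt (2 * pi) / (1 / s j)) ^ DIM('a))"
        using c s[of j] by (subst nn_integral_gauss) (auto simp: ennreal_mult')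
      also have "c * (sqrt (2 * pi) / (1 / s j)) ^ DIM('a) = (2 * pi) ^ DIM('a)"
        using s[of j] unfolding c_def power_mult_distrib[symmetric] by simp
      finally show ?thesis .
    qed
    have inner: "(CLINT \<xi>|lborel. R \<xi> * iexp (- 1 * (z \<bullet> \<xi>))) =
        (CLINT x|lborel. g x * complex_of_real (K (x - (y + z))))" for z
    proof -
      define Q where "Q \<xi> = complex_of_real (gauss (s j) \<xi>) * iexp (- 1 * (\<xi> \<bullet> (y + z)))" for \<xi>
      have Q: "integrable lborel Q"
        unfolding Q_def using gauss_integrable[OF s]
        by (intro integrable_mult_bounded[of _ _ 1]) (auto simp: complex_of_real_integrable_eq)
      have "R \<xi> * iexp (- 1 * (z \<bullet> \<xi>)) = G \<xi> * Q \<xi>" for \<xi>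
        by (simp add: R_def Q_def inner_add_right mult_exp_exp inner_commute algebra_simps)
      then have "(CLINT \<xi>|lborel. R \<xi> * iexp (- 1 * (z \<bullet> \<xi>))) = (CLINT \<xi>|lborel. G \<xi> * Q \<xi>)" by simp
      also have "\<dots> = (CLINT x|lborel. g x * (CLINT \<xi>|lborel. Q \<xi> * iexp (1 * (x \<bullet> \<xi>))))"
        unfolding G_def by (rule integral_kernel_swap[OF g Q])
      also have "(\<lambda>x. CLINT \<xi>|lborel. Q \<xi> * iexp (1 * (x \<bullet> \<xi>))) = (\<lambda>x. complex_of_real (K (x - (y + z))))"
      proof
        fix x
        have "Q \<xi> * iexp (1 * (x \<bullet> \<xi>)) = complex_of_real (gauss (s j) \<xi>) * iexp (\<xi> \<bullet> (x - (y + z)))" for \<xi>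
          by (simp add: Q_def inner_diff_right inner_add_right mult_exp_exp inner_commute algebra_simps)
        then show "(CLINT \<xi>|lborel. Q \<xi> * iexp (1 * (x \<bullet> \<xi>))) = complex_of_real (K (x - (y + z)))"
          by (simp only: gauss_transform[OF s]) (simp add: K_def c_def)
      qed
      finally show ?thesis .
    qed
    have "fourier (\<phi> j) y = (CLINT \<xi>|lborel. fourier f \<xi> * R \<xi>)"
      unfolding fouriereq[of "\<phi> j"] \<phi>_def R_def by (simp add: ac_simps)
    also have "\<dots> = (CLINT z|lborel. f z * (CLINT \<xi>|lborel. R \<xi> * iexp (- 1 * (z \<bullet> \<xi>))))"
      unfolding fouriereq[of f] by (rule integral_kernel_swap[OF f R])
    also have "\<dots> = (CLINT z|lborel. CLINT x|lborel. f z * (g x * complex_of_real (K (x - (y + z)))))"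
      unfolding inner by simp
    finally have "ennreal (cmod (fourier (\<phi> j) y)) \<le>
        (\<integral>\<^sup>+z. ennreal (cmod (CLINT x|lborel. f z * (g x * complex_of_real (K (x - (y + z)))))) \<partial>lborel)"
      using norm_integral_le_nn_integral by simp
    also have "\<dots> \<le> (\<integral>\<^sup>+z. \<integral>\<^sup>+x. ennreal (cmod (f z * (g x * complex_of_real (K (x - (y + z)))))) \<partial>lborel \<partial>lborel)"
      by (intro nn_integral_mono norm_integral_le_nn_integral)
    \<comment> \<open>After Young's inequality each summand contains only one of \<open>f z\<close>
      and \<open>g x\<close>, so the other variable is integrated against \<open>K\<close> alone and
      yields the factor (2 pi)^d.\<close>
    also have "\<dots> \<le> (\<integral>\<^sup>+z. \<integral>\<^sup>+x. ennreal (a * cmod (f z) powr p) * ennreal (K (x - (y + z)))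
          + ennreal (b * cmod (g x) powr q) * ennreal (K (x - (y + z))) \<partial>lborel \<partial>lborel)"
    proof (intro nn_integral_mono)
      fix z x
      have "cmod (f z * (g x * complex_of_real (K (x - (y + z))))) = (cmod (f z) * cmod (g x)) * K (x - (y + z))"
        using K0 by (simp add: norm_mult)
      also have "\<dots> \<le> (a * cmod (f z) powr p + b * cmod (g x) powr q) * K (x - (y + z))"
        unfolding a_def b_def by (intro mult_right_mono K0 Youngs_inequality_scaled pq \<delta>) auto
      finally show "ennreal (cmod (f z * (g x * complex_of_real (K (x - (y + z)))))) \<le>
        ennreal (a * cmod (f z) powr p) * ennreal (K (x - (y + z))) +
        ennreal (b * cmod (g x) powr q) * ennreal (K (x - (y + z)))"
        using ab K0 by (simp add: ennreal_mult'[symmetric] ennreal_plus[symmetric] ring_distribs ennreal_leI del: ennreal_plus)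
    qed
    also have "\<dots> = (\<integral>\<^sup>+z. \<integral>\<^sup>+x. ennreal (a * cmod (f z) powr p) * ennreal (K (x - (y + z))) \<partial>lborel \<partial>lborel)
        + (\<integral>\<^sup>+z. \<integral>\<^sup>+x. ennreal (b * cmod (g x) powr q) * ennreal (K (x - (y + z))) \<partial>lborel \<partial>lborel)"
      by (simp add: nn_integral_add)
    also have "(\<integral>\<^sup>+z. \<integral>\<^sup>+x. ennreal (a * cmod (f z) powr p) * ennreal (K (x - (y + z))) \<partial>lborel \<partial>lborel)
       = (\<integral>\<^sup>+z. ennreal (a * cmod (f z) powr p) * ennreal ((2 * pi) ^ DIM('a)) \<partial>lborel)"
      by (intro nn_integral_cong)
         (simp add: nn_integral_cmult nn_integral_lborel_diff_right[of "\<lambda>w. ennreal (K w)"] Kint)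
    also have "\<dots> = ennreal ((2 * pi) ^ DIM('a) * (a * F))"
      using ab F by (simp add: nn_integral_multc nn_integral_cmult ennreal_mult' mult.commute)
    also have "(\<integral>\<^sup>+z. \<integral>\<^sup>+x. ennreal (b * cmod (g x) powr q) * ennreal (K (x - (y + z))) \<partial>lborel \<partial>lborel)
       = (\<integral>\<^sup>+x. \<integral>\<^sup>+z. ennreal (b * cmod (g x) powr q) * ennreal (K (x - (y + z))) \<partial>lborel \<partial>lborel)"
      by (rule lborel_pair.Fubini') (simp add: borel_prod)
    also have "\<dots> = (\<integral>\<^sup>+x. ennreal (b * cmod (g x) powr q) * ennreal ((2 * pi) ^ DIM('a)) \<partial>lborel)"
    proof (intro nn_integral_cong)
      fix x
      have "(\<integral>\<^sup>+z. ennreal (K (x - (y + z))) \<partial>lborel) = (\<integral>\<^sup>+z. ennreal (K ((x - y) - z)) \<partial>lborel)"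
        by (simp add: algebra_simps)
      also have "\<dots> = ennreal ((2 * pi) ^ DIM('a))"
        by (simp add: nn_integral_lborel_diff_left[of "\<lambda>w. ennreal (K w)"] Kint)
      finally show "(\<integral>\<^sup>+z. ennreal (b * cmod (g x) powr q) * ennreal (K (x - (y + z))) \<partial>lborel) =
         ennreal (b * cmod (g x) powr q) * ennreal ((2 * pi) ^ DIM('a))"
        by (simp add: nn_integral_cmult)
    qed
    also have "\<dots> = ennreal ((2 * pi) ^ DIM('a) * (b * J))"
      using ab J by (simp add: nn_integral_multc nn_integral_cmult ennreal_mult' mult.commute)
    also have "ennreal ((2 * pi) ^ DIM('a) * (a * F)) + ennreal ((2 * pi) ^ DIM('a) * (b * J)) = ennreal S"
      using ab F J by (simp add: S_def ennreal_plus[symmetric] ring_distribs del: ennreal_plus)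
    finally show "cmod (fourier (\<phi> j) y) \<le> S" using S by simp
  qed
  moreover have "(\<lambda>j. CLINT \<xi>|lborel. \<phi> j \<xi> * m \<xi>) \<longlonglongrightarrow> (CLINT \<xi>|lborel. G \<xi> * (fourier f \<xi> * m \<xi>))"
  proof (rule integral_dominated_convergence[where w="\<lambda>\<xi>. (\<integral>x. cmod (g x) \<partial>lborel) * cmod (fourier f \<xi> * m \<xi>)"])
    show "integrable lborel (\<lambda>\<xi>. (\<integral>x. cmod (g x) \<partial>lborel) * cmod (fourier f \<xi> * m \<xi>))"
      using H by auto
    show "(\<lambda>\<xi>. \<phi> j \<xi> * m \<xi>) \<in> borel_measurable lborel" for j unfolding \<phi>_def by measurable
    show "AE \<xi> in lborel. norm (\<phi> j \<xi> * m \<xi>) \<le> (\<integral>x. cmod (g x) \<partial>lborel) * cmod (fourier f \<xi> * m \<xi>)" for j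
    proof (rule AE_I2)
      fix \<xi>
      have "norm (\<phi> j \<xi> * m \<xi>) = (cmod (G \<xi>) * gauss (s j) \<xi>) * cmod (fourier f \<xi> * m \<xi>)"
        using gauss_pos[of "s j" \<xi>] by (simp add: \<phi>_def norm_mult)
      also have "\<dots> \<le> ((\<integral>x. cmod (g x) \<partial>lborel) * 1) * cmod (fourier f \<xi> * m \<xi>)"
        using gauss_le_1[of "s j" \<xi>] gauss_pos[of "s j" \<xi>] Gle[of \<xi>]
        by (intro mult_right_mono mult_mono) auto
      finally show "norm (\<phi> j \<xi> * m \<xi>) \<le> (\<integral>x. cmod (g x) \<partial>lborel) * cmod (fourier f \<xi> * m \<xi>)" by simp
    qed
    show "AE \<xi> in lborel. (\<lambda>j. \<phi> j \<xi> * m \<xi>) \<longlonglongrightarrow> G \<xi> * (fourier f \<xi> * m \<xi>)"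
    proof (rule AE_I2)
      fix \<xi> :: 'a
      have "s \<longlonglongrightarrow> 0" unfolding s_def using LIMSEQ_inverse_real_of_nat by (simp add: inverse_eq_divide)
      then have "(\<lambda>j. gauss (s j) \<xi>) \<longlonglongrightarrow> exp (- (norm (0 *\<^sub>R \<xi>))\<^sup>2 / 2)"
        unfolding gauss_def by (intro tendsto_intros) auto
      then have "(\<lambda>j. complex_of_real (gauss (s j) \<xi>)) \<longlonglongrightarrow> complex_of_real 1"
        by (intro tendsto_of_real) simp
      then have "(\<lambda>j. fourier f \<xi> * G \<xi> * complex_of_real (gauss (s j) \<xi>) * m \<xi>) \<longlonglongrightarrow> fourier f \<xi> * G \<xi> * complex_of_real 1 * m \<xi>"
        by (intro tendsto_mult tendsto_const)
      then show "(\<lambda>j. \<phi> j \<xi> * m \<xi>) \<longlonglongrightarrow> G \<xi> * (fourier f \<xi> * m \<xi>)"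
        by (simp add: \<phi>_def ac_simps)
    qed
  qed measurable
  ultimately show ?thesis
    unfolding pair using LIMSEQ_le_const2[OF tendsto_norm]
    by (force simp: S_def a_def b_def mult.assoc)
qed

text \<open>The function is tested against its own Hoelder extremal, restricted to balls. The
  resulting inequality has the same finite quantity \<open>J\<close> on both sides, so part of it is
  absorbed; letting the balls grow gives the whole space by monotone convergence.\<close>

lemma fs_bound_nn_integral_powr:
  fixes m f :: "'a::euclidean_space \<Rightarrow> complex"
  assumes m: "fs_bound C m" and C: "C > 0" and f: "integrable lborel f" and p: "p > 1"
  defines "T \<equiv> \<lambda>x. complex_of_real (1 / (2 * pi) ^ DIM('a)) *
      (CLINT \<xi>|lborel. fourier f \<xi> * m \<xi> * iexp (x \<bullet> \<xi>))"
  assumes H: "integrable lborel (\<lambda>\<xi>. fourier f \<xi> * m \<xi>)"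
    and F: "(\<integral>\<^sup>+x. ennreal (cmod (f x) powr p) \<partial>lborel) = ennreal F" "0 \<le> F"
  shows "(\<integral>\<^sup>+x. ennreal (cmod (T x) powr p) \<partial>lborel) \<le> ennreal (C powr p * F)"
proof -
  define k where "k = 1 / (2 * pi) ^ DIM('a)"
  have k: "k > 0" by (simp add: k_def)
  have Tk: "T x = complex_of_real k * (CLINT \<xi>|lborel. fourier f \<xi> * m \<xi> * iexp (x \<bullet> \<xi>))" for x
    by (simp add: T_def k_def)
  have Hm: "(\<lambda>\<xi>. fourier f \<xi> * m \<xi>) \<in> borel_measurable borel" using H by auto
  have Tm[measurable]: "T \<in> borel_measurable borel"
    unfolding Tk[abs_def] using borel_measurable_integral_iexp[OF Hm, of 1]
    by (intro borel_measurable_times) (simp_all add: inner_commute)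
  define B where "B = k * (\<integral>\<xi>. cmod (fourier f \<xi> * m \<xi>) \<partial>lborel)"
  have TB: "cmod (T x) \<le> B" for x
    unfolding Tk B_def using norm_integral_iexp_le[OF H, of 1 x] k
    by (simp add: norm_mult inner_commute mult_left_mono)
  \<comment> \<open>At this point \<open>T\<close> is only known to be bounded. Restriction to a
    ball makes \<open>J\<close> below finite, without which it could not be subtracted.\<close>
  define A where "A n = cball (0::'a) (real n)" for n :: nat
  have [measurable]: "A n \<in> sets borel" for n by (simp add: A_def)
  have Aint: "integrable lborel (\<lambda>x. indicat_real (A n) x)" for n
    using emeasure_lborel_cball_finite[of "0::'a" "real n"]
    by (intro integrable_real_indicator) (auto simp: A_def)
  have main: "(\<integral>\<^sup>+x. ennreal (indicator (A n) x * cmod (T x) powr p) \<partial>lborel) \<le> ennreal (C powr p * F)" for n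
  proof -
    define J where "J = (\<integral>x. indicator (A n) x * cmod (T x) powr p \<partial>lborel)"
    have Ji: "integrable lborel (\<lambda>x. indicator (A n) x * cmod (T x) powr p)"
      by (rule Bochner_Integration.integrable_bound[OF integrable_mult_right[OF Aint[of n], of "B powr p"]])
         (use p in \<open>auto intro!: AE_I2 powr_mono2 TB simp: indicator_def\<close>)
    have J0: "J \<ge> 0" unfolding J_def by (intro integral_nonneg_AE) auto
    have Jn: "(\<integral>\<^sup>+x. ennreal (indicator (A n) x * cmod (T x) powr p) \<partial>lborel) = ennreal J"
      unfolding J_def using Ji by (intro nn_integral_eq_integral) auto
    \<comment> \<open>The extremal function: on the ball \<open>g * T\<close> and
      \<open>cmod g powr q\<close> both equal \<open>cmod T powr p\<close>.\<close>
    define g where "g x = complex_of_real (indicator (A n) x * cmod (T x) powr (p - 1)) * cnj (sgn (T x))" for x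
    have gn: "cmod (g x) = indicator (A n) x * cmod (T x) powr (p - 1)" for x
      by (simp add: g_def norm_mult norm_sgn)
    have [measurable]: "cnj \<in> borel_measurable borel"
      by (intro borel_measurable_continuous_onI continuous_intros)
    have [measurable]: "g \<in> borel_measurable borel"
      unfolding g_def sgn_div_norm by measurable
    have gi: "integrable lborel g"
      by (rule Bochner_Integration.integrable_bound[OF integrable_mult_right[OF Aint[of n], of "B powr (p - 1)"]])
         (use p in \<open>auto intro!: AE_I2 powr_mono2 TB simp: gn indicator_def\<close>)
    have gT: "g x * T x = complex_of_real (indicator (A n) x * cmod (T x) powr p)" for x
    proof (cases "T x = 0")
      case False
      have "cnj (T x) * T x = complex_of_real (cmod (T x)) * complex_of_real (cmod (T x))"
        using complex_norm_square[of "T x"] by (simp add: power2_eq_square mult.commute)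
      then have "cnj (sgn (T x)) * T x = complex_of_real (cmod (T x))"
        using False by (simp add: sgn_eq)
      then have "g x * T x = complex_of_real (indicator (A n) x * (cmod (T x) powr (p - 1) * cmod (T x)))"
        by (simp add: g_def mult.assoc)
      also have "cmod (T x) powr (p - 1) * cmod (T x) = cmod (T x) powr p"
        using False powr_add[of "cmod (T x)" "p - 1" 1] by simp
      finally show ?thesis .
    qed simp
    define q where "q = p / (p - 1)"
    have q: "q > 1" "1 / p + 1 / q = 1" using p by (auto simp: q_def field_simps)
    have gq: "cmod (g x) powr q = indicator (A n) x * cmod (T x) powr p" for x
      using p by (auto simp: gn q_def powr_powr indicator_def)
    \<comment> \<open>Chosen so that \<open>C * \<delta> powr (- q) = 1\<close>: then
      \<open>J\<close> occurs on the right with coefficient exactly \<open>1 / q\<close> and a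
      factor \<open>1 / p\<close> remains on both sides after absorption.\<close>
    define \<delta> where "\<delta> = C powr (1 / q)"
    have \<delta>: "\<delta> > 0" using C by (simp add: \<delta>_def)
    have "cmod (CLINT x|lborel. g x * (CLINT \<xi>|lborel. fourier f \<xi> * m \<xi> * iexp (x \<bullet> \<xi>)))
      \<le> C * (2 * pi) ^ DIM('a) * (\<delta> powr p / p * F + \<delta> powr (- q) / q * J)"
      using fs_bound_pairing[OF m f gi H p q \<delta> F _ J0] by (simp add: gq Jn)
    moreover have "(CLINT x|lborel. g x * (CLINT \<xi>|lborel. fourier f \<xi> * m \<xi> * iexp (x \<bullet> \<xi>))) = complex_of_real (J / k)"
    proof -
      have "g x * (CLINT \<xi>|lborel. fourier f \<xi> * m \<xi> * iexp (x \<bullet> \<xi>)) = complex_of_real (indicator (A n) x * cmod (T x) powr p / k)" for x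
        using gT[of x] k by (simp add: Tk field_simps)
      then show ?thesis unfolding J_def by (simp del: of_real_mult of_real_divide)
    qed
    ultimately have "J / k \<le> C * (2 * pi) ^ DIM('a) * (\<delta> powr p / p * F + \<delta> powr (- q) / q * J)"
      using J0 k by (simp add: norm_divide)
    then have "J / k \<le> C * (\<delta> powr p / p * F + \<delta> powr (- q) / q * J) / k"
      by (simp add: k_def mult.assoc mult.left_commute mult.commute)
    then have "J \<le> C * (\<delta> powr p / p * F + \<delta> powr (- q) / q * J)"
      using k by (simp only: divide_le_cancel)
    moreover have "\<delta> powr (- q) = 1 / C" "\<delta> powr p = C powr p / C"
    proof -
      show "\<delta> powr (- q) = 1 / C" using C q by (simp add: \<delta>_def powr_powr powr_minus_divide)
      have "1 / q * p = p - 1" using p by (simp add: q_def)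
      then show "\<delta> powr p = C powr p / C" using C by (simp add: \<delta>_def powr_powr powr_diff)
    qed
    ultimately have "J \<le> C powr p * F / p + J / q" using C by (simp add: field_simps)
    then have "J * (1 - 1 / q) \<le> C powr p * F / p" by (simp add: algebra_simps)
    also have "1 - 1 / q = 1 / p" using q by simp
    finally have "J \<le> C powr p * F" using p by (simp add: field_simps)
    then show ?thesis unfolding Jn by (rule ennreal_leI)
  qed
  have "(\<integral>\<^sup>+x. ennreal (cmod (T x) powr p) \<partial>lborel)
      = (\<integral>\<^sup>+x. (SUP n. ennreal (indicator (A n) x * cmod (T x) powr p)) \<partial>lborel)"
  proof (intro nn_integral_cong antisym)
    fix x :: 'a
    obtain n :: nat where "norm x \<le> real n" using real_arch_simple by blast
    then have "x \<in> A n" by (simp add: A_def)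
    then show "ennreal (cmod (T x) powr p) \<le> (SUP n. ennreal (indicator (A n) x * cmod (T x) powr p))"
      by (intro SUP_upper2[of n]) auto
    show "(SUP n. ennreal (indicator (A n) x * cmod (T x) powr p)) \<le> ennreal (cmod (T x) powr p)"
      by (intro SUP_least ennreal_leI) (auto simp: indicator_def)
  qed
  also have "\<dots> = (SUP n. \<integral>\<^sup>+x. ennreal (indicator (A n) x * cmod (T x) powr p) \<partial>lborel)"
    by (rule nn_integral_monotone_convergence_SUP)
       (auto simp: incseq_def le_fun_def A_def indicator_def intro!: ennreal_leI)
  also have "\<dots> \<le> ennreal (C powr p * F)"
    by (rule SUP_least) (rule main)
  finally show ?thesis .
qed

lemma Lp_norm_multiplier_le:
  fixes m f :: "'a::euclidean_space \<Rightarrow> complex"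
  assumes m: "fs_bound C m" and C: "C > 0" and f: "integrable lborel f" and p: "p > 1"
  defines "T \<equiv> \<lambda>x. complex_of_real (1 / (2 * pi) ^ DIM('a)) *
      (CLINT \<xi>|lborel. fourier f \<xi> * iexp (\<xi> \<bullet> x) * m \<xi>)"
  shows "Lp_norm p T \<le> ennreal C * Lp_norm p f"
proof (cases "integrable lborel (\<lambda>\<xi>. fourier f \<xi> * m \<xi>)")
  case False
  \<comment> \<open>The Bochner integral of a non-integrable function is \<open>0\<close>, so the decay of \<open>fourier f\<close> is never needed.\<close>
  have "(CLINT \<xi>|lborel. fourier f \<xi> * iexp (\<xi> \<bullet> x) * m \<xi>) = 0" for x
  proof (rule not_integrable_integral_eq, rule notI)
    assume "integrable lborel (\<lambda>\<xi>. fourier f \<xi> * iexp (\<xi> \<bullet> x) * m \<xi>)"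
    then have "integrable lborel (\<lambda>\<xi>. (fourier f \<xi> * iexp (\<xi> \<bullet> x) * m \<xi>) * iexp (\<xi> \<bullet> (- x)))"
      by (rule integrable_mult_iexp)
    moreover have "iexp (\<xi> \<bullet> x) * iexp (\<xi> \<bullet> (- x)) = 1" for \<xi>
      by (simp add: mult_exp_exp)
    then have "(fourier f \<xi> * iexp (\<xi> \<bullet> x) * m \<xi>) * iexp (\<xi> \<bullet> (- x)) = fourier f \<xi> * m \<xi>" for \<xi>
      by (metis (no_types, opaque_lifting) mult.assoc mult.commute mult.right_neutral)
    ultimately have "integrable lborel (\<lambda>\<xi>. fourier f \<xi> * m \<xi>)" by (simp only:)
    with False show False ..
  qed
  then have "T = (\<lambda>x. 0)" by (simp add: T_def)
  then show ?thesis using p by (simp add: Lp_norm_def Let_def)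
next
  case True
  define I where "I g = (\<integral>\<^sup>+x. ennreal (cmod (g x) powr p) \<partial>lborel)" for g :: "'a \<Rightarrow> complex"
  have fm: "f \<in> borel_measurable lborel" using f by auto
  show ?thesis
  proof (cases "I f < \<infinity>")
    case False
    \<comment> \<open>The right-hand side is infinite here because \<open>C\<close> is strictly
      positive; with \<open>C = 0\<close> the product would be 0.\<close>
    then have "Lp_norm p f = \<infinity>" by (simp add: Lp_norm_def I_def)
    then show ?thesis using C by (simp add: ennreal_mult_top)
  next
    case fin: True
    define F where "F = enn2real (I f)"
    have F: "I f = ennreal F" "0 \<le> F" using fin by (auto simp: F_def)
    have T: "T = (\<lambda>x. complex_of_real (1 / (2 * pi) ^ DIM('a)) *
      (CLINT \<xi>|lborel. fourier f \<xi> * m \<xi> * iexp (x \<bullet> \<xi>)))"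
      by (simp add: T_def inner_commute ac_simps)
    have le: "I T \<le> ennreal (C powr p * F)"
      using fs_bound_nn_integral_powr[OF m C f p True F[unfolded I_def]] by (simp add: I_def T)
    have "(\<lambda>\<xi>. fourier f \<xi> * m \<xi>) \<in> borel_measurable borel" using True by auto
    from borel_measurable_integral_iexp[OF this, of 1] have Tm: "T \<in> borel_measurable lborel"
      unfolding T by (intro borel_measurable_times) (simp_all add: inner_commute)
    have Tfin: "I T < \<infinity>" using le by (auto intro: le_less_trans)
    have "Lp_norm p T = ennreal (enn2real (I T) powr (1 / p))"
      using Tm Tfin by (simp add: Lp_norm_def I_def)
    also have "\<dots> \<le> ennreal ((C powr p * F) powr (1 / p))"
      using p F le C by (intro ennreal_leI powr_mono2) (auto intro: enn2real_leI)
    also have "(C powr p * F) powr (1 / p) = C * F powr (1 / p)"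
      using C F p by (simp add: powr_mult powr_powr)
    also have "ennreal \<dots> = ennreal C * Lp_norm p f"
      using fm fin C by (simp add: Lp_norm_def I_def[symmetric] F_def[symmetric] ennreal_mult')
    finally show ?thesis .
  qed
qed

section \<open>Integrability of Schwartz functions\<close>

lemma integrable_inverse_1_plus_square: "integrable lborel (\<lambda>u::real. inverse (1 + u\<^sup>2))"
  using integrable_inverse_1_plus_square by (simp add: set_integrable_def)

text \<open>Comparison with a product of one-dimensional Cauchy profiles: with t = |x|^2, the
  product of the 1 + x_b^2 is at most (1 + t)^d \<le> 2^d (1 + t^d), which explains the exponent
  2d.\<close>

lemma integrable_lborel_decay:
  fixes g :: "'a::euclidean_space \<Rightarrow> 'c::{banach, second_countable_topology}"
  assumes [measurable]: "g \<in> borel_measurable borel"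
    and le: "\<And>x. norm (g x) * (1 + norm x ^ (2 * DIM('a))) \<le> C"
  shows "integrable lborel g"
proof -
  let ?d = "DIM('a)"
  have "integrable lborel (\<lambda>x::'a. \<Prod>b\<in>Basis. complex_of_real (inverse (1 + (x \<bullet> b)\<^sup>2)))"
    using integrable_inverse_1_plus_square
    by (intro integrable_lborel_prod) (simp add: complex_of_real_integrable_eq del: of_real_inverse)
  then have "integrable lborel (\<lambda>x::'a. \<Prod>b\<in>Basis. inverse (1 + (x \<bullet> b)\<^sup>2))"
    unfolding of_real_prod[symmetric] complex_of_real_integrable_eq .
  then have "integrable lborel (\<lambda>x::'a. (C * 2 ^ ?d) * (\<Prod>b\<in>Basis. inverse (1 + (x \<bullet> b)\<^sup>2)))"
    by (rule integrable_mult_right)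
  then show ?thesis
  proof (rule Bochner_Integration.integrable_bound)
    show "AE x in lborel. norm (g x) \<le> norm ((C * 2 ^ ?d) * (\<Prod>b\<in>Basis. inverse (1 + (x \<bullet> b)\<^sup>2)))"
    proof (rule AE_I2)
      fix x :: 'a
      have C: "C \<ge> 0" by (rule order_trans[OF _ le[of 0]]) auto
      define t where "t = (norm x)\<^sup>2"
      have t: "t \<ge> 0" by (simp add: t_def)
      define P where "P = (\<Prod>b\<in>Basis. (1 + (x \<bullet> b)\<^sup>2))"
      have P: "P > 0" unfolding P_def by (intro prod_pos) (auto intro: add_pos_nonneg)
      have "P \<le> (\<Prod>b\<in>(Basis::'a set). 1 + t)"
        unfolding P_def t_def
        by (intro prod_mono) (auto simp: Basis_le_norm abs_le_square_iff[symmetric] power2_abs)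
      also have "\<dots> = (1 + t) ^ ?d" by simp
      also have "\<dots> \<le> (2 * max 1 t) ^ ?d" using t by (intro power_mono) auto
      also have "\<dots> \<le> 2 ^ ?d * (1 + t ^ ?d)"
        using t by (auto simp: power_mult_distrib max_def)
      finally have "P \<le> 2 ^ ?d * (1 + norm x ^ (2 * ?d))" by (simp add: t_def power_mult)
      then have "norm (g x) * P \<le> norm (g x) * (2 ^ ?d * (1 + norm x ^ (2 * ?d)))"
        by (rule mult_left_mono) simp
      also have "\<dots> \<le> 2 ^ ?d * C" using le[of x] by simp
      finally have "norm (g x) \<le> C * 2 ^ ?d * inverse P" using P by (simp add: field_simps)
      also have "inverse P = (\<Prod>b\<in>Basis. inverse (1 + (x \<bullet> b)\<^sup>2))"
        unfolding P_def using prod_inversef[of "\<lambda>b. 1 + (x \<bullet> b)\<^sup>2" Basis] by (simp add: o_def)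
      finally show "norm (g x) \<le> norm ((C * 2 ^ ?d) * (\<Prod>b\<in>Basis. inverse (1 + (x \<bullet> b)\<^sup>2)))"
        by (rule order_trans) (simp only: real_norm_def abs_ge_self)
    qed
  qed measurable
qed

lemma schwartz_space_integrable:
  fixes f :: "'a::euclidean_space \<Rightarrow> complex"
  assumes "f \<in> schwartz_space"
  shows "integrable lborel f"
proof -
  have d: "f differentiable (at x)" and b: "bounded (range (\<lambda>x. norm x ^ k *\<^sub>R f x))" for x and k :: nat
    using assms unfolding schwartz_space_def by (auto dest!: bspec[where x="[]"])
  have "continuous_on UNIV f"
    using d by (simp add: continuous_on_eq_continuous_at differentiable_imp_continuous_within)
  then have m: "f \<in> borel_measurable borel" by (rule borel_measurable_continuous_onI)
  obtain A where A: "norm (f x) \<le> A" for x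
    using b[of 0] unfolding bounded_iff by auto
  obtain B where B: "norm x ^ (2 * DIM('a)) * norm (f x) \<le> B" for x
    using b[of "2 * DIM('a)"] unfolding bounded_iff by auto
  show ?thesis
    by (rule integrable_lborel_decay[OF m, of "A + B"])
       (use add_mono[OF A B] in \<open>simp add: algebra_simps\<close>)
qed

section \<open>Smoothness of the stable law\<close>

text \<open>This is \<open>x \<le> exp x\<close> at \<open>x = c * t / n\<close>, raised to the
  power \<open>n\<close>.\<close>

lemma power_times_exp_le:
  fixes c t :: real
  assumes "c > 0" "t \<ge> 0"
  shows "t ^ n * exp (- c * t) \<le> (real n / c) ^ n"
proof (cases "n = 0")
  case True
  then show ?thesis using assms by simp
next
  case False
  then have n: "real n > 0" by simp
  have "(c * t / real n) ^ n \<le> exp (c * t / real n) ^ n"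
  proof (rule power_mono)
    show "c * t / real n \<le> exp (c * t / real n)"
      using exp_ge_add_one_self[of "c * t / real n"] by linarith
  qed (use assms in auto)
  also have "\<dots> = exp (c * t)" using n by (simp add: exp_of_nat_mult[symmetric])
  finally have "t ^ n \<le> exp (c * t) * (real n / c) ^ n"
    using assms n by (simp add: power_divide power_mult_distrib field_simps)
  then show ?thesis by (simp add: exp_minus field_simps)
qed

lemma integrable_exp_decay:
  fixes w :: "'a::euclidean_space \<Rightarrow> real"
  assumes [measurable]: "w \<in> borel_measurable borel"
    and w: "\<And>x. 0 \<le> w x" "\<And>x. w x \<le> B * exp (- c * norm x)" and c: "c > 0"
  shows "integrable lborel (\<lambda>x. norm x ^ k * w x)"
proof (rule integrable_lborel_decay)
  show "(\<lambda>x. norm x ^ k * w x) \<in> borel_measurable borel" by measurable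
  let ?n = "2 * DIM('a)"
  fix x :: 'a
  have B: "0 \<le> B" using order_trans[OF w(1) w(2), of 0] by simp
  have "norm (norm x ^ k * w x) * (1 + norm x ^ ?n) = norm x ^ k * w x + norm x ^ (k + ?n) * w x"
    using w(1)[of x] by (simp add: algebra_simps power_add)
  also have "\<dots> \<le> norm x ^ k * (B * exp (- c * norm x)) + norm x ^ (k + ?n) * (B * exp (- c * norm x))"
    by (intro add_mono mult_left_mono w) auto
  also have "\<dots> = B * (norm x ^ k * exp (- c * norm x)) + B * (norm x ^ (k + ?n) * exp (- c * norm x))"
    by (simp add: ac_simps)
  also have "\<dots> \<le> B * (real k / c) ^ k + B * (real (k + ?n) / c) ^ (k + ?n)"
    using B c by (intro add_mono mult_left_mono power_times_exp_le) auto
  finally show "norm (norm x ^ k * w x) * (1 + norm x ^ ?n) \<le>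
     B * (real k / c) ^ k + B * (real (k + ?n) / c) ^ (k + ?n)" .
qed

lemma gauss_le_exp: "gauss 1 x \<le> exp (1 / 2) * exp (- 1 * norm x)"
proof -
  have "0 \<le> (norm x - 1)\<^sup>2" by simp
  then have "- (norm x)\<^sup>2 / 2 \<le> 1 / 2 + - 1 * norm x" by (simp add: power2_diff)
  then show ?thesis by (simp add: gauss_def exp_add[symmetric])
qed

text \<open>Lets a cutoff translated by y be controlled by the untranslated one and its value at y.
  From |x + y|^2 \<le> 2|x|^2 + 2|y|^2 the value at x + y is at least a^2 b^2, and 1 - a^2 \<le> 2
  (1 - a).\<close>

lemma one_minus_gauss_add_le:
  "1 - gauss s (x + y) \<le> 2 * (1 - gauss s x) + 2 * (1 - gauss s y)"
proof -
  define a b where "a = gauss s x" and "b = gauss s y"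
  have ab: "0 < a" "a \<le> 1" "0 < b" "b \<le> 1" by (auto simp: a_def b_def gauss_pos gauss_le_1)
  have "(norm (s *\<^sub>R x + s *\<^sub>R y))\<^sup>2 \<le> (norm (s *\<^sub>R x) + norm (s *\<^sub>R y))\<^sup>2"
    by (intro power_mono norm_triangle_ineq) auto
  also have "\<dots> \<le> 2 * (norm (s *\<^sub>R x))\<^sup>2 + 2 * (norm (s *\<^sub>R y))\<^sup>2"
    using zero_le_power2[of "norm (s *\<^sub>R x) - norm (s *\<^sub>R y)"] by (simp add: power2_sum power2_diff)
  finally have "a\<^sup>2 * b\<^sup>2 \<le> gauss s (x + y)"
    unfolding a_def b_def gauss_def exp_double[symmetric] exp_add[symmetric]
    by (simp add: scaleR_add_right)
  moreover have "1 - a\<^sup>2 * b\<^sup>2 = (1 - a\<^sup>2) + a\<^sup>2 * (1 - b\<^sup>2)" by (simp add: algebra_simps)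
  moreover have "a\<^sup>2 * (1 - b\<^sup>2) \<le> 1 * (1 - b\<^sup>2)"
    using ab by (intro mult_right_mono) (auto simp: power_le_one)
  moreover have "1 - a\<^sup>2 \<le> 2 * (1 - a)" "1 - b\<^sup>2 \<le> 2 * (1 - b)"
    using zero_le_power2[of "a - 1"] zero_le_power2[of "b - 1"] by (simp_all add: power2_diff)
  ultimately show ?thesis by (simp add: a_def b_def)
qed

lemma one_minus_gauss_le: "1 - gauss s x \<le> (s * norm x)\<^sup>2 / 2"
  using exp_ge_add_one_self[of "- (norm (s *\<^sub>R x))\<^sup>2 / 2"] by (simp add: gauss_def power_mult_distrib)

lemma lborel_integral_translate:
  fixes f :: "'a::euclidean_space \<Rightarrow> 'c::{banach, second_countable_topology}"
  assumes [measurable]: "f \<in> borel_measurable borel"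
  shows "(\<integral>x. f (x - t) \<partial>lborel) = (\<integral>x. f x \<partial>lborel)"
    and "integrable lborel f \<Longrightarrow> integrable lborel (\<lambda>x. f (x - t))"
proof -
  have eq: "(lborel :: 'a measure) = distr lborel borel (\<lambda>x. x - t)"
    using lborel_affine[of 1 "-t"] by (simp add: density_1)
  have "(\<integral>x. f x \<partial>lborel) = (\<integral>x. f x \<partial>distr lborel borel (\<lambda>x. x - t))" using eq by simp
  then show "(\<integral>x. f (x - t) \<partial>lborel) = (\<integral>x. f x \<partial>lborel)" by (simp add: integral_distr)
  have "integrable lborel f = integrable (distr lborel borel (\<lambda>x. x - t)) f" using eq by simp
  then show "integrable lborel f \<Longrightarrow> integrable lborel (\<lambda>x. f (x - t))" by (simp add: integrable_distr_eq)
qed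

lemma
  fixes \<phi> g :: "'a::euclidean_space \<Rightarrow> complex"
  assumes \<phi>: "integrable lborel \<phi>" and g: "integrable lborel g"
  defines "\<Theta> \<equiv> \<lambda>\<xi>. CLINT \<zeta>|lborel. \<phi> \<zeta> * g (\<xi> - \<zeta>)"
  shows convolution_integrable: "integrable lborel \<Theta>"
    and convolution_transform: "(CLINT \<xi>|lborel. \<Theta> \<xi> * iexp (\<xi> \<bullet> x)) =
      (CLINT \<xi>|lborel. \<phi> \<xi> * iexp (\<xi> \<bullet> x)) * (CLINT \<xi>|lborel. g \<xi> * iexp (\<xi> \<bullet> x))"
proof -
  have [measurable]: "\<phi> \<in> borel_measurable borel" "g \<in> borel_measurable borel" using \<phi> g by auto
  have int: "integrable (lborel \<Otimes>\<^sub>M lborel) (\<lambda>(\<zeta>, \<xi>). \<phi> \<zeta> * g (\<xi> - \<zeta>) * iexp (\<xi> \<bullet> x))" for x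
  proof (rule lborel_pair.Fubini_integrable)
    show "(\<lambda>(\<zeta>, \<xi>). \<phi> \<zeta> * g (\<xi> - \<zeta>) * iexp (\<xi> \<bullet> x)) \<in> borel_measurable (lborel \<Otimes>\<^sub>M lborel)"
      unfolding case_prod_unfold by measurable
    have "(\<integral>\<xi>. norm (case (\<zeta>, \<xi>) of (\<zeta>, \<xi>) \<Rightarrow> \<phi> \<zeta> * g (\<xi> - \<zeta>) * iexp (\<xi> \<bullet> x)) \<partial>lborel) =
       cmod (\<phi> \<zeta>) * (\<integral>\<xi>. cmod (g \<xi>) \<partial>lborel)" for \<zeta>
      using lborel_integral_translate(1)[of "\<lambda>\<xi>. cmod (g \<xi>)" \<zeta>] by (simp add: norm_mult)
    then show "integrable lborel (\<lambda>\<zeta>. \<integral>\<xi>. norm (case (\<zeta>, \<xi>) of (\<zeta>, \<xi>) \<Rightarrow> \<phi> \<zeta> * g (\<xi> - \<zeta>) * iexp (\<xi> \<bullet> x)) \<partial>lborel)"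
      using \<phi> by auto
    show "AE \<zeta> in lborel. integrable lborel (\<lambda>\<xi>. case (\<zeta>, \<xi>) of (\<zeta>, \<xi>) \<Rightarrow> \<phi> \<zeta> * g (\<xi> - \<zeta>) * iexp (\<xi> \<bullet> x))"
    proof (rule AE_I2)
      fix \<zeta>
      have "integrable lborel (\<lambda>\<xi>. g (\<xi> - \<zeta>) * iexp (\<xi> \<bullet> x))"
        using g by (intro integrable_mult_iexp lborel_integral_translate(2)) auto
      from integrable_mult_right[OF this, of "\<phi> \<zeta>"]
      show "integrable lborel (\<lambda>\<xi>. case (\<zeta>, \<xi>) of (\<zeta>, \<xi>) \<Rightarrow> \<phi> \<zeta> * g (\<xi> - \<zeta>) * iexp (\<xi> \<bullet> x))"
        by (simp add: mult.assoc)
    qed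
  qed
  show "integrable lborel \<Theta>"
    using lborel_pair.integrable_snd[OF int[of 0]] by (simp add: \<Theta>_def)
  have "(CLINT \<xi>|lborel. \<Theta> \<xi> * iexp (\<xi> \<bullet> x)) = (CLINT \<xi>|lborel. CLINT \<zeta>|lborel. \<phi> \<zeta> * g (\<xi> - \<zeta>) * iexp (\<xi> \<bullet> x))"
    by (simp add: \<Theta>_def)
  also have "\<dots> = (CLINT \<zeta>|lborel. CLINT \<xi>|lborel. \<phi> \<zeta> * g (\<xi> - \<zeta>) * iexp (\<xi> \<bullet> x))"
    using lborel_pair.Fubini_integral[OF int[of x]] by simp
  also have "\<dots> = (CLINT \<zeta>|lborel. (\<phi> \<zeta> * iexp (\<zeta> \<bullet> x)) * (CLINT \<xi>|lborel. g \<xi> * iexp (\<xi> \<bullet> x)))"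
  proof (intro Bochner_Integration.integral_cong refl)
    fix \<zeta>
    have "(CLINT \<xi>|lborel. \<phi> \<zeta> * g (\<xi> - \<zeta>) * iexp (\<xi> \<bullet> x)) =
        (CLINT \<xi>|lborel. (\<phi> \<zeta> * iexp (\<zeta> \<bullet> x)) * (g (\<xi> - \<zeta>) * iexp ((\<xi> - \<zeta>) \<bullet> x)))"
    proof (intro Bochner_Integration.integral_cong refl)
      fix \<xi>
      have "iexp (\<zeta> \<bullet> x) * iexp ((\<xi> - \<zeta>) \<bullet> x) = iexp (\<xi> \<bullet> x)"
        by (simp add: inner_diff_left mult_exp_exp algebra_simps)
      then show "\<phi> \<zeta> * g (\<xi> - \<zeta>) * iexp (\<xi> \<bullet> x) = (\<phi> \<zeta> * iexp (\<zeta> \<bullet> x)) * (g (\<xi> - \<zeta>) * iexp ((\<xi> - \<zeta>) \<bullet> x))"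
        by (metis (no_types, lifting) mult.assoc mult.left_commute)
    qed
    also have "\<dots> = (\<phi> \<zeta> * iexp (\<zeta> \<bullet> x)) * (CLINT \<xi>|lborel. g (\<xi> - \<zeta>) * iexp ((\<xi> - \<zeta>) \<bullet> x))"
      by (rule integral_mult_right_zero)
    also have "(CLINT \<xi>|lborel. g (\<xi> - \<zeta>) * iexp ((\<xi> - \<zeta>) \<bullet> x)) = (CLINT \<xi>|lborel. g \<xi> * iexp (\<xi> \<bullet> x))"
      by (rule lborel_integral_translate) measurable
    finally show "(CLINT \<xi>|lborel. \<phi> \<zeta> * g (\<xi> - \<zeta>) * iexp (\<xi> \<bullet> x)) =
      (\<phi> \<zeta> * iexp (\<zeta> \<bullet> x)) * (CLINT \<xi>|lborel. g \<xi> * iexp (\<xi> \<bullet> x))" .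
  qed
  also have "\<dots> = (CLINT \<xi>|lborel. \<phi> \<xi> * iexp (\<xi> \<bullet> x)) * (CLINT \<xi>|lborel. g \<xi> * iexp (\<xi> \<bullet> x))"
    by (rule integral_mult_left_zero)
  finally show "(CLINT \<xi>|lborel. \<Theta> \<xi> * iexp (\<xi> \<bullet> x)) =
      (CLINT \<xi>|lborel. \<phi> \<xi> * iexp (\<xi> \<bullet> x)) * (CLINT \<xi>|lborel. g \<xi> * iexp (\<xi> \<bullet> x))" .
qed

lemma gauss_normalisation:
  assumes "R > 0"
  shows "(R / sqrt (2 * pi)) ^ n = 1 / (2 * pi) ^ n * (sqrt (2 * pi) / (1 / R)) ^ n"
proof -
  define s where "s = sqrt (2 * pi)"
  have s: "s > 0" "2 * pi = s * s" by (simp_all add: s_def)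
  have "R / s = 1 / (s * s) * (s / (1 / R))" using s(1) by simp
  then have "(R / s) ^ n = (1 / (s * s)) ^ n * (s / (1 / R)) ^ n"
    using power_mult_distrib[of "1 / (s * s)" "s / (1 / R)" n] by presburger
  then show ?thesis by (simp only: power_one_over s(2)[unfolded s_def, symmetric] s_def)
qed

text \<open>The centred normal density with standard deviation 1/R. Its transform is the spatial
  cutoff \<open>gauss (1 / R)\<close>.\<close>

definition gauss_kernel :: "real \<Rightarrow> 'a::euclidean_space \<Rightarrow> real" where
  "gauss_kernel R x = (R / sqrt (2 * pi)) ^ DIM('a) * gauss R x"

lemma
  fixes x :: "'a::euclidean_space"
  assumes R: "R > 0"
  shows gauss_kernel_nonneg: "0 \<le> gauss_kernel R x"
    and gauss_kernel_integrable: "integrable lborel (\<lambda>x::'a. complex_of_real (gauss_kernel R x))"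
    and gauss_kernel_transform:
      "(CLINT \<xi>|lborel. complex_of_real (gauss_kernel R \<xi>) * iexp (\<xi> \<bullet> x)) = complex_of_real (gauss (1 / R) x)"
    and gauss_kernel_eq: "complex_of_real (gauss_kernel R x) =
      complex_of_real (1 / (2 * pi) ^ DIM('a)) * (CLINT \<xi>|lborel. complex_of_real (gauss (1 / R) \<xi>) * iexp (\<xi> \<bullet> x))"
proof -
  show "0 \<le> gauss_kernel R x" using R gauss_pos[of R x] by (simp add: gauss_kernel_def)
  show "integrable lborel (\<lambda>x::'a. complex_of_real (gauss_kernel R x))"
    using gauss_integrable[OF R, where 'a='a] by (simp add: gauss_kernel_def complex_of_real_integrable_eq del: of_real_mult)
  have "(CLINT \<xi>|lborel. complex_of_real (gauss_kernel R \<xi>) * iexp (\<xi> \<bullet> x)) =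
      complex_of_real ((R / sqrt (2 * pi)) ^ DIM('a)) * (CLINT \<xi>|lborel. complex_of_real (gauss R \<xi>) * iexp (\<xi> \<bullet> x))"
    unfolding gauss_kernel_def of_real_mult mult.assoc by (rule integral_mult_right_zero)
  also have "\<dots> = complex_of_real ((R / sqrt (2 * pi)) ^ DIM('a) * ((sqrt (2 * pi) / R) ^ DIM('a) * gauss (1 / R) x))"
    unfolding gauss_transform[OF R] of_real_mult ..
  also have "(R / sqrt (2 * pi)) ^ DIM('a) * ((sqrt (2 * pi) / R) ^ DIM('a) * gauss (1 / R) x) = gauss (1 / R) x"
    using R unfolding mult.assoc[symmetric] power_mult_distrib[symmetric] by simp
  finally show "(CLINT \<xi>|lborel. complex_of_real (gauss_kernel R \<xi>) * iexp (\<xi> \<bullet> x)) = complex_of_real (gauss (1 / R) x)" .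
  show "complex_of_real (gauss_kernel R x) =
      complex_of_real (1 / (2 * pi) ^ DIM('a)) * (CLINT \<xi>|lborel. complex_of_real (gauss (1 / R) \<xi>) * iexp (\<xi> \<bullet> x))"
    using R by (subst gauss_transform) (simp_all only: gauss_kernel_def mult.assoc gauss_normalisation of_real_mult, simp_all)
qed

text \<open>Smoothing in frequency by a Gaussian kernel amounts to localising in space.\<close>

lemma convolution_gauss_kernel_le:
  fixes \<phi> :: "'a::euclidean_space \<Rightarrow> complex"
  assumes \<phi>: "integrable lborel \<phi>" and S: "\<And>y. cmod (fourier \<phi> y) \<le> S" and R: "R > 0"
  shows "cmod (CLINT \<zeta>|lborel. \<phi> \<zeta> * complex_of_real (gauss_kernel R (\<xi> - \<zeta>))) \<le>
    S * (R / sqrt (2 * pi)) ^ DIM('a)"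
proof -
  define k where "k = 1 / (2 * pi) ^ DIM('a)"
  have k: "k > 0" by (simp add: k_def)
  define Q where "Q x = complex_of_real (gauss (1 / R) x) * iexp (x \<bullet> \<xi>)" for x
  have gi: "integrable lborel (gauss (1 / R) :: 'a \<Rightarrow> real)" using R by (intro gauss_integrable) auto
  then have Q: "integrable lborel Q"
    unfolding Q_def by (intro integrable_mult_iexp) (simp add: complex_of_real_integrable_eq)
  \<comment> \<open>Writing the kernel as the transform of the cutoff turns the convolution into an
    integral of \<open>fourier \<phi>\<close> against a Gaussian of width R. Only the sup of
    \<open>fourier \<phi>\<close> then matters, and the mass of that Gaussian gives the factor
    R^d.\<close>
  have "complex_of_real (gauss_kernel R (\<xi> - \<zeta>)) = complex_of_real k * (CLINT x|lborel. Q x * iexp (- 1 * (\<zeta> \<bullet> x)))" for \<zeta>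
    unfolding gauss_kernel_eq[OF R] k_def[symmetric] Q_def
    by (simp add: inner_diff_right mult_exp_exp inner_commute algebra_simps)
  then have "(CLINT \<zeta>|lborel. \<phi> \<zeta> * complex_of_real (gauss_kernel R (\<xi> - \<zeta>))) =
     (CLINT \<zeta>|lborel. complex_of_real k * (\<phi> \<zeta> * (CLINT x|lborel. Q x * iexp (- 1 * (\<zeta> \<bullet> x)))))"
    by (simp only: ac_simps)
  also have "\<dots> = complex_of_real k * (CLINT x|lborel. fourier \<phi> x * Q x)"
    unfolding integral_mult_right_zero integral_kernel_swap[OF \<phi> Q, symmetric] by (simp add: fourier_def)
  also have "cmod \<dots> \<le> k * (\<integral>x. S * gauss (1 / R) x \<partial>(lborel :: 'a measure))"
  proof -
    have "cmod (CLINT x|lborel. fourier \<phi> x * Q x) \<le> (\<integral>x. S * gauss (1 / R) x \<partial>(lborel :: 'a measure))"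
    proof (rule order_trans[OF integral_norm_bound], rule integral_mono)
      have "(\<lambda>y. fourier \<phi> y) \<in> borel_measurable borel"
        using borel_measurable_integral_iexp[of \<phi> "-1"] \<phi> by (simp add: fourier_def)
      from integrable_mult_bounded[OF Q this S] show "integrable lborel (\<lambda>x. cmod (fourier \<phi> x * Q x))"
        by (intro integrable_norm) (simp add: mult.commute)
      show "integrable lborel (\<lambda>x::'a. S * gauss (1 / R) x)" using gi by simp
      show "norm (fourier \<phi> x * Q x) \<le> S * gauss (1 / R) x" for x :: 'a
        using S[of x] gauss_pos[of "1/R" x] by (simp add: Q_def norm_mult mult_right_mono)
    qed
    then show ?thesis using k by (simp add: norm_mult)
  qed
  also have "k * (\<integral>x. S * gauss (1 / R) x \<partial>(lborel :: 'a measure)) = S * (k * (sqrt (2 * pi) / (1 / R)) ^ DIM('a))"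
    using R gauss_integral[of "1 / R", where 'a='a] by simp
  also have "k * (sqrt (2 * pi) / (1 / R)) ^ DIM('a) = (R / sqrt (2 * pi)) ^ DIM('a)"
    unfolding k_def by (rule gauss_normalisation[OF R, symmetric])
  finally show ?thesis .
qed

lemma cmod_one_minus_iexp_le: "cmod (1 - iexp t) \<le> \<bar>t\<bar>"
  using iexp_approx1[of t 0] by (simp add: norm_minus_commute)

lemma fs_bound_one_minus_iexp: "fs_bound 2 (\<lambda>\<xi>. 1 - iexp (\<xi> \<bullet> v))"
  using fs_bound_diff[OF fs_bound_one fs_bound_iexp] by simp

lemma cos_eq_iexp: "complex_of_real (cos t) = (iexp t + iexp (- t)) / 2"
  unfolding cos_of_real[symmetric] cos_exp_eq by simp

text \<open>The identity |1 - e^{it}|^2 = 2 (1 - cos t) in factored form: each cosine term supplies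
  two first differences, and each of them gains a power of |v| below.\<close>

lemma one_minus_cos_eq_iexp: "complex_of_real (1 - cos t) = 1 / 2 * ((1 - iexp t) * (1 - iexp (- t)))"
proof -
  define a b where "a = iexp t" and "b = iexp (- t)"
  have "a * b = 1" by (simp add: a_def b_def mult_exp_exp)
  then have "(1 - a) * (1 - b) = 2 - (a + b)" by (simp add: algebra_simps)
  then have "1 / 2 * ((1 - a) * (1 - b)) = 1 - (a + b) / 2" by (simp add: diff_divide_distrib)
  then show ?thesis unfolding of_real_diff of_real_1 cos_eq_iexp a_def b_def by (rule sym)
qed

section \<open>Translation differences of the stable law\<close>

text \<open>The stable law reduced to what the estimates use. The lower bound on \<open>lam\<close>,
  which stems from non-degeneracy, gives integrability in frequency; the upper bound with \<alpha> >
  1 makes \<open>1 - exp (- lam \<xi>)\<close> at most linear in |\<xi>|, which stands in for a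
  first moment.\<close>

locale stable_char = prob_space \<mu> for \<mu> :: "'a::euclidean_space measure" +
  fixes lam :: "'a \<Rightarrow> real" and \<alpha> c0 C0 :: real
  assumes sets_mu [simp, measurable_cong]: "sets \<mu> = sets borel"
    and char_mu: "(CLINT y|\<mu>. iexp (y \<bullet> \<xi>)) = complex_of_real (exp (- lam \<xi>))"
    and lam_measurable [measurable]: "lam \<in> borel_measurable borel"
    and lam_scale: "s > 0 \<Longrightarrow> lam (s *\<^sub>R \<xi>) = s powr \<alpha> * lam \<xi>"
    and c0: "c0 > 0" and lam_lower: "c0 * norm \<xi> powr \<alpha> \<le> lam \<xi>"
    and lam_upper: "lam \<xi> \<le> C0 * norm \<xi> powr \<alpha>"
    and alpha_gt_1: "\<alpha> > 1"
begin

lemma space_mu [simp]: "space \<mu> = UNIV"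
  using sets_eq_imp_space_eq[OF sets_mu] by simp

lemma prob_UNIV [simp]: "measure \<mu> UNIV = 1"
  using prob_space by simp

lemma lam_nonneg: "0 \<le> lam \<xi>"
  using c0 by (intro order_trans[OF _ lam_lower]) simp

lemma fs_bound_char: "fs_bound 1 (\<lambda>\<xi>. complex_of_real (exp (- lam \<xi>)))"
proof -
  have "fs_bound (\<integral>t. 1 \<partial>\<mu>) (\<lambda>\<xi>. CLINT t|\<mu>. iexp (\<xi> \<bullet> t))"
    by (rule fs_bound_mixture) (auto intro: fs_bound_iexp sigma_finite_measure_axioms)
  then show ?thesis using prob_space by (simp add: inner_commute[of _ "_::'a"] char_mu[symmetric])
qed

lemma integral_mult_char:
  fixes \<phi> :: "'a \<Rightarrow> complex"
  assumes \<phi>: "integrable lborel \<phi>"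
  shows "(CLINT \<xi>|lborel. \<phi> \<xi> * complex_of_real (exp (- lam \<xi>))) = (CLINT x|\<mu>. CLINT \<xi>|lborel. \<phi> \<xi> * iexp (\<xi> \<bullet> x))"
proof -
  have [measurable]: "\<phi> \<in> borel_measurable borel" using \<phi> by auto
  have "(CLINT \<xi>|lborel. \<phi> \<xi> * complex_of_real (exp (- lam \<xi>))) = (CLINT \<xi>|lborel. CLINT x|\<mu>. \<phi> \<xi> * iexp (\<xi> \<bullet> x))"
    by (simp add: char_mu[symmetric] inner_commute)
  also have "\<dots> = (CLINT x|\<mu>. CLINT \<xi>|lborel. \<phi> \<xi> * iexp (\<xi> \<bullet> x))"
    by (rule integral_swap_product_bound[OF sigma_finite_lborel sigma_finite_measure_axioms _ integrable_norm[OF \<phi>], of _ "\<lambda>_. 1"])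
       (auto simp: norm_mult)
  finally show ?thesis .
qed

lemma norm_exp_lam_le: "exp (- lam \<xi>) \<le> exp c0 * exp (- c0 * norm \<xi>)"
proof -
  have "norm \<xi> - 1 \<le> norm \<xi> powr \<alpha>"
  proof (cases "norm \<xi> \<ge> 1")
    case True
    then have "norm \<xi> powr 1 \<le> norm \<xi> powr \<alpha>" using alpha_gt_1 by (intro powr_mono) auto
    then show ?thesis using True by simp
  qed (use powr_ge_zero[of "norm \<xi>" \<alpha>] in linarith)
  then have "c0 * (norm \<xi> - 1) \<le> lam \<xi>"
    using c0 by (intro order_trans[OF _ lam_lower] mult_left_mono) auto
  then show ?thesis by (simp add: exp_add[symmetric] algebra_simps)
qed

lemma integrable_norm_exp_lam: "integrable lborel (\<lambda>\<xi>. norm \<xi> * exp (- lam \<xi>))"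
  using integrable_exp_decay[of "\<lambda>\<xi>. exp (- lam \<xi>)" "exp c0" c0 1] norm_exp_lam_le c0 by simp

lemma norm_mult_exp_lam_le: "norm \<xi> * exp (- lam \<xi>) \<le> exp c0 * (1 / c0)"
proof -
  have "norm \<xi> * exp (- lam \<xi>) \<le> norm \<xi> * (exp c0 * exp (- c0 * norm \<xi>))"
    by (intro mult_left_mono norm_exp_lam_le) auto
  also have "\<dots> = exp c0 * (norm \<xi> ^ 1 * exp (- c0 * norm \<xi>))" by simp
  also have "\<dots> \<le> exp c0 * (real 1 / c0) ^ 1"
    using c0 by (intro mult_left_mono power_times_exp_le) auto
  finally show ?thesis by simp
qed

lemma one_minus_exp_lam_le: "1 - exp (- lam \<xi>) \<le> max 1 C0 * norm \<xi>"
proof (cases "norm \<xi> \<ge> 1")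
  case True
  have "1 - exp (- lam \<xi>) \<le> 1 * norm \<xi>" using True by (smt (verit) exp_gt_zero)
  also have "\<dots> \<le> max 1 C0 * norm \<xi>" by (intro mult_right_mono) auto
  finally show ?thesis .
next
  case False
  have "1 - exp (- lam \<xi>) \<le> lam \<xi>" using exp_ge_add_one_self[of "- lam \<xi>"] by simp
  also have "\<dots> \<le> C0 * norm \<xi> powr \<alpha>" by (rule lam_upper)
  also have "\<dots> \<le> max 1 C0 * norm \<xi> powr \<alpha>" by (intro mult_right_mono) auto
  also have "\<dots> \<le> max 1 C0 * norm \<xi> powr 1"
    using False alpha_gt_1 by (intro mult_left_mono powr_mono') auto
  finally show ?thesis by simp
qed

definition tail_const :: real where
  "tail_const = max 1 C0 * (\<integral>\<xi>. norm \<xi> * gauss_kernel 1 \<xi> \<partial>(lborel :: 'a measure))"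

text \<open>The truncation inequality for characteristic functions, with a Gaussian average in place
  of an interval: the mass outside radius R is the average of \<open>1 - exp (- lam \<xi>)\<close>
  against \<open>gauss_kernel R\<close>. The integrand is at most linear and the kernel has first
  moment of order 1/R.\<close>

lemma tail_le:
  assumes R: "R > 0"
  shows "(\<integral>x. 1 - gauss (1 / R) x \<partial>\<mu>) \<le> tail_const / R"
proof -
  let ?g = "gauss_kernel R :: 'a \<Rightarrow> real"
  note gi = gauss_kernel_integrable[OF R, where 'a='a]
  have gi': "integrable lborel ?g" using gi by (simp add: complex_of_real_integrable_eq)
  have [measurable]: "gauss_kernel r \<in> borel_measurable (borel :: 'a measure)" for r
    unfolding gauss_kernel_def by measurable
  have g1: "(\<integral>\<xi>. ?g \<xi> \<partial>lborel) = 1"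
    using gauss_kernel_transform[OF R, of "0::'a"] by (simp add: gauss_def[of _ 0])
  have "integrable lborel (\<lambda>\<xi>::'a. norm \<xi> ^ 1 * gauss 1 \<xi>)"
    by (rule integrable_exp_decay[where B="exp (1 / 2)" and c=1])
       (rule borel_measurable_gauss less_imp_le[OF gauss_pos] gauss_le_exp zero_less_one)+
  from integrable_mult_right[OF this, of "(1 / sqrt (2 * pi)) ^ DIM('a)"]
  have n1: "integrable lborel (\<lambda>\<xi>::'a. norm \<xi> * gauss_kernel 1 \<xi>)"
    unfolding gauss_kernel_def by (simp add: mult.left_commute)
  have sc: "norm (R *\<^sub>R \<xi>) * gauss_kernel 1 (R *\<^sub>R \<xi>) = (1 / R ^ DIM('a)) * R * (norm \<xi> * ?g \<xi>)" for \<xi>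
    using R by (simp add: gauss_kernel_def gauss_def power_divide)
  have "integrable lborel (\<lambda>\<xi>::'a. norm (R *\<^sub>R \<xi>) * gauss_kernel 1 (R *\<^sub>R \<xi>))"
    using integrable_lborel_scaleR[OF _ n1, of R] R by simp
  from integrable_mult_right[OF this[unfolded sc], of "R ^ DIM('a) / R"]
  have nR: "integrable lborel (\<lambda>\<xi>::'a. norm \<xi> * ?g \<xi>)"
    using R by (simp add: mult.assoc[symmetric])
  have eqR: "(\<integral>\<xi>. norm \<xi> * ?g \<xi> \<partial>lborel) = (\<integral>\<xi>. norm \<xi> * gauss_kernel 1 \<xi> \<partial>(lborel :: 'a measure)) / R"
  proof -
    have "(\<integral>\<xi>. norm \<xi> * gauss_kernel 1 \<xi> \<partial>(lborel :: 'a measure)) =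
        R ^ DIM('a) * (\<integral>\<xi>. norm (R *\<^sub>R \<xi>) * gauss_kernel 1 (R *\<^sub>R \<xi>) \<partial>(lborel :: 'a measure))"
      using R by (subst integral_lborel_scaleR[of R]) auto
    also have "\<dots> = R * (\<integral>\<xi>. norm \<xi> * ?g \<xi> \<partial>lborel)"
      unfolding sc integral_mult_right_zero using R by simp
    finally show ?thesis using R by simp
  qed
  have ei: "integrable lborel (\<lambda>\<xi>. ?g \<xi> * exp (- lam \<xi>))"
    by (rule Bochner_Integration.integrable_bound[OF gi'])
       (use gauss_kernel_nonneg[OF R] lam_nonneg in \<open>auto intro!: AE_I2 simp: abs_mult mult_left_le\<close>)
  have gm: "integrable \<mu> (gauss (1 / R) :: 'a \<Rightarrow> real)"
    by (rule integrable_const_bound[of _ 1]) (auto simp: gauss_le_1 less_imp_le[OF gauss_pos])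
  have "complex_of_real (\<integral>x. gauss (1 / R) x \<partial>\<mu>) = complex_of_real (\<integral>\<xi>. ?g \<xi> * exp (- lam \<xi>) \<partial>lborel)"
  proof -
    have "(CLINT x|\<mu>. complex_of_real (gauss (1 / R) x)) =
        (CLINT \<xi>|lborel. complex_of_real (?g \<xi>) * complex_of_real (exp (- lam \<xi>)))"
      unfolding integral_mult_char[OF gi] gauss_kernel_transform[OF R] ..
    then show ?thesis by (simp flip: of_real_mult)
  qed
  then have e: "(\<integral>x. gauss (1 / R) x \<partial>\<mu>) = (\<integral>\<xi>. ?g \<xi> * exp (- lam \<xi>) \<partial>lborel)"
    using of_real_eq_iff by blast
  have "(\<integral>x. 1 - gauss (1 / R) x \<partial>\<mu>) = (\<integral>\<xi>. ?g \<xi> - ?g \<xi> * exp (- lam \<xi>) \<partial>lborel)"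
    using gm gi' ei by (simp add: e g1 prob_space)
  also have "\<dots> \<le> (\<integral>\<xi>. max 1 C0 * (norm \<xi> * ?g \<xi>) \<partial>lborel)"
  proof (rule integral_mono)
    show "?g \<xi> - ?g \<xi> * exp (- lam \<xi>) \<le> max 1 C0 * (norm \<xi> * ?g \<xi>)" for \<xi>
      using mult_left_mono[OF one_minus_exp_lam_le[of \<xi>] gauss_kernel_nonneg[OF R, of \<xi>]] by (simp add: algebra_simps)
  qed (use gi' ei nR in auto)
  also have "\<dots> = tail_const / R" by (simp add: eqR tail_const_def)
  finally show ?thesis .
qed

text \<open>The test function is split into its smoothing \<open>\<Theta>\<close> at frequency scale
  1/R and the rest. For \<open>\<Theta>\<close> a sup bound of order R^d meets the integrable weight
  |\<xi>| exp(-lam); on the side of \<mu> the rest carries the factor 1 - gauss (1 / R), whose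
  integral is a tail.\<close>

lemma char_diff_pairing_le:
  fixes v :: 'a and \<phi> :: "'a \<Rightarrow> complex"
  assumes R: "R > 0" and \<phi>: "integrable lborel \<phi>" and S: "0 \<le> S" "\<And>y. cmod (fourier \<phi> y) \<le> S"
  shows "cmod (CLINT \<xi>|lborel. \<phi> \<xi> * ((1 - iexp (\<xi> \<bullet> v)) * complex_of_real (exp (- lam \<xi>)))) \<le>
    ((R / sqrt (2 * pi)) ^ DIM('a) * (norm v * (\<integral>\<xi>. norm \<xi> * exp (- lam \<xi>) \<partial>lborel))
      + (3 * (tail_const / R) + (norm v / R)\<^sup>2)) * S"
proof -
  let ?h = "\<lambda>\<xi>. complex_of_real (exp (- lam \<xi>))"
  let ?g = "\<lambda>\<xi>::'a. complex_of_real (gauss_kernel R \<xi>)"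
  let ?\<chi> = "gauss (1 / R) :: 'a \<Rightarrow> real"
  define F where "F \<psi> x = (CLINT \<xi>|lborel. \<psi> \<xi> * iexp (\<xi> \<bullet> x))" for \<psi> :: "'a \<Rightarrow> complex" and x
  have [measurable]: "\<phi> \<in> borel_measurable borel" using \<phi> by auto
  have FS: "cmod (F \<phi> x) \<le> S" for x
    using S(2)[of "-x"] by (simp add: F_def fourier_def)
  have Fm[measurable]: "F \<psi> \<in> borel_measurable borel" if "integrable lborel \<psi>" for \<psi>
    unfolding F_def using borel_measurable_integral_iexp[of \<psi> 1] that by simp
  \<comment> \<open>Multiplication by \<open>iexp (\<xi> \<bullet> v)\<close> becomes translation by
    \<open>v\<close> on the side of \<mu>, so the pairing is the mean of a first difference.\<close>
  have pair: "(CLINT \<xi>|lborel. \<psi> \<xi> * ((1 - iexp (\<xi> \<bullet> v)) * ?h \<xi>)) = (CLINT x|\<mu>. F \<psi> x - F \<psi> (x + v))"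
    if \<psi>: "integrable lborel \<psi>" and b: "\<And>x. cmod (F \<psi> x) \<le> B" for \<psi> B
  proof -
    have \<psi>v: "integrable lborel (\<lambda>\<xi>. \<psi> \<xi> * iexp (\<xi> \<bullet> v))" by (rule integrable_mult_iexp[OF \<psi>])
    have hi: "integrable lborel (\<lambda>\<xi>. \<theta> \<xi> * ?h \<xi>)" if "integrable lborel \<theta>" for \<theta> :: "'a \<Rightarrow> complex"
      using fs_bound_integrable[OF that fs_bound_char] .
    have sh: "F (\<lambda>\<xi>. \<psi> \<xi> * iexp (\<xi> \<bullet> v)) x = F \<psi> (x + v)" for x
      by (simp add: F_def inner_add_right mult_exp_exp algebra_simps)
    have "(CLINT \<xi>|lborel. \<psi> \<xi> * ((1 - iexp (\<xi> \<bullet> v)) * ?h \<xi>)) =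
       (CLINT \<xi>|lborel. \<psi> \<xi> * ?h \<xi>) - (CLINT \<xi>|lborel. (\<psi> \<xi> * iexp (\<xi> \<bullet> v)) * ?h \<xi>)"
      using hi[OF \<psi>] hi[OF \<psi>v] by (subst Bochner_Integration.integral_diff[symmetric]) (auto simp: algebra_simps)
    also have "\<dots> = (CLINT x|\<mu>. F \<psi> x) - (CLINT x|\<mu>. F \<psi> (x + v))"
      unfolding integral_mult_char[OF \<psi>] integral_mult_char[OF \<psi>v] F_def[symmetric] sh ..
    also have "\<dots> = (CLINT x|\<mu>. F \<psi> x - F \<psi> (x + v))"
      using Fm[OF \<psi>] by (intro Bochner_Integration.integral_diff[symmetric] integrable_const_bound[of _ B]) (auto simp: b)
    finally show ?thesis .
  qed
  define \<Theta> where "\<Theta> \<xi> = (CLINT \<zeta>|lborel. \<phi> \<zeta> * ?g (\<xi> - \<zeta>))" for \<xi>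
  note gi = gauss_kernel_integrable[OF R, where 'a='a]
  have \<Theta>: "integrable lborel \<Theta>"
    unfolding \<Theta>_def by (rule convolution_integrable[OF \<phi> gi])
  have F\<Theta>: "F \<Theta> x = F \<phi> x * complex_of_real (?\<chi> x)" for x
    unfolding F_def \<Theta>_def convolution_transform[OF \<phi> gi] gauss_kernel_transform[OF R] ..
  have \<chi>: "0 < ?\<chi> x" "?\<chi> x \<le> 1" for x by (simp_all add: gauss_pos gauss_le_1)
  have F\<Theta>b: "cmod (F \<Theta> x) \<le> S" for x
    using mult_mono[OF FS[of x] \<chi>(2)[of x] S(1)] \<chi>(1)[of x] by (simp add: F\<Theta> norm_mult)
  have near: "cmod (CLINT \<xi>|lborel. \<Theta> \<xi> * ((1 - iexp (\<xi> \<bullet> v)) * ?h \<xi>)) \<le>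
      S * (R / sqrt (2 * pi)) ^ DIM('a) * (norm v * (\<integral>\<xi>. norm \<xi> * exp (- lam \<xi>) \<partial>lborel))"
  proof -
    have "cmod (CLINT \<xi>|lborel. \<Theta> \<xi> * ((1 - iexp (\<xi> \<bullet> v)) * ?h \<xi>)) \<le>
       (\<integral>\<xi>. S * (R / sqrt (2 * pi)) ^ DIM('a) * (norm v * (norm \<xi> * exp (- lam \<xi>))) \<partial>lborel)"
    proof (rule order_trans[OF integral_norm_bound], rule integral_mono)
      show "integrable lborel (\<lambda>\<xi>. cmod (\<Theta> \<xi> * ((1 - iexp (\<xi> \<bullet> v)) * ?h \<xi>)))"
        by (intro integrable_norm fs_bound_integrable[OF \<Theta> fs_bound_mult[OF fs_bound_one_minus_iexp fs_bound_char]])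
      show "integrable lborel (\<lambda>\<xi>. S * (R / sqrt (2 * pi)) ^ DIM('a) * (norm v * (norm \<xi> * exp (- lam \<xi>))))"
        by (intro integrable_mult_right integrable_norm_exp_lam)
      fix \<xi> :: 'a
      have 1: "cmod (\<Theta> \<xi>) \<le> S * (R / sqrt (2 * pi)) ^ DIM('a)"
        unfolding \<Theta>_def by (rule convolution_gauss_kernel_le[OF \<phi> S(2) R])
      have 2: "cmod (1 - iexp (\<xi> \<bullet> v)) \<le> norm v * norm \<xi>"
        using cmod_one_minus_iexp_le[of "\<xi> \<bullet> v"] Cauchy_Schwarz_ineq2[of \<xi> v]
        by (metis mult.commute order_trans)
      have "cmod (\<Theta> \<xi> * ((1 - iexp (\<xi> \<bullet> v)) * ?h \<xi>)) = cmod (\<Theta> \<xi>) * (cmod (1 - iexp (\<xi> \<bullet> v)) * exp (- lam \<xi>))"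
        by (simp add: norm_mult)
      also have "\<dots> \<le> S * (R / sqrt (2 * pi)) ^ DIM('a) * ((norm v * norm \<xi>) * exp (- lam \<xi>))"
        by (intro mult_mono 1 mult_right_mono 2) (use S R in auto)
      finally show "cmod (\<Theta> \<xi> * ((1 - iexp (\<xi> \<bullet> v)) * ?h \<xi>)) \<le>
        S * (R / sqrt (2 * pi)) ^ DIM('a) * (norm v * (norm \<xi> * exp (- lam \<xi>)))" by (simp add: mult.assoc)
    qed
    then show ?thesis by simp
  qed
  have mi: "integrable \<mu> f" if "f \<in> borel_measurable borel" "\<And>x. \<bar>f x\<bar> \<le> B" for f :: "'a \<Rightarrow> real" and B
    by (rule integrable_const_bound[of _ B]) (use that in auto)
  have \<chi>i: "integrable \<mu> (\<lambda>x. 1 - ?\<chi> (x + w))" for w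
    using \<chi>[of "_ + w"] by (intro mi[of _ 1]) (auto simp: abs_le_iff less_imp_le intro: order_trans[of _ 0])
  have \<chi>i0: "integrable \<mu> (\<lambda>x. 1 - ?\<chi> x)" using \<chi>i[of 0] by simp
  let ?far = "\<lambda>x. F \<phi> x * complex_of_real (1 - ?\<chi> x) - F \<phi> (x + v) * complex_of_real (1 - ?\<chi> (x + v))"
  have Fi: "integrable \<mu> (\<lambda>x. F \<psi> x - F \<psi> (x + v))" if "integrable lborel \<psi>" "\<And>x. cmod (F \<psi> x) \<le> S" for \<psi>
    using Fm[OF that(1)] that(2)
    by (intro Bochner_Integration.integrable_diff integrable_const_bound[of _ S]) auto
  have "(CLINT x|\<mu>. F \<phi> x - F \<phi> (x + v)) - (CLINT x|\<mu>. F \<Theta> x - F \<Theta> (x + v)) = (CLINT x|\<mu>. ?far x)"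
    using Fi[OF \<phi> FS] Fi[OF \<Theta> F\<Theta>b]
    by (subst Bochner_Integration.integral_diff[symmetric]) (auto simp: F\<Theta> algebra_simps)
  moreover have "cmod (CLINT x|\<mu>. ?far x) \<le> S * (3 * (tail_const / R) + (norm v / R)\<^sup>2)"
  proof -
    \<comment> \<open>The 3 is 1 for the cutoff at \<open>x\<close> plus 2 for the cutoff at
      \<open>x + v\<close>, by the quasi-subadditivity of 1 - gauss; the remaining term, twice 1 -
      gauss at \<open>v\<close>, is at most \<open>(norm v / R)\<^sup>2\<close>.\<close>
    let ?b = "\<lambda>x. S * (3 * (1 - ?\<chi> x) + 2 * (1 - ?\<chi> v))"
    have le: "cmod (?far x) \<le> ?b x" for x
    proof -
      have "cmod (?far x) \<le> cmod (F \<phi> x) * (1 - ?\<chi> x) + cmod (F \<phi> (x + v)) * (1 - ?\<chi> (x + v))"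
        using \<chi>(2)[of x] \<chi>(2)[of "x + v"] by (intro order_trans[OF norm_triangle_ineq4]) (simp add: norm_mult del: of_real_diff)
      also have "\<dots> \<le> S * (1 - ?\<chi> x) + S * (1 - ?\<chi> (x + v))"
        using \<chi>(2)[of x] \<chi>(2)[of "x + v"] by (intro add_mono mult_right_mono FS) auto
      also have "\<dots> \<le> S * (1 - ?\<chi> x) + S * (2 * (1 - ?\<chi> x) + 2 * (1 - ?\<chi> v))"
        by (intro add_left_mono mult_left_mono one_minus_gauss_add_le S)
      finally show ?thesis by (simp add: algebra_simps)
    qed
    have "cmod (CLINT x|\<mu>. ?far x) \<le> (\<integral>x. ?b x \<partial>\<mu>)"
    proof (rule order_trans[OF integral_norm_bound], rule integral_mono)
      show bi: "integrable \<mu> ?b" by (intro integrable_mult_right Bochner_Integration.integrable_add \<chi>i0) simp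
      have "integrable \<mu> ?far"
      proof (rule Bochner_Integration.integrable_bound[OF bi])
        show "?far \<in> borel_measurable \<mu>" using Fm[OF \<phi>] by measurable
        show "AE x in \<mu>. cmod (?far x) \<le> norm (?b x)"
          unfolding real_norm_def by (intro AE_I2 order_trans[OF le abs_ge_self])
      qed
      then show "integrable \<mu> (\<lambda>x. cmod (?far x))" by (rule integrable_norm)
    qed (rule le)
    also have "\<dots> = S * (3 * (\<integral>x. 1 - ?\<chi> x \<partial>\<mu>) + 2 * (1 - ?\<chi> v))"
      using \<chi>i0 by (simp only: integral_mult_right_zero Bochner_Integration.integral_add integrable_mult_right integrable_const)
         (use prob_space in simp)
    also have "\<dots> \<le> S * (3 * (tail_const / R) + (norm v / R)\<^sup>2)"
      using tail_le[OF R] one_minus_gauss_le[of "1 / R" v] by (intro mult_left_mono S add_mono) auto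
    finally show ?thesis .
  qed
  ultimately have "cmod ((CLINT x|\<mu>. F \<phi> x - F \<phi> (x + v)) - (CLINT x|\<mu>. F \<Theta> x - F \<Theta> (x + v)))
    \<le> S * (3 * (tail_const / R) + (norm v / R)\<^sup>2)" by simp
  with near show ?thesis
    unfolding pair[OF \<phi> FS] pair[OF \<Theta> F\<Theta>b]
    using norm_triangle_ineq2[of "CLINT x|\<mu>. F \<phi> x - F \<phi> (x + v)" "CLINT x|\<mu>. F \<Theta> x - F \<Theta> (x + v)"]
    by (simp add: algebra_simps)
qed


lemma char_diff_bound:
  defines "\<kappa> \<equiv> 1 / (real DIM('a) + 1)"
  obtains K where "K \<ge> 0"
    "\<And>v. fs_bound (K * norm v powr \<kappa>) (\<lambda>\<xi>. (1 - iexp (\<xi> \<bullet> v)) * complex_of_real (exp (- lam \<xi>)))"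
proof -
  define N where "N = (1 / sqrt (2 * pi)) ^ DIM('a) * (\<integral>\<xi>. norm \<xi> * exp (- lam \<xi>) \<partial>lborel)"
  define B where "B = exp c0 * (1 / c0)"
  \<comment> \<open>The summands serve in turn the near part, the far part with the shift of the
    cutoff, the pointwise bound, and the trivial bound 2 for |v| > 1.\<close>
  define K where "K = N + (3 * tail_const + 1) + B + 2"
  have tc: "tail_const \<ge> 0"
    unfolding tail_const_def
    by (intro mult_nonneg_nonneg integral_nonneg_AE AE_I2) (auto simp: gauss_kernel_nonneg)
  have N: "N \<ge> 0" unfolding N_def by (intro mult_nonneg_nonneg integral_nonneg_AE AE_I2) auto
  have B: "B \<ge> 0" using c0 by (simp add: B_def)
  have \<kappa>: "0 < \<kappa>" "\<kappa> \<le> 1" by (auto simp: \<kappa>_def field_simps)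
  let ?f = "\<lambda>v \<xi>. (1 - iexp (\<xi> \<bullet> v)) * complex_of_real (exp (- lam \<xi>))"
  have "fs_bound (K * norm v powr \<kappa>) (?f v)" for v
  proof -
    consider "v = 0" | "0 < norm v" "norm v \<le> 1" | "norm v > 1" by fastforce
    then show ?thesis
    proof cases
      case 1
      then show ?thesis using fs_bound_const[of 0] by simp
    next
      case 3
      have "2 * 1 \<le> K * norm v powr \<kappa>"
        using N tc B 3 \<kappa> by (intro mult_mono) (auto simp: K_def ge_one_powr_ge_zero)
      then show ?thesis
        using fs_bound_mono[OF fs_bound_mult[OF fs_bound_one_minus_iexp fs_bound_char]] by simp
    next
      case 2
      define w where "w = norm v"
      have w: "0 < w" "w \<le> 1" using 2 by (simp_all add: w_def)
      have ww: "w \<le> w powr \<kappa>" using powr_mono'[of \<kappa> 1 w] w \<kappa> by simp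
      \<comment> \<open>The value at which \<open>R ^ d * w\<close> and \<open>1 / R\<close>
        coincide: both equal \<open>w powr \<kappa>\<close>, since (d + 1) \<kappa> = 1.\<close>
      define R where "R = w powr (- \<kappa>)"
      have R: "R > 0" using w by (simp add: R_def)
      have wR: "w powr \<kappa> = 1 / R" using w by (simp add: R_def powr_minus_divide)
      have "R ^ DIM('a) * w = w powr (- \<kappa> * real DIM('a)) * w powr 1"
        using w by (simp add: R_def powr_powr powr_realpow[symmetric])
      also have "\<dots> = w powr \<kappa>"
        unfolding powr_add[symmetric] by (rule arg_cong[where f="\<lambda>x. w powr x"]) (simp add: \<kappa>_def field_simps)
      finally have Rd: "R ^ DIM('a) * w = w powr \<kappa>" .
      have "(w / R)\<^sup>2 = (w powr \<kappa>)\<^sup>2 * w\<^sup>2" by (simp add: wR power_divide)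
      also have "\<dots> \<le> 1 * w"
        using w \<kappa> by (intro mult_mono) (auto simp: power2_eq_square mult_le_one powr_le1 mult_left_le)
      finally have wR2: "(w / R)\<^sup>2 \<le> w powr \<kappa>" using ww by simp
      have le: "(R / sqrt (2 * pi)) ^ DIM('a) * (w * (\<integral>\<xi>. norm \<xi> * exp (- lam \<xi>) \<partial>lborel))
          + (3 * (tail_const / R) + (w / R)\<^sup>2) \<le> K * w powr \<kappa>"
      proof -
        have "(R / sqrt (2 * pi)) ^ DIM('a) * (w * (\<integral>\<xi>. norm \<xi> * exp (- lam \<xi>) \<partial>lborel)) = N * (R ^ DIM('a) * w)"
          by (simp add: N_def power_divide)
        also have "\<dots> = N * w powr \<kappa>" by (simp only: Rd)
        finally have "(R / sqrt (2 * pi)) ^ DIM('a) * (w * (\<integral>\<xi>. norm \<xi> * exp (- lam \<xi>) \<partial>lborel))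
          + (3 * (tail_const / R) + (w / R)\<^sup>2) \<le> N * w powr \<kappa> + (3 * tail_const * w powr \<kappa> + w powr \<kappa>)"
          using wR2 by (simp add: wR)
        also have "\<dots> \<le> K * w powr \<kappa>"
          using B w by (simp add: K_def ring_distribs)
        finally show ?thesis .
      qed
      show ?thesis
      proof (rule fs_boundI)
        show "0 \<le> K * norm v powr \<kappa>" using N tc B by (simp add: K_def)
        show "?f v \<in> borel_measurable borel" by measurable
        show "cmod (?f v \<xi>) \<le> K * norm v powr \<kappa>" for \<xi>
        proof -
          have "cmod (?f v \<xi>) \<le> (norm v * norm \<xi>) * exp (- lam \<xi>)"
            using cmod_one_minus_iexp_le[of "\<xi> \<bullet> v"] Cauchy_Schwarz_ineq2[of \<xi> v]
            by (simp add: norm_mult mult.commute[of "norm v"])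
          also have "\<dots> \<le> norm v * B"
            using norm_mult_exp_lam_le[of \<xi>] unfolding B_def mult.assoc by (intro mult_left_mono) auto
          also have "\<dots> \<le> norm v powr \<kappa> * K"
            using ww B N tc by (intro mult_mono) (auto simp: w_def K_def)
          finally show ?thesis by (simp add: mult.commute)
        qed
        fix \<phi> :: "'a \<Rightarrow> complex" and S
        assume \<phi>: "integrable lborel \<phi>" "0 \<le> S" "\<And>y. cmod (fourier \<phi> y) \<le> S"
        show "cmod (CLINT \<xi>|lborel. \<phi> \<xi> * ?f v \<xi>) \<le> K * norm v powr \<kappa> * S"
          using char_diff_pairing_le[OF R \<phi>, of v] mult_right_mono[OF le \<phi>(2)]
          unfolding w_def by linarith
      qed
    qed
  qed
  moreover have "K \<ge> 0" using N tc B by (simp add: K_def)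
  ultimately show thesis using that by blast
qed

text \<open>By homogeneity a dilation by n^(-1/\<alpha>) turns exp(-lam) into its n-th root. The
  norm is invariant under dilation, so only the shift \<open>v\<close> is rescaled.\<close>

lemma char_scaled_diff_bound:
  defines "\<kappa> \<equiv> 1 / (real DIM('a) + 1)"
  assumes n: "n > 0"
  obtains K where "K \<ge> 0"
    "\<And>v. fs_bound (K * norm v powr \<kappa>) (\<lambda>\<xi>. (1 - iexp (\<xi> \<bullet> v)) * complex_of_real (exp (- lam \<xi> / n)))"
proof -
  obtain K where K: "K \<ge> 0"
    "\<And>v. fs_bound (K * norm v powr \<kappa>) (\<lambda>\<xi>. (1 - iexp (\<xi> \<bullet> v)) * complex_of_real (exp (- lam \<xi>)))"
    unfolding \<kappa>_def using char_diff_bound by blast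
  define s where "s = n powr (- (1 / \<alpha>))"
  have s: "s > 0" using n by (simp add: s_def)
  have ls: "lam (s *\<^sub>R \<xi>) = lam \<xi> / n" for \<xi>
  proof -
    have "s powr \<alpha> = n powr (- 1)" unfolding s_def powr_powr using alpha_gt_1 by simp
    then show ?thesis using n by (simp add: lam_scale[OF s] powr_minus_divide)
  qed
  have "fs_bound (K * (1 / s) powr \<kappa> * norm v powr \<kappa>) (\<lambda>\<xi>. (1 - iexp (\<xi> \<bullet> v)) * complex_of_real (exp (- lam \<xi> / n)))" for v
    using fs_bound_dilate[OF K(2)[of "(1 / s) *\<^sub>R v"], of s] s by (simp add: ls powr_mult powr_divide)
  then show thesis using that[of "K * (1 / s) powr \<kappa>"] K(1) by simp
qed

lemma cos_power_bound:
  obtains K where "K \<ge> 0"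
    "\<And>v. fs_bound (K * min 1 ((norm v)\<^sup>2))
       (\<lambda>\<xi>. complex_of_real ((1 - cos (\<xi> \<bullet> v)) ^ (DIM('a) + 1) * exp (- lam \<xi>)))"
proof -
  define k where "k = DIM('a) + 1"
  \<comment> \<open>Each of the \<open>k\<close> cosine factors splits into two differences, so 2k
    roots of exp(-lam) are needed, one per difference. The total gain is |v|^(2 k \<kappa>) =
    |v|^2.\<close>
  define n where "n = 2 * real k"
  define \<kappa> where "\<kappa> = 1 / (real DIM('a) + 1)"
  have n: "n > 0" by (simp add: n_def k_def)
  obtain K where K: "K \<ge> 0"
    "\<And>v. fs_bound (K * norm v powr \<kappa>) (\<lambda>\<xi>. (1 - iexp (\<xi> \<bullet> v)) * complex_of_real (exp (- lam \<xi> / n)))"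
    using char_scaled_diff_bound[OF n] unfolding \<kappa>_def by blast
  let ?w = "\<lambda>\<xi>. complex_of_real (exp (- lam \<xi> / n))"
  have eq: "complex_of_real ((1 - cos (\<xi> \<bullet> v)) ^ k * exp (- lam \<xi>)) =
      (1 / 2 * (((1 - iexp (\<xi> \<bullet> v)) * ?w \<xi>) * ((1 - iexp (\<xi> \<bullet> (- v))) * ?w \<xi>))) ^ k" for \<xi> v
  proof -
    have "1 / 2 * (((1 - iexp (\<xi> \<bullet> v)) * ?w \<xi>) * ((1 - iexp (\<xi> \<bullet> (- v))) * ?w \<xi>))
       = (1 / 2 * ((1 - iexp (\<xi> \<bullet> v)) * (1 - iexp (- (\<xi> \<bullet> v))))) * (?w \<xi> * ?w \<xi>)"
      by simp
    also have "1 / 2 * ((1 - iexp (\<xi> \<bullet> v)) * (1 - iexp (- (\<xi> \<bullet> v)))) = complex_of_real (1 - cos (\<xi> \<bullet> v))"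
      by (rule one_minus_cos_eq_iexp[symmetric])
    also have "?w \<xi> * ?w \<xi> = complex_of_real (exp (- lam \<xi> / real k))"
      by (simp add: n_def exp_add[symmetric] flip: of_real_mult)
    also have "(complex_of_real (1 - cos (\<xi> \<bullet> v)) * complex_of_real (exp (- lam \<xi> / real k))) ^ k =
       complex_of_real ((1 - cos (\<xi> \<bullet> v)) ^ k * exp (real k * (- lam \<xi> / real k)))"
      unfolding exp_of_nat_mult by (simp add: power_mult_distrib)
    also have "real k * (- lam \<xi> / real k) = - lam \<xi>" by (simp add: k_def)
    finally show ?thesis by simp
  qed
  have b1: "fs_bound ((1 / 2 * (K * K)) ^ k * (norm v)\<^sup>2)
     (\<lambda>\<xi>. complex_of_real ((1 - cos (\<xi> \<bullet> v)) ^ k * exp (- lam \<xi>)))" for v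
  proof -
    have "fs_bound ((cmod (1 / 2) * ((K * norm v powr \<kappa>) * (K * norm (- v) powr \<kappa>))) ^ k)
      (\<lambda>\<xi>. complex_of_real ((1 - cos (\<xi> \<bullet> v)) ^ k * exp (- lam \<xi>)))"
      unfolding eq by (intro fs_bound_power fs_bound_cmult fs_bound_mult K(2))
    moreover have "(norm v powr \<kappa> * norm v powr \<kappa>) ^ k = (norm v)\<^sup>2"
    proof (cases "v = 0")
      case False
      have "(norm v powr \<kappa> * norm v powr \<kappa>) ^ k = (norm v powr (\<kappa> + \<kappa>)) powr real k"
        using False by (subst powr_realpow) (simp_all only: powr_add, simp_all)
      also have "\<dots> = norm v powr ((\<kappa> + \<kappa>) * real k)" by (rule powr_powr)
      also have "(\<kappa> + \<kappa>) * real k = real 2" by (simp add: \<kappa>_def k_def field_simps)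
      also have "norm v powr real 2 = (norm v)\<^sup>2" using False by (intro powr_realpow) simp
      finally show ?thesis .
    qed (simp add: k_def)
    moreover have "(cmod (1 / 2) * ((K * norm v powr \<kappa>) * (K * norm (- v) powr \<kappa>))) ^ k =
        (1 / 2 * (K * K)) ^ k * (norm v powr \<kappa> * norm v powr \<kappa>) ^ k"
      unfolding power_mult_distrib[symmetric] by (simp add: norm_divide mult.left_commute mult.commute mult.assoc)
    ultimately show ?thesis by simp
  qed
  \<comment> \<open>For large \<open>v\<close> the differences give nothing; this uniform bound caps
    the estimate, so that it is integrable against r^(-1-\<beta>) dr at infinity.\<close>
  have b2: "fs_bound (2 ^ k) (\<lambda>\<xi>. complex_of_real ((1 - cos (\<xi> \<bullet> v)) ^ k * exp (- lam \<xi>)))" for v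
  proof -
    have c: "complex_of_real (1 - cos (\<xi> \<bullet> v)) = 1 - 1 / 2 * (iexp (\<xi> \<bullet> v) + iexp (\<xi> \<bullet> (- v)))" for \<xi>
    proof -
      have "complex_of_real (cos (\<xi> \<bullet> v)) = (iexp (\<xi> \<bullet> v) + iexp (\<xi> \<bullet> (- v))) / 2"
        unfolding cos_eq_iexp by simp
      then show ?thesis by (simp only: of_real_diff of_real_1 times_divide_eq_left mult_1)
    qed
    have "fs_bound (1 + cmod (1 / 2) * (1 + 1)) (\<lambda>\<xi>. complex_of_real (1 - cos (\<xi> \<bullet> v)))"
      unfolding c by (intro fs_bound_diff fs_bound_one fs_bound_cmult fs_bound_add fs_bound_iexp)
    then have "fs_bound (2 ^ k) (\<lambda>\<xi>. complex_of_real (1 - cos (\<xi> \<bullet> v)) ^ k)"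
      by (intro fs_bound_power) simp
    from fs_bound_mult[OF this fs_bound_char] show ?thesis by simp
  qed
  define K' where "K' = max ((1 / 2 * (K * K)) ^ k) (2 ^ k)"
  have "fs_bound (K' * min 1 ((norm v)\<^sup>2)) (\<lambda>\<xi>. complex_of_real ((1 - cos (\<xi> \<bullet> v)) ^ k * exp (- lam \<xi>)))" for v
  proof (cases "1 \<le> (norm v)\<^sup>2")
    case True
    then show ?thesis by (intro fs_bound_mono[OF b2]) (simp add: K'_def)
  next
    case False
    then show ?thesis by (intro fs_bound_mono[OF b1]) (auto simp: K'_def intro!: mult_right_mono)
  qed
  moreover have "K' \<ge> 0" by (simp add: K'_def le_max_iff_disj)
  ultimately show thesis using that unfolding k_def by blast
qed

end

section \<open>Mixtures over the half line\<close>

text \<open>The measure r^q dr on the open half line. It occurs with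
  \<open>q = - 1 - \<beta>\<close> for jump sizes and with \<open>q = s - 1\<close> or
  \<open>q = t - 1\<close> for integral representations of powers.\<close>

definition powr_measure :: "real \<Rightarrow> real measure" where
  "powr_measure q = density lborel (\<lambda>r. ennreal (indicator {0<..} r * r powr q))"

lemma sets_powr_measure [simp, measurable_cong]: "sets (powr_measure q) = sets borel"
  and space_powr_measure [simp]: "space (powr_measure q) = UNIV"
  by (simp_all add: powr_measure_def)

lemma AE_powr_measure: "AE r in powr_measure q. P r" if "\<And>r. 0 < r \<Longrightarrow> P r"
  unfolding powr_measure_def by (subst AE_density) (auto simp: indicator_def that)

lemma integrable_powr_measure_iff:
  fixes g :: "real \<Rightarrow> 'c::{banach, second_countable_topology}"
  assumes "g \<in> borel_measurable borel"
  shows "integrable (powr_measure q) g \<longleftrightarrow> integrable lborel (\<lambda>r. (indicator {0<..} r * r powr q) *\<^sub>R g r)"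
  unfolding powr_measure_def using assms by (intro integrable_density) auto

lemma integral_powr_measure_eq:
  fixes g :: "real \<Rightarrow> 'c::{banach, second_countable_topology}"
  assumes "g \<in> borel_measurable borel"
  shows "(\<integral>r. g r \<partial>powr_measure q) = (\<integral>r. (indicator {0<..} r * r powr q) *\<^sub>R g r \<partial>lborel)"
  unfolding powr_measure_def using assms by (intro integral_density) auto

lemma sigma_finite_powr_measure: "sigma_finite_measure (powr_measure q)"
  unfolding powr_measure_def
  by (subst sigma_finite_measure.sigma_finite_iff_density_finite[OF sigma_finite_lborel]) auto

text \<open>The common origin of all power laws below: |a|^\<beta> from the cosine integral, A^s and
  L^s from the splitting of fractional powers, and (1 + lam)^(-t) from the Gamma integral.\<close>

lemma integral_powr_measure_scale:
  fixes g :: "real \<Rightarrow> 'c::{banach, second_countable_topology}"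
  assumes g[measurable]: "g \<in> borel_measurable borel" and a: "a > 0"
  shows "(\<integral>r. g (a * r) \<partial>powr_measure q) = a powr (- q - 1) *\<^sub>R (\<integral>r. g r \<partial>powr_measure q)"
    and "integrable (powr_measure q) g \<Longrightarrow> integrable (powr_measure q) (\<lambda>r. g (a * r))"
proof -
  define F where "F r = (indicator {0<..} r * r powr q) *\<^sub>R g r" for r
  have F: "F (0 + a * r) = a powr q *\<^sub>R ((indicator {0<..} r * r powr q) *\<^sub>R g (a * r))" for r
    using a by (auto simp: F_def indicator_def powr_mult zero_less_mult_iff)
  have "(\<integral>r. g r \<partial>powr_measure q) = (\<integral>r. F r \<partial>lborel)"
    unfolding F_def by (rule integral_powr_measure_eq[OF g])
  also have "\<dots> = \<bar>a\<bar> *\<^sub>R (\<integral>r. F (0 + a * r) \<partial>lborel)"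
    using a by (intro lborel_integral_real_affine) auto
  also have "\<dots> = \<bar>a\<bar> *\<^sub>R (a powr q *\<^sub>R (\<integral>r. (indicator {0<..} r * r powr q) *\<^sub>R g (a * r) \<partial>lborel))"
    unfolding F by (simp only: integral_scaleR_right)
  also have "\<dots> = (a * a powr q) *\<^sub>R (\<integral>r. g (a * r) \<partial>powr_measure q)"
    using a by (subst integral_powr_measure_eq) simp_all
  also have "a * a powr q = a powr (q + 1)" using a by (simp add: powr_add)
  finally show "(\<integral>r. g (a * r) \<partial>powr_measure q) = a powr (- q - 1) *\<^sub>R (\<integral>r. g r \<partial>powr_measure q)"
    using a by (simp add: powr_add[symmetric])
  assume "integrable (powr_measure q) g"
  then have "integrable lborel F" by (simp add: integrable_powr_measure_iff F_def[abs_def])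
  then have "integrable lborel (\<lambda>r. F (0 + a * r))"
    using a by (intro lborel_integrable_real_affine) auto
  from integrable_scaleR_right[OF this[unfolded F], of "a powr (- q)"]
  show "integrable (powr_measure q) (\<lambda>r. g (a * r))"
    using a by (simp add: integrable_powr_measure_iff powr_add[symmetric] mult.assoc[symmetric])
qed

lemma
  assumes q: "q > -1"
  shows integrable_powr_measure_exp: "integrable (powr_measure q) (\<lambda>r. exp (- r))"
    and integral_powr_measure_exp: "(\<integral>r. exp (- r) \<partial>powr_measure q) = Gamma (q + 1)"
proof -
  have eq: "ennreal ((indicator {0<..} t * t powr q) *\<^sub>R exp (- t)) = ennreal (indicator {0..} t * t powr (q + 1 - 1) / exp t)" for t :: real
    by (cases "t = 0") (auto simp: indicator_def exp_minus field_simps)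
  have nn: "(\<integral>\<^sup>+t. ennreal ((indicator {0<..} t * t powr q) *\<^sub>R exp (- t)) \<partial>lborel) = ennreal (Gamma (q + 1))"
    unfolding eq using q by (intro Gamma_conv_nn_integral_real[symmetric]) auto
  have "has_bochner_integral lborel (\<lambda>t. (indicator {0<..} t * t powr q) *\<^sub>R exp (- t)) (Gamma (q + 1))"
    using q nn by (intro has_bochner_integral_nn_integral) (auto intro: less_imp_le Gamma_real_pos)
  then show "integrable (powr_measure q) (\<lambda>r. exp (- r))"
      "(\<integral>r. exp (- r) \<partial>powr_measure q) = Gamma (q + 1)"
    by (auto simp: has_bochner_integral_iff integrable_powr_measure_iff integral_powr_measure_eq)
qed

lemma integrable_powr_measure_powr_exp:
  assumes "q + e > -1"
  shows "integrable (powr_measure q) (\<lambda>r. r powr e * exp (- r))"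
  using integrable_powr_measure_exp[OF assms]
  by (simp add: integrable_powr_measure_iff powr_add ac_simps)

lemma integrable_powr_measure_tail:
  assumes "q + e < -1"
  shows "integrable (powr_measure q) (\<lambda>r. indicator {1..} r * r powr e)"
proof -
  have "((\<lambda>r. r powr (q + e)) has_integral - (1 powr (q + e + 1)) / (q + e + 1)) {1..}"
    using assms by (intro has_integral_powr_to_inf) auto
  then have "(\<integral>\<^sup>+r. ennreal (indicator {1..} r * r powr (q + e)) \<partial>lborel) = ennreal (- (1 powr (q + e + 1)) / (q + e + 1))"
    by (intro nn_integral_has_integral_lebesgue) auto
  then have "integrable lborel (\<lambda>r. indicator {1..} r * r powr (q + e))"
    by (intro integrableI_nonneg) (auto simp: less_top[symmetric])
  also have "(\<lambda>r::real. indicator {1..} r * r powr (q + e)) = (\<lambda>r. (indicator {0<..} r * r powr q) *\<^sub>R (indicator {1..} r * r powr e))"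
    by (auto simp: indicator_def powr_add)
  finally show ?thesis by (simp add: integrable_powr_measure_iff)
qed

lemma integrable_powr_measure_bound:
  fixes g :: "real \<Rightarrow> 'c::{banach, second_countable_topology}"
  assumes [measurable]: "g \<in> borel_measurable borel"
    and B: "0 \<le> B" "\<And>r. 0 < r \<Longrightarrow> r \<le> 1 \<Longrightarrow> norm (g r) \<le> B * r powr e1" "\<And>r. 1 \<le> r \<Longrightarrow> norm (g r) \<le> B * r powr e2"
    and e: "q + e1 > -1" "q + e2 < -1"
  shows "integrable (powr_measure q) g"
proof (rule Bochner_Integration.integrable_bound)
  \<comment> \<open>On (0, 1] one has exp(1 - r) \<ge> 1, so a Gamma integrand dominates there; from
    1 on the pure power takes over.\<close>
  show "integrable (powr_measure q) (\<lambda>r. B * exp 1 * (r powr e1 * exp (- r)) + B * (indicator {1..} r * r powr e2))"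
    using e by (intro Bochner_Integration.integrable_add integrable_mult_right
        integrable_powr_measure_powr_exp integrable_powr_measure_tail)
  show "AE r in powr_measure q. norm (g r) \<le> norm (B * exp 1 * (r powr e1 * exp (- r)) + B * (indicator {1..} r * r powr e2))"
  proof (rule AE_powr_measure)
    fix r :: real assume r: "0 < r"
    have "norm (g r) \<le> B * exp 1 * (r powr e1 * exp (- r)) + B * (indicator {1..} r * r powr e2)"
    proof (cases "r \<le> 1")
      case True
      have "B * r powr e1 * 1 \<le> B * r powr e1 * exp (1 - r)"
        using True B by (intro mult_left_mono) auto
      also have "\<dots> = B * exp 1 * (r powr e1 * exp (- r))" by (simp add: exp_diff exp_minus field_simps)
      finally show ?thesis using B(2)[OF r True] B(1) by (smt (verit) indicator_pos_le mult_nonneg_nonneg powr_ge_zero)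
    next
      case False
      then have "norm (g r) \<le> B * (indicator {1..} r * r powr e2)" using B(3)[of r] by simp
      then show ?thesis using B(1) by (smt (verit) exp_gt_zero mult_nonneg_nonneg powr_ge_zero)
    qed
    then show "norm (g r) \<le> norm (B * exp 1 * (r powr e1 * exp (- r)) + B * (indicator {1..} r * r powr e2))"
      unfolding real_norm_def by (rule order_trans[OF _ abs_ge_self])
  qed
qed simp

lemma integral_powr_measure_pos:
  fixes g :: "real \<Rightarrow> real"
  assumes g: "integrable (powr_measure q) g" and nonneg: "\<And>r. 0 < r \<Longrightarrow> 0 \<le> g r"
    and pos: "\<And>r. 1 < r \<Longrightarrow> r < 2 \<Longrightarrow> 0 < g r"
  shows "0 < (\<integral>r. g r \<partial>powr_measure q)"
proof (rule ccontr)
  have nn: "AE r in powr_measure q. 0 \<le> g r" by (rule AE_powr_measure[OF nonneg])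
  assume "\<not> 0 < (\<integral>r. g r \<partial>powr_measure q)"
  then have "(\<integral>r. g r \<partial>powr_measure q) = 0" using integral_nonneg_AE[OF nn] by simp
  then have "AE r in powr_measure q. g r = 0"
    using integral_nonneg_eq_0_iff_AE[OF g nn] by simp
  then have "AE r in lborel. 0 < ennreal (indicator {0<..} r * r powr q) \<longrightarrow> g r = 0"
    unfolding powr_measure_def by (subst (asm) AE_density) auto
  then have "AE r in lborel. r \<notin> {1<..<2::real}"
    by (rule AE_mp) (intro AE_I2 impI notI, use pos in \<open>fastforce simp: indicator_def\<close>)
  then have "emeasure lborel {1<..<2::real} = 0"
    by (subst (asm) AE_iff_measurable[of "{1<..<2::real}"]) auto
  then show False by simp
qed

lemma fs_bound_powr_mixture:
  fixes m :: "real \<Rightarrow> 'a::euclidean_space \<Rightarrow> complex"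
  assumes m: "\<And>r. 0 < r \<Longrightarrow> fs_bound (c r) (m r)"
    and meas[measurable]: "(\<lambda>p. m (fst p) (snd p)) \<in> borel_measurable (borel \<Otimes>\<^sub>M borel)"
    and c: "integrable (powr_measure q) c"
  shows "fs_bound (\<integral>r. c r \<partial>powr_measure q) (\<lambda>\<xi>. \<integral>r. m r \<xi> \<partial>powr_measure q)"
proof -
  \<comment> \<open>\<open>fs_bound_mixture\<close> asks for a bound at every point of the space,
    whereas one is available only for positive \<open>r\<close>. Setting everything to 0 elsewhere
    alters neither integral.\<close>
  define m' c' where "m' r = (if 0 < r then m r else (\<lambda>_. 0))" and "c' r = (if 0 < r then c r else 0)" for r
  have [measurable]: "c \<in> borel_measurable borel" using borel_measurable_integrable[OF c] by simp
  have cm[measurable]: "c' \<in> borel_measurable borel" unfolding c'_def by measurable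
  have mm: "(\<lambda>p. m' (fst p) (snd p)) \<in> borel_measurable (powr_measure q \<Otimes>\<^sub>M borel)"
  proof -
    have "(\<lambda>p. if 0 < fst p then m (fst p) (snd p) else 0) \<in> borel_measurable (borel \<Otimes>\<^sub>M borel)"
      by measurable
    also have "(\<lambda>p. if 0 < fst p then m (fst p) (snd p) else 0) = (\<lambda>p. m' (fst p) (snd p))"
      by (auto simp: m'_def)
    finally show ?thesis by (simp cong: measurable_cong_sets sets_pair_measure_cong)
  qed
  have mm1: "(\<lambda>r. m r \<xi>) \<in> borel_measurable borel" for \<xi>
    using measurable_compose[OF measurable_Pair2' meas, of \<xi>] by simp
  have mm1': "(\<lambda>r. m' r \<xi>) \<in> borel_measurable borel" for \<xi>
    using measurable_compose[OF measurable_Pair2' mm, of \<xi>] by simp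
  have c'eq: "AE r in powr_measure q. c' r = c r" by (rule AE_powr_measure) (simp add: c'_def)
  have "fs_bound (\<integral>r. c' r \<partial>powr_measure q) (\<lambda>\<xi>. \<integral>r. m' r \<xi> \<partial>powr_measure q)"
  proof (rule fs_bound_mixture[OF sigma_finite_powr_measure _ mm])
    show "fs_bound (c' r) (m' r)" for r
      using m[of r] by (simp add: m'_def c'_def fs_bound_zero)
    show "integrable (powr_measure q) c'"
      by (subst integrable_cong_AE[OF _ _ c'eq], measurable) (rule c)
  qed
  also have "(\<integral>r. c' r \<partial>powr_measure q) = (\<integral>r. c r \<partial>powr_measure q)"
    by (rule integral_cong_AE[OF _ _ c'eq]) measurable
  also have "(\<lambda>\<xi>. \<integral>r. m' r \<xi> \<partial>powr_measure q) = (\<lambda>\<xi>. \<integral>r. m r \<xi> \<partial>powr_measure q)"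
    proof (intro ext integral_cong_AE)
    fix \<xi>
    note mm1[of \<xi>, measurable] mm1'[of \<xi>, measurable]
    show "(\<lambda>r. m' r \<xi>) \<in> borel_measurable (powr_measure q)" "(\<lambda>r. m r \<xi>) \<in> borel_measurable (powr_measure q)"
      by measurable
    show "AE r in powr_measure q. m' r \<xi> = m r \<xi>" by (rule AE_powr_measure) (simp add: m'_def)
  qed
  finally show ?thesis .
qed

section \<open>Jump integrals of powers of 1 - cos\<close>

text \<open>Near 0 the integrand is O(r^2), as a single factor already is, and \<beta> < 2; at
  infinity it is bounded and \<beta> > 0.\<close>

lemma integrable_cos_power:
  assumes "0 < \<beta>" "\<beta> < 2" "k \<ge> 1"
  shows "integrable (powr_measure (- 1 - \<beta>)) (\<lambda>r. (1 - cos r) ^ k)"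
proof (rule integrable_powr_measure_bound[where B="2 ^ k" and ?e1.0=2 and ?e2.0=0])
  have c: "0 \<le> 1 - cos r" "1 - cos r \<le> 2" for r :: real
    using cos_ge_minus_one[of r] cos_le_one[of r] by linarith+
  show "norm ((1 - cos r) ^ k) \<le> 2 ^ k * r powr 0" if "1 \<le> r" for r
    using that c[of r] by (auto intro: power_mono)
  show "norm ((1 - cos r) ^ k) \<le> 2 ^ k * r powr 2" if "0 < r" "r \<le> 1" for r
  proof -
    obtain j where k: "k = Suc j" using \<open>k \<ge> 1\<close> by (cases k) auto
    have "1 - cos r = 2 * (sin (r / 2))\<^sup>2" using cos_double_sin[of "r / 2"] by simp
    also have "\<dots> \<le> 2 * (r / 2)\<^sup>2"
      using abs_sin_x_le_abs_x[of "r / 2"] by (simp only: abs_le_square_iff)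
    also have "\<dots> \<le> 2 * r\<^sup>2" by (simp add: power_divide)
    finally have "(1 - cos r) * (1 - cos r) ^ j \<le> (2 * r\<^sup>2) * 2 ^ j"
      using c[of r] by (intro mult_mono power_mono) auto
    moreover have "r powr 2 = r\<^sup>2" using that powr_realpow[of r 2] by simp
    ultimately show ?thesis using c[of r] by (simp add: k ac_simps)
  qed
qed (use assms in auto)

text \<open>For \<open>k = 1\<close> this is the Levy-Khintchine formula for |a|^\<beta>.
  Homogeneity of the measure gives the same power for every \<open>k\<close>; only the constant
  changes.\<close>

lemma cos_power_integral:
  fixes a :: real
  assumes \<beta>: "0 < \<beta>" "\<beta> < 2" and k: "k \<ge> 1"
  shows "integrable (powr_measure (- 1 - \<beta>)) (\<lambda>r. (1 - cos (a * r)) ^ k)"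
    and "(\<integral>r. (1 - cos (a * r)) ^ k \<partial>powr_measure (- 1 - \<beta>)) =
      \<bar>a\<bar> powr \<beta> * (\<integral>r. (1 - cos r) ^ k \<partial>powr_measure (- 1 - \<beta>))"
proof -
  have ca: "cos (a * r) = cos (\<bar>a\<bar> * r)" for r by (simp add: abs_if)
  have "integrable (powr_measure (- 1 - \<beta>)) (\<lambda>r. (1 - cos (\<bar>a\<bar> * r)) ^ k) \<and>
      (\<integral>r. (1 - cos (\<bar>a\<bar> * r)) ^ k \<partial>powr_measure (- 1 - \<beta>)) =
      \<bar>a\<bar> powr \<beta> * (\<integral>r. (1 - cos r) ^ k \<partial>powr_measure (- 1 - \<beta>))"
  proof (cases "a = 0")
    case False
    then show ?thesis
      using integral_powr_measure_scale[of "\<lambda>r. (1 - cos r) ^ k" "\<bar>a\<bar>" "- 1 - \<beta>"] integrable_cos_power[OF assms]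
      by simp
  qed (use k in \<open>simp add: zero_power\<close>)
  then show "integrable (powr_measure (- 1 - \<beta>)) (\<lambda>r. (1 - cos (a * r)) ^ k)"
    "(\<integral>r. (1 - cos (a * r)) ^ k \<partial>powr_measure (- 1 - \<beta>)) =
      \<bar>a\<bar> powr \<beta> * (\<integral>r. (1 - cos r) ^ k \<partial>powr_measure (- 1 - \<beta>))"
    unfolding ca by auto
qed

lemma cos_power_integral_pos:
  assumes "0 < \<beta>" "\<beta> < 2" "k \<ge> 1"
  shows "0 < (\<integral>r. (1 - cos r) ^ k \<partial>powr_measure (- 1 - \<beta>))"
proof (rule integral_powr_measure_pos[OF integrable_cos_power[OF assms]])
  fix r :: real assume "1 < r" "r < 2"
  then have "cos r < cos 0" using pi_gt3 by (intro cos_monotone_0_pi) auto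
  then show "0 < (1 - cos r) ^ k" by simp
qed simp

text \<open>Neumann series in N / w with w = v + C. The norms sum to 1 / (w - C) = 1 / v: adding to
  \<open>v\<close> the constant that bounds \<open>N\<close> makes the estimate independent of
  \<open>C\<close>, so that it survives a limit in which \<open>C\<close> is unbounded.\<close>

lemma fs_bound_resolvent:
  assumes N: "fs_bound C N" and v: "v > 0"
  shows "fs_bound (1 / v) (\<lambda>\<xi>. 1 / (complex_of_real (v + C) - N \<xi>))"
proof -
  have C: "C \<ge> 0" by (rule fs_bound_nonneg[OF N])
  define w where "w = v + C"
  have w: "w > 0" "C < w" using v C by (auto simp: w_def)
  have x: "\<bar>C / w\<bar> < 1" using w C by simp
  define P where "P n \<xi> = (\<Sum>j<n. complex_of_real (1 / w) * (complex_of_real (1 / w) * N \<xi>) ^ j)" for n \<xi>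
  have P: "fs_bound (1 / v) (P n)" for n
  proof -
    have "fs_bound (\<Sum>j<n. cmod (complex_of_real (1 / w)) * (cmod (complex_of_real (1 / w)) * C) ^ j) (P n)"
      unfolding P_def by (intro fs_bound_sum fs_bound_cmult fs_bound_power N)
    moreover have "(\<Sum>j<n. cmod (complex_of_real (1 / w)) * (cmod (complex_of_real (1 / w)) * C) ^ j) = 1 / w * (\<Sum>j<n. (C / w) ^ j)"
      using w by (simp add: sum_distrib_left norm_divide)
    moreover have "(\<Sum>j<n. (C / w) ^ j) \<le> 1 / (1 - C / w)"
      using sum_le_suminf[OF summable_geometric[of "C / w"], of "{..<n}"] suminf_geometric[of "C / w"] x C w by simp
    then have "1 / w * (\<Sum>j<n. (C / w) ^ j) \<le> 1 / w * (1 / (1 - C / w))"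
      using w by (intro mult_left_mono) auto
    moreover have "1 / w * (1 / (1 - C / w)) = 1 / v" using w by (simp add: w_def field_simps)
    ultimately show ?thesis using fs_bound_mono by metis
  qed
  show ?thesis
  proof (rule fs_bound_lim[OF P])
    fix \<xi>
    define z where "z = complex_of_real (1 / w) * N \<xi>"
    have z: "cmod z < 1"
      using fs_bound_cmod[OF N, of \<xi>] w by (simp add: z_def norm_mult norm_divide field_simps)
    then have z1: "z \<noteq> 1" by auto
    have "(\<lambda>j. complex_of_real (1 / w) * z ^ j) sums (complex_of_real (1 / w) * (1 / (1 - z)))"
      by (intro sums_mult geometric_sums z)
    moreover have "complex_of_real (1 / w) * (1 / (1 - z)) = 1 / (complex_of_real w - N \<xi>)"
    proof -
      have "N \<xi> = complex_of_real w * z" using w by (simp add: z_def)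
      then show ?thesis using w z1 by (simp add: field_simps)
    qed
    ultimately show "(\<lambda>n. P n \<xi>) \<longlonglongrightarrow> 1 / (complex_of_real (v + C) - N \<xi>)"
      by (simp add: sums_def P_def z_def w_def)
  qed
qed

section \<open>The multiplier\<close>

lemma integrable_min_square:
  assumes "0 < \<beta>" "\<beta> < 2" "0 \<le> y"
  shows "integrable (powr_measure (- 1 - \<beta>)) (\<lambda>r. min 1 ((r * y)\<^sup>2))"
proof (rule integrable_powr_measure_bound[where B="max 1 (y\<^sup>2)" and ?e1.0=2 and ?e2.0=0])
  fix r :: real
  show "norm (min 1 ((r * y)\<^sup>2)) \<le> max 1 (y\<^sup>2) * r powr 0" if "1 \<le> r"
    using that by (auto simp: min_def max_def abs_le_square_iff)
  show "norm (min 1 ((r * y)\<^sup>2)) \<le> max 1 (y\<^sup>2) * r powr 2" if "0 < r" "r \<le> 1"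
  proof -
    have "norm (min 1 ((r * y)\<^sup>2)) \<le> y\<^sup>2 * r\<^sup>2" by (simp add: min_def power_mult_distrib mult.commute)
    also have "\<dots> \<le> max 1 (y\<^sup>2) * r\<^sup>2" by (intro mult_right_mono) auto
    also have "r\<^sup>2 = r powr 2" using that powr_realpow[of r 2] by simp
    finally show ?thesis .
  qed
qed (use assms in auto)

text \<open>The substitution u = L x represents L^s as a multiple of the integral of L / (u + L)
  against u^(s-1) du. The same substitution applied to the two-regime bound min 2 (A / u) gives A^s,
  which is the interpolation between the regimes.\<close>

lemma
  fixes s :: real
  assumes s: "0 < s" "s < 1"
  shows integrable_powr_measure_min: "A > 0 \<Longrightarrow> integrable (powr_measure (s - 1)) (\<lambda>u. min 2 (A / u))"
    and integral_powr_measure_min: "A > 0 \<Longrightarrow>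
      (\<integral>u. min 2 (A / u) \<partial>powr_measure (s - 1)) = A powr s * (\<integral>u. min 2 (1 / u) \<partial>powr_measure (s - 1))"
    and integral_powr_measure_inverse: "L > 0 \<Longrightarrow>
      (\<integral>u. L / (u + L) \<partial>powr_measure (s - 1)) = L powr s * (\<integral>u. 1 / (u + 1) \<partial>powr_measure (s - 1))"
    and integral_powr_measure_inverse_pos: "0 < (\<integral>u. 1 / (u + 1) \<partial>powr_measure (s - 1))"
proof -
  have m: "integrable (powr_measure (s - 1)) (\<lambda>u. min 2 (1 / u))"
  proof (rule integrable_powr_measure_bound[where B=2 and ?e1.0=0 and ?e2.0="-1"])
    fix r :: real
    show "norm (min 2 (1 / r)) \<le> 2 * r powr 0" if "0 < r" "r \<le> 1" using that by (auto simp: min_def)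
    show "norm (min 2 (1 / r)) \<le> 2 * r powr -1" if "1 \<le> r"
      using that by (auto simp: min_def powr_minus_divide divide_right_mono)
  qed (use s in auto)
  have i: "integrable (powr_measure (s - 1)) (\<lambda>u. 1 / (u + 1))"
  proof (rule integrable_powr_measure_bound[where B=1 and ?e1.0=0 and ?e2.0="-1"])
    fix r :: real
    show "norm (1 / (r + 1)) \<le> 1 * r powr 0" if "0 < r" "r \<le> 1" using that by (auto simp: field_simps)
    show "norm (1 / (r + 1)) \<le> 1 * r powr -1" if "1 \<le> r"
      using that by (auto simp: powr_minus_divide field_simps)
  qed (use s in auto)
  show "integrable (powr_measure (s - 1)) (\<lambda>u. min 2 (A / u))"
    "(\<integral>u. min 2 (A / u) \<partial>powr_measure (s - 1)) = A powr s * (\<integral>u. min 2 (1 / u) \<partial>powr_measure (s - 1))"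
    if A: "A > 0"
    using integral_powr_measure_scale[of "\<lambda>u. min 2 (1 / u)" "1 / A" "s - 1"] m A
    by (simp_all add: powr_minus_divide powr_divide)
  have Leq: "L / (u + L) = 1 / (1 / L * u + 1)" if "L > 0" for L u :: real
    using that by (cases "u + L = 0") (auto simp: field_simps)
  show "(\<integral>u. L / (u + L) \<partial>powr_measure (s - 1)) = L powr s * (\<integral>u. 1 / (u + 1) \<partial>powr_measure (s - 1))"
    if L: "L > 0"
    unfolding Leq[OF L] using integral_powr_measure_scale(1)[of "\<lambda>u. 1 / (u + 1)" "1 / L" "s - 1"] L
    by (simp add: powr_minus_divide powr_divide)
  show "0 < (\<integral>u. 1 / (u + 1) \<partial>powr_measure (s - 1))"
    by (rule integral_powr_measure_pos[OF i]) auto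
qed

lemma powr_one_plus_le:
  fixes x s :: real
  assumes "0 \<le> x" "0 < s"
  shows "(1 + x) powr s \<le> 2 powr s * (1 + x powr s)"
proof -
  have "(1 + x) powr s \<le> (2 * max 1 x) powr s" using assms by (intro powr_mono2) auto
  also have "\<dots> = 2 powr s * (max 1 x) powr s" using assms by (simp add: powr_mult)
  also have "\<dots> \<le> 2 powr s * (1 + x powr s)" by (intro mult_left_mono) (auto simp: max_def)
  finally show ?thesis .
qed

section \<open>The exponent of order \<beta> against the semigroup of order \<alpha>\<close>

text \<open>\<open>Y\<close> is the direction of a jump, kept as a measurable map into the unit
  sphere because \<sigma> lives on the sphere and not on the Borel sets of the whole space. The
  theorem takes it to be the identity.\<close>

locale stable_pair = stable_char + finite_measure \<sigma> for \<sigma> :: "'w measure" +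
  fixes Y :: "'w \<Rightarrow> 'a" and lamb :: "'a \<Rightarrow> real" and b \<beta> :: real
  assumes Y_measurable [measurable]: "Y \<in> borel_measurable \<sigma>"
    and norm_Y: "w \<in> space \<sigma> \<Longrightarrow> norm (Y w) = 1"
    and b_nonneg: "0 \<le> b" and beta_gt_1: "1 < \<beta>" and beta_less_2: "\<beta> < 2"
    and lamb_eq: "lamb \<xi> = b * (\<integral>w. \<bar>\<xi> \<bullet> Y w\<bar> powr \<beta> \<partial>\<sigma>)"
begin

lemma sigma_finite_sigma: "sigma_finite_measure \<sigma>"
  by (rule finite_measure_axioms[THEN finite_measure.axioms(1)])

lemma inner_Y_le: "w \<in> space \<sigma> \<Longrightarrow> \<bar>\<xi> \<bullet> Y w\<bar> \<le> norm \<xi>"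
  using Cauchy_Schwarz_ineq2[of \<xi> "Y w"] norm_Y[of w] by simp

lemma integrable_inner_Y: "integrable \<sigma> (\<lambda>w. \<bar>\<xi> \<bullet> Y w\<bar> powr \<beta>)"
  by (rule integrable_const_bound[of _ "norm \<xi> powr \<beta>"])
     (use beta_gt_1 in \<open>auto intro!: AE_I2 powr_mono2 inner_Y_le\<close>)

lemma lamb_nonneg: "0 \<le> lamb \<xi>"
  unfolding lamb_eq using b_nonneg by (intro mult_nonneg_nonneg integral_nonneg_AE) auto

lemma lamb_measurable [measurable]: "lamb \<in> borel_measurable borel"
proof -
  have "(\<lambda>(\<xi>, w). \<bar>\<xi> \<bullet> Y w\<bar> powr \<beta>) \<in> borel_measurable ((borel :: 'a measure) \<Otimes>\<^sub>M \<sigma>)"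
    unfolding case_prod_unfold by measurable
  from sigma_finite_measure.borel_measurable_lebesgue_integral[OF sigma_finite_sigma this]
  show ?thesis unfolding lamb_eq[abs_def] by measurable
qed

lemma lamb_scale: "s > 0 \<Longrightarrow> lamb (s *\<^sub>R \<xi>) = s powr \<beta> * lamb \<xi>"
  by (simp add: lamb_eq abs_mult powr_mult mult.left_commute)

lemma lamb_mult_char_bound:
  obtains D where "D \<ge> 0" "fs_bound D (\<lambda>\<xi>. complex_of_real (lamb \<xi> * exp (- lam \<xi>)))"
proof -
  define k where "k = DIM('a) + 1"
  define Q where "Q = (\<integral>r. (1 - cos r) ^ k \<partial>powr_measure (- 1 - \<beta>))"
  have \<beta>: "0 < \<beta>" "\<beta> < 2" and k: "k \<ge> 1" using beta_gt_1 beta_less_2 by (auto simp: k_def)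
  have Q: "Q > 0" unfolding Q_def by (rule cos_power_integral_pos[OF \<beta> k])
  obtain K where K: "K \<ge> 0"
    "\<And>v. fs_bound (K * min 1 ((norm v)\<^sup>2)) (\<lambda>\<xi>. complex_of_real ((1 - cos (\<xi> \<bullet> v)) ^ k * exp (- lam \<xi>)))"
    unfolding k_def using cos_power_bound by blast
  \<comment> \<open>Directions have norm 1, so the radial bound is the same for all of them and the
    outer integral over \<sigma> has a constant integrand.\<close>
  define J where "J = (\<integral>r. K * min 1 ((r * 1)\<^sup>2) \<partial>powr_measure (- 1 - \<beta>))"
  have inner: "fs_bound J (\<lambda>\<xi>. complex_of_real (Q * \<bar>\<xi> \<bullet> Y w\<bar> powr \<beta> * exp (- lam \<xi>)))" if w: "w \<in> space \<sigma>" for w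
  proof -
    have "fs_bound J (\<lambda>\<xi>. CLINT r|powr_measure (- 1 - \<beta>). complex_of_real ((1 - cos ((\<xi> \<bullet> Y w) * r)) ^ k * exp (- lam \<xi>)))"
      unfolding J_def
    proof (rule fs_bound_powr_mixture)
      show "fs_bound (K * min 1 ((r * 1)\<^sup>2)) (\<lambda>\<xi>. complex_of_real ((1 - cos ((\<xi> \<bullet> Y w) * r)) ^ k * exp (- lam \<xi>)))" for r
        using K(2)[of "r *\<^sub>R Y w"] norm_Y[OF w] by (simp add: mult.commute power_mult_distrib)
      show "integrable (powr_measure (- 1 - \<beta>)) (\<lambda>r. K * min 1 ((r * 1)\<^sup>2))"
        by (intro integrable_mult_right integrable_min_square \<beta>) simp
    qed measurable
    moreover have "(CLINT r|powr_measure (- 1 - \<beta>). complex_of_real ((1 - cos ((\<xi> \<bullet> Y w) * r)) ^ k * exp (- lam \<xi>)))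
        = complex_of_real (Q * \<bar>\<xi> \<bullet> Y w\<bar> powr \<beta> * exp (- lam \<xi>))" for \<xi>
      unfolding integral_complex_of_real integral_mult_left_zero cos_power_integral(2)[OF \<beta> k] Q_def
      by (simp add: mult.commute)
    ultimately show ?thesis by simp
  qed
  have "fs_bound (\<integral>w. J \<partial>\<sigma>) (\<lambda>\<xi>. CLINT w|\<sigma>. complex_of_real (Q * \<bar>\<xi> \<bullet> Y w\<bar> powr \<beta> * exp (- lam \<xi>)))"
    by (rule fs_bound_mixture[OF sigma_finite_sigma inner]) auto
  then have "fs_bound (cmod (complex_of_real (b / Q)) * (\<integral>w. J \<partial>\<sigma>))
     (\<lambda>\<xi>. complex_of_real (b / Q) * (CLINT w|\<sigma>. complex_of_real (Q * \<bar>\<xi> \<bullet> Y w\<bar> powr \<beta> * exp (- lam \<xi>))))"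
    by (rule fs_bound_cmult)
  moreover have "complex_of_real (b / Q) * (CLINT w|\<sigma>. complex_of_real (Q * \<bar>\<xi> \<bullet> Y w\<bar> powr \<beta> * exp (- lam \<xi>)))
      = complex_of_real (lamb \<xi> * exp (- lam \<xi>))" for \<xi>
    unfolding integral_complex_of_real integral_mult_left_zero integral_mult_right_zero lamb_eq using Q by simp
  ultimately have "fs_bound (cmod (complex_of_real (b / Q)) * (\<integral>w. J \<partial>\<sigma>)) (\<lambda>\<xi>. complex_of_real (lamb \<xi> * exp (- lam \<xi>)))"
    by simp
  from that[OF fs_bound_nonneg[OF this] this] show thesis .
qed

lemma char_time_scale:
  assumes \<tau>: "\<tau> > 0"
  shows "lam (\<tau> powr (1 / \<alpha>) *\<^sub>R \<xi>) = \<tau> * lam \<xi>"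
    and "lamb (\<tau> powr (1 / \<alpha>) *\<^sub>R \<xi>) = \<tau> powr (\<beta> / \<alpha>) * lamb \<xi>"
  using \<tau> alpha_gt_1 by (simp_all add: lam_scale lamb_scale powr_powr)

lemma fs_bound_char_time:
  assumes \<tau>: "\<tau> > 0"
  shows "fs_bound 1 (\<lambda>\<xi>. complex_of_real (exp (- \<tau> * lam \<xi>)))"
  using fs_bound_dilate[OF fs_bound_char, of "\<tau> powr (1 / \<alpha>)"] \<tau> by (simp add: char_time_scale)

text \<open>The dilation by \<tau>^(1/\<alpha>) turns \<open>lam\<close> into \<tau>
  \<open>lam\<close> but \<open>lamb\<close> into \<tau>^(\<beta>/\<alpha>) \<open>lamb\<close>.
  Dilations being free of cost, dividing out the second factor is the whole price.\<close>

lemma lamb_mult_char_time_bound: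
  assumes D: "fs_bound D (\<lambda>\<xi>. complex_of_real (lamb \<xi> * exp (- lam \<xi>)))" and \<tau>: "\<tau> > 0"
  shows "fs_bound (D * \<tau> powr (- (\<beta> / \<alpha>))) (\<lambda>\<xi>. complex_of_real (lamb \<xi> * exp (- \<tau> * lam \<xi>)))"
proof -
  have "fs_bound D (\<lambda>\<xi>. complex_of_real (\<tau> powr (\<beta> / \<alpha>) * lamb \<xi> * exp (- \<tau> * lam \<xi>)))"
    using fs_bound_dilate[OF D, of "\<tau> powr (1 / \<alpha>)"] \<tau> by (simp add: char_time_scale)
  from fs_bound_cmult[OF this, of "complex_of_real (\<tau> powr (- (\<beta> / \<alpha>)))"]
  have "fs_bound (\<tau> powr (- (\<beta> / \<alpha>)) * D)
     (\<lambda>\<xi>. complex_of_real (\<tau> powr (- (\<beta> / \<alpha>)) * (\<tau> powr (\<beta> / \<alpha>) * lamb \<xi> * exp (- \<tau> * lam \<xi>))))"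
    by (simp only: norm_of_real abs_of_nonneg powr_ge_zero of_real_mult)
  moreover have "\<tau> powr (- (\<beta> / \<alpha>)) * (\<tau> powr (\<beta> / \<alpha>) * lamb \<xi> * exp (- \<tau> * lam \<xi>)) = lamb \<xi> * exp (- \<tau> * lam \<xi>)" for \<xi>
    using \<tau> by (simp add: mult.assoc[symmetric] powr_add[symmetric])
  ultimately show ?thesis by (subst mult.commute) (simp only:)
qed

text \<open>The exponent is approximated by those of the compound Poisson laws keeping only the jumps
  of size at least \<open>1/n\<close>, for which the resolvent is a Neumann series.\<close>

lemma lamb_resolvent_bound:
  assumes v: "v > 0"
  shows "fs_bound (1 / v) (\<lambda>\<xi>. complex_of_real (1 / (v + lamb \<xi>)))"
proof -
  have \<beta>: "0 < \<beta>" "\<beta> < 2" using beta_gt_1 beta_less_2 by auto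
  let ?M = "powr_measure (- 1 - \<beta>)"
  interpret M: sigma_finite_measure ?M by (rule sigma_finite_powr_measure)
  define Q where "Q = (\<integral>r. 1 - cos r \<partial>?M)"
  have Q: "Q > 0" using cos_power_integral_pos[OF \<beta>, of 1] by (simp add: Q_def)
  have cosint: "integrable ?M (\<lambda>r. 1 - cos (a * r))" "(\<integral>r. 1 - cos (a * r) \<partial>?M) = Q * \<bar>a\<bar> powr \<beta>" for a
    using cos_power_integral[OF \<beta>, of 1 a] by (simp_all add: Q_def mult.commute)
  define I where "I n r = indicat_real {1 / real (Suc n)..} r" for n r
  have [measurable]: "I n \<in> borel_measurable borel" for n unfolding I_def by measurable
  have I01: "0 \<le> I n r" "I n r \<le> 1" for n r by (auto simp: I_def indicator_def)
  \<comment> \<open>The truncated jump measure is finite: the indicator is at most ((n + 1) r)^2,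
    and the exponent 2 exceeds \<beta>.\<close>
  have Ii: "integrable ?M (I n)" for n
  proof (rule integrable_powr_measure_bound[where B="(real (Suc n))\<^sup>2" and ?e1.0=2 and ?e2.0=0])
    fix r :: real
    show "norm (I n r) \<le> (real (Suc n))\<^sup>2 * r powr 2" if "0 < r" "r \<le> 1"
    proof (cases "1 / real (Suc n) \<le> r")
      case True
      then have "1 \<le> real (Suc n) * r" by (simp add: field_simps)
      then have "1 \<le> (real (Suc n) * r)\<^sup>2" by (rule one_le_power)
      also have "\<dots> = (real (Suc n))\<^sup>2 * r powr 2" using that powr_realpow[of r 2] by (simp add: power_mult_distrib)
      finally show ?thesis using I01[of n r] by simp
    qed (simp add: I_def)
    show "norm (I n r) \<le> (real (Suc n))\<^sup>2 * r powr 0" if "1 \<le> r"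
    proof -
      have "norm (I n r) \<le> 1" using I01[of n r] by simp
      also have "1 \<le> (real (Suc n))\<^sup>2" by (rule one_le_power) simp
      also have "\<dots> = (real (Suc n))\<^sup>2 * r powr 0" using that by simp
      finally show ?thesis .
    qed
  qed (use \<beta> in auto)
  \<comment> \<open>Total mass and cosine transform of the truncated radial jump measure. Their
    difference is its exponent, and it increases to Q |a|^\<beta> as the truncation is
    removed.\<close>
  define c where "c n = (\<integral>r. I n r \<partial>?M)" for n
  define N where "N n a = (\<integral>r. I n r * cos (a * r) \<partial>?M)" for n a
  have Ni: "integrable ?M (\<lambda>r. I n r * cos (a * r))" for n a
    by (rule Bochner_Integration.integrable_bound[OF Ii[of n]])
       (auto intro!: AE_I2 simp: abs_mult mult_left_le)
  have [measurable]: "N n \<in> borel_measurable borel" for n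
    unfolding N_def[abs_def] by (rule M.borel_measurable_lebesgue_integral) (simp add: case_prod_unfold)
  have cN: "c n - N n a = (\<integral>r. I n r * (1 - cos (a * r)) \<partial>?M)" for n a
    unfolding c_def N_def using Ii Ni by (simp add: right_diff_distrib)
  have Ie: "norm (I n r * (1 - cos (a * r))) \<le> 1 - cos (a * r)" for n r a
    using I01[of n r] cos_le_one[of "a * r"] by (simp add: abs_mult mult_left_le_one_le)
  have cNle: "\<bar>c n - N n a\<bar> \<le> Q * \<bar>a\<bar> powr \<beta>" for n a
  proof -
    have i: "integrable ?M (\<lambda>r. I n r * (1 - cos (a * r)))"
      using Bochner_Integration.integrable_diff[OF Ii Ni] by (simp add: right_diff_distrib)
    have "\<bar>\<integral>r. I n r * (1 - cos (a * r)) \<partial>?M\<bar> \<le> (\<integral>r. norm (I n r * (1 - cos (a * r))) \<partial>?M)"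
      using integral_norm_bound[of ?M "\<lambda>r. I n r * (1 - cos (a * r))"] by simp
    also have "\<dots> \<le> (\<integral>r. 1 - cos (a * r) \<partial>?M)"
      by (rule integral_mono[OF integrable_norm[OF i] cosint(1) Ie])
    finally show ?thesis unfolding cN cosint(2) .
  qed
  have lim1: "(\<lambda>n. c n - N n a) \<longlonglongrightarrow> Q * \<bar>a\<bar> powr \<beta>" for a
    unfolding cN cosint(2)[symmetric]
  proof (rule integral_dominated_convergence[where w="\<lambda>r. 1 - cos (a * r)"])
    show "AE r in ?M. (\<lambda>n. I n r * (1 - cos (a * r))) \<longlonglongrightarrow> 1 - cos (a * r)"
    proof (rule AE_powr_measure)
      fix r :: real assume "0 < r"
      then obtain n0 where n0: "1 / real (Suc n0) < r" using nat_approx_posE by blast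
      have "I n r = 1" if "n \<ge> n0" for n
      proof -
        have "1 / real (Suc n) \<le> 1 / real (Suc n0)" using that by (intro divide_left_mono) auto
        then show ?thesis using n0 by (simp add: I_def)
      qed
      then have "eventually (\<lambda>n. I n r * (1 - cos (a * r)) = 1 - cos (a * r)) sequentially"
        by (auto simp: eventually_sequentially)
      then show "(\<lambda>n. I n r * (1 - cos (a * r))) \<longlonglongrightarrow> 1 - cos (a * r)" by (rule tendsto_eventually)
    qed
    show "AE r in ?M. norm (I n r * (1 - cos (a * r))) \<le> 1 - cos (a * r)" for n
      by (intro AE_I2 Ie)
  qed (use cosint(1) in auto)
  \<comment> \<open>The total jump mass is also the norm bound for \<open>NN n\<close>, so C - NN
    has precisely the form required by \<open>fs_bound_resolvent\<close>, and 1 / v holds for every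
    \<open>n\<close> although \<open>C n\<close> may grow without bound.\<close>
  define C where "C n = b / Q * (c n * measure \<sigma> (space \<sigma>))" for n
  define NN where "NN n \<xi> = b / Q * (\<integral>w. N n (\<xi> \<bullet> Y w) \<partial>\<sigma>)" for n \<xi>
  have NN: "fs_bound (C n) (\<lambda>\<xi>. complex_of_real (NN n \<xi>))" for n
  proof -
    have 1: "fs_bound (c n) (\<lambda>\<xi>. complex_of_real (N n (\<xi> \<bullet> Y w)))" for w
    proof -
      have "fs_bound (c n) (\<lambda>\<xi>. CLINT r|?M. complex_of_real (I n r * cos ((\<xi> \<bullet> Y w) * r)))"
        unfolding c_def
      proof (rule fs_bound_powr_mixture[OF _ _ Ii])
        fix r :: real
        have e: "complex_of_real (I n r * cos ((\<xi> \<bullet> Y w) * r)) =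
            complex_of_real (I n r / 2) * (iexp (\<xi> \<bullet> (r *\<^sub>R Y w)) + iexp (\<xi> \<bullet> (- (r *\<^sub>R Y w))))" for \<xi>
          unfolding of_real_mult cos_eq_iexp by (simp add: mult.commute)
        have "fs_bound (cmod (complex_of_real (I n r / 2)) * (1 + 1)) (\<lambda>\<xi>. complex_of_real (I n r * cos ((\<xi> \<bullet> Y w) * r)))"
          unfolding e by (intro fs_bound_cmult fs_bound_add fs_bound_iexp)
        then show "fs_bound (I n r) (\<lambda>\<xi>. complex_of_real (I n r * cos ((\<xi> \<bullet> Y w) * r)))"
          using I01[of n r] by (simp del: of_real_divide)
      qed measurable
      then show ?thesis by (simp only: N_def integral_complex_of_real)
    qed
    have "fs_bound (\<integral>w. c n \<partial>\<sigma>) (\<lambda>\<xi>. CLINT w|\<sigma>. complex_of_real (N n (\<xi> \<bullet> Y w)))"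
      by (rule fs_bound_mixture[OF sigma_finite_sigma 1]) auto
    from fs_bound_cmult[OF this, of "complex_of_real (b / Q)"] show ?thesis
      using b_nonneg Q by (simp add: C_def NN_def mult.commute norm_divide)
  qed
  have lim2: "(\<lambda>n. C n - NN n \<xi>) \<longlonglongrightarrow> lamb \<xi>" for \<xi>
  proof -
    have "\<bar>N n a\<bar> \<le> c n" for n a
      unfolding N_def c_def
    proof -
      have "\<bar>\<integral>r. I n r * cos (a * r) \<partial>?M\<bar> \<le> (\<integral>r. norm (I n r * cos (a * r)) \<partial>?M)"
        using integral_norm_bound[of ?M "\<lambda>r. I n r * cos (a * r)"] by simp
      also have "\<dots> \<le> (\<integral>r. I n r \<partial>?M)"
        using I01 by (intro integral_mono integrable_norm Ni Ii) (simp add: abs_mult mult_left_le)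
      finally show "\<bar>\<integral>r. I n r * cos (a * r) \<partial>?M\<bar> \<le> (\<integral>r. I n r \<partial>?M)" .
    qed
    then have Nint: "integrable \<sigma> (\<lambda>w. N n (\<xi> \<bullet> Y w))" for n
      by (intro integrable_const_bound[of _ "c n"]) auto
    have "(\<lambda>n. \<integral>w. c n - N n (\<xi> \<bullet> Y w) \<partial>\<sigma>) \<longlonglongrightarrow> (\<integral>w. Q * \<bar>\<xi> \<bullet> Y w\<bar> powr \<beta> \<partial>\<sigma>)"
      by (rule integral_dominated_convergence[where w="\<lambda>w. Q * \<bar>\<xi> \<bullet> Y w\<bar> powr \<beta>"])
         (use lim1 cNle integrable_inner_Y in auto)
    then have "(\<lambda>n. b / Q * (\<integral>w. c n - N n (\<xi> \<bullet> Y w) \<partial>\<sigma>)) \<longlonglongrightarrow> b / Q * (\<integral>w. Q * \<bar>\<xi> \<bullet> Y w\<bar> powr \<beta> \<partial>\<sigma>)"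
      by (intro tendsto_mult tendsto_const)
    moreover have "b / Q * (\<integral>w. Q * \<bar>\<xi> \<bullet> Y w\<bar> powr \<beta> \<partial>\<sigma>) = lamb \<xi>" using Q by (simp add: lamb_eq)
    moreover have "b / Q * (\<integral>w. c n - N n (\<xi> \<bullet> Y w) \<partial>\<sigma>) = C n - NN n \<xi>" for n
      using Nint by (simp add: C_def NN_def right_diff_distrib mult.commute[of _ "c n"])
    ultimately show ?thesis by simp
  qed
  show ?thesis
  proof (rule fs_bound_lim[OF fs_bound_resolvent[OF NN v]])
    fix \<xi>
    have "(\<lambda>n. 1 / (v + (C n - NN n \<xi>))) \<longlonglongrightarrow> 1 / (v + lamb \<xi>)"
      using v lamb_nonneg[of \<xi>] by (intro tendsto_intros lim2) auto
    then have "(\<lambda>n. complex_of_real (1 / (v + (C n - NN n \<xi>)))) \<longlonglongrightarrow> complex_of_real (1 / (v + lamb \<xi>))"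
      by (rule tendsto_of_real)
    then show "(\<lambda>n. 1 / (complex_of_real (v + C n) - complex_of_real (NN n \<xi>))) \<longlonglongrightarrow> complex_of_real (1 / (v + lamb \<xi>))"
      by (simp add: add_diff_eq)
  qed
qed

lemma powr_lamb_mult_char_time_bound:
  assumes D: "fs_bound D (\<lambda>\<xi>. complex_of_real (lamb \<xi> * exp (- lam \<xi>)))" and s: "0 < s" "s < 1"
  obtains K where "K \<ge> 0" "\<And>\<tau>. \<tau> > 0 \<Longrightarrow> fs_bound (K * (1 + D * \<tau> powr (- (\<beta> / \<alpha>))) powr s)
     (\<lambda>\<xi>. complex_of_real ((1 + lamb \<xi>) powr s * exp (- \<tau> * lam \<xi>)))"
proof -
  let ?M = "powr_measure (s - 1)"
  define P where "P = (\<integral>u. 1 / (u + 1) \<partial>?M)"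
  define P2 where "P2 = (\<integral>u. min 2 (1 / u) \<partial>?M)"
  have P: "P > 0" unfolding P_def by (rule integral_powr_measure_inverse_pos[OF s])
  have D0: "D \<ge> 0" by (rule fs_bound_nonneg[OF D])
  have "fs_bound (P2 / P * (1 + D * \<tau> powr (- (\<beta> / \<alpha>))) powr s)
     (\<lambda>\<xi>. complex_of_real ((1 + lamb \<xi>) powr s * exp (- \<tau> * lam \<xi>)))" if \<tau>: "\<tau> > 0" for \<tau>
  proof -
    define A where "A = 1 + D * \<tau> powr (- (\<beta> / \<alpha>))"
    have A: "A > 0" using D0 by (simp add: A_def add_pos_nonneg)
    let ?h = "\<lambda>\<xi>. exp (- \<tau> * lam \<xi>)"
    let ?L = "\<lambda>\<xi>. 1 + lamb \<xi>"
    have L: "?L \<xi> > 0" for \<xi> using lamb_nonneg[of \<xi>] by simp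
    have "fs_bound (\<integral>u. min 2 (A / u) \<partial>?M) (\<lambda>\<xi>. CLINT u|?M. complex_of_real (?L \<xi> / (u + ?L \<xi>) * ?h \<xi>))"
    proof (rule fs_bound_powr_mixture)
      fix u :: real assume u: "0 < u"
      have res: "fs_bound (1 / (u + 1)) (\<lambda>\<xi>. complex_of_real (1 / (u + ?L \<xi>)))"
        using lamb_resolvent_bound[of "u + 1"] u by (simp add: add.assoc)
      \<comment> \<open>Bound without smoothing, effective for small u: L / (u + L) = 1 - u / (u +
        L), where u + L = (u + 1) + lamb has resolvent norm at most 1 / (u + 1).\<close>
      have b1: "fs_bound 2 (\<lambda>\<xi>. complex_of_real (?L \<xi> / (u + ?L \<xi>) * ?h \<xi>))"
      proof -
        have 1: "fs_bound ((1 + cmod (complex_of_real u) * (1 / (u + 1))) * 1)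
           (\<lambda>\<xi>. (1 - complex_of_real u * complex_of_real (1 / (u + ?L \<xi>))) * complex_of_real (?h \<xi>))"
          by (intro fs_bound_mult fs_bound_diff fs_bound_one fs_bound_cmult res fs_bound_char_time \<tau>)
        have 2: "(1 - complex_of_real u * complex_of_real (1 / (u + ?L \<xi>))) * complex_of_real (?h \<xi>)
            = complex_of_real (?L \<xi> / (u + ?L \<xi>) * ?h \<xi>)" for \<xi>
        proof -
          have "1 - u * (1 / (u + ?L \<xi>)) = ?L \<xi> / (u + ?L \<xi>)" using u L[of \<xi>] by (simp add: field_simps)
          then show ?thesis by (metis of_real_1 of_real_diff of_real_mult)
        qed
        have 3: "(1 + cmod (complex_of_real u) * (1 / (u + 1))) * 1 \<le> 2" using u by (simp add: field_simps)
        show ?thesis using fs_bound_mono[OF 1 3] by (simp only: 2)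
      qed
      \<comment> \<open>Bound with smoothing, effective for large u: the numerator is absorbed by
        the semigroup, as (1 + lamb) exp(-\<tau> lam) has norm at most A, and the resolvent
        contributes 1 / (u + 1).\<close>
      have b2: "fs_bound (A / u) (\<lambda>\<xi>. complex_of_real (?L \<xi> / (u + ?L \<xi>) * ?h \<xi>))"
      proof -
        have 1: "fs_bound (A * (1 / (u + 1)))
          (\<lambda>\<xi>. (complex_of_real (?h \<xi>) + complex_of_real (lamb \<xi> * ?h \<xi>)) * complex_of_real (1 / (u + ?L \<xi>)))"
          unfolding A_def
          by (intro fs_bound_mult fs_bound_add res fs_bound_char_time lamb_mult_char_time_bound D \<tau>)
        have 2: "(complex_of_real (?h \<xi>) + complex_of_real (lamb \<xi> * ?h \<xi>)) * complex_of_real (1 / (u + ?L \<xi>))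
           = complex_of_real (?L \<xi> / (u + ?L \<xi>) * ?h \<xi>)" for \<xi>
          unfolding of_real_add[symmetric] of_real_mult[symmetric] by (simp add: ring_distribs add_divide_distrib)
        have 3: "A * (1 / (u + 1)) \<le> A / u" using A u by (simp add: field_simps)
        show ?thesis using fs_bound_mono[OF 1 3] by (simp only: 2)
      qed
      show "fs_bound (min 2 (A / u)) (\<lambda>\<xi>. complex_of_real (?L \<xi> / (u + ?L \<xi>) * ?h \<xi>))"
        using b1 b2 by (simp add: min_def)
    next
      show "integrable ?M (\<lambda>u. min 2 (A / u))" by (rule integrable_powr_measure_min[OF s A])
    qed measurable
    moreover have "(CLINT u|?M. complex_of_real (?L \<xi> / (u + ?L \<xi>) * ?h \<xi>)) = complex_of_real (P * (?L \<xi> powr s * ?h \<xi>))" for \<xi>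
      unfolding integral_complex_of_real integral_mult_left_zero integral_powr_measure_inverse[OF s L] P_def
      by (simp add: ac_simps)
    ultimately have "fs_bound (A powr s * P2) (\<lambda>\<xi>. complex_of_real (P * (?L \<xi> powr s * ?h \<xi>)))"
      by (simp only: integral_powr_measure_min[OF s A] P2_def)
    from fs_bound_cmult[OF this, of "complex_of_real (1 / P)"]
    show ?thesis using P by (simp add: A_def mult.commute norm_divide)
  qed
  moreover have "P2 / P \<ge> 0"
    unfolding P2_def using P by (intro divide_nonneg_pos integral_nonneg_AE AE_powr_measure) auto
  ultimately show thesis using that by blast
qed

lemma multiplier_bound:
  assumes "\<beta> < \<alpha>"
  obtains C where "fs_bound C (\<lambda>\<xi>. complex_of_real
     ((1 + lamb \<xi>) powr ((\<beta> - 1) / \<beta>) / (1 + lam \<xi>) powr ((\<alpha> - 1) / \<alpha>)))"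
proof -
  define s t where "s = (\<beta> - 1) / \<beta>" and "t = (\<alpha> - 1) / \<alpha>"
  have s: "0 < s" "s < 1" and t: "0 < t" using beta_gt_1 alpha_gt_1 by (auto simp: s_def t_def)
  obtain D where D: "D \<ge> 0" "fs_bound D (\<lambda>\<xi>. complex_of_real (lamb \<xi> * exp (- lam \<xi>)))"
    using lamb_mult_char_bound .
  obtain K where K: "K \<ge> 0" "\<And>\<tau>. \<tau> > 0 \<Longrightarrow> fs_bound (K * (1 + D * \<tau> powr (- (\<beta> / \<alpha>))) powr s)
     (\<lambda>\<xi>. complex_of_real ((1 + lamb \<xi>) powr s * exp (- \<tau> * lam \<xi>)))"
    using powr_lamb_mult_char_time_bound[OF D(2) s] by blast
  let ?M = "powr_measure (t - 1)"
  \<comment> \<open>The power of 1 + D \<tau>^(-\<beta>/\<alpha>) is split by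
    \<open>powr_one_plus_le\<close> into a constant and a pure power, so that two Gamma integrals
    majorise it; exp(-\<tau>) comes from the 1 in 1 + lam.\<close>
  define c where "c \<tau> = K * (2 powr s * (1 + D powr s * \<tau> powr (- (s * \<beta> / \<alpha>)))) * exp (- \<tau>)" for \<tau>
  have "integrable ?M c"
  proof -
    \<comment> \<open>As s \<beta> = \<beta> - 1, this compares (\<beta> - 1) / \<alpha> with
      (\<alpha> - 1) / \<alpha>. Strictness is exactly convergence of the integral at \<tau> =
      0.\<close>
    have "s * \<beta> / \<alpha> < t" using assms beta_gt_1 alpha_gt_1 by (simp add: s_def t_def divide_strict_right_mono)
    then have "integrable ?M (\<lambda>\<tau>. K * 2 powr s * exp (- \<tau>) + K * 2 powr s * D powr s * (\<tau> powr (- (s * \<beta> / \<alpha>)) * exp (- \<tau>)))"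
      using t by (intro Bochner_Integration.integrable_add integrable_mult_right
          integrable_powr_measure_exp integrable_powr_measure_powr_exp) auto
    moreover have "c = (\<lambda>\<tau>. K * 2 powr s * exp (- \<tau>) + K * 2 powr s * D powr s * (\<tau> powr (- (s * \<beta> / \<alpha>)) * exp (- \<tau>)))"
      by (simp add: c_def fun_eq_iff algebra_simps)
    ultimately show ?thesis by simp
  qed
  then have "fs_bound (\<integral>\<tau>. c \<tau> \<partial>?M)
     (\<lambda>\<xi>. CLINT \<tau>|?M. complex_of_real ((1 + lamb \<xi>) powr s * exp (- ((1 + lam \<xi>) * \<tau>))))"
  proof (rule fs_bound_powr_mixture[rotated 2])
    fix \<tau> :: real assume \<tau>: "0 < \<tau>"
    have "(1 + D * \<tau> powr (- (\<beta> / \<alpha>))) powr s \<le> 2 powr s * (1 + (D * \<tau> powr (- (\<beta> / \<alpha>))) powr s)"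
      using D s by (intro powr_one_plus_le) auto
    also have "(D * \<tau> powr (- (\<beta> / \<alpha>))) powr s = D powr s * \<tau> powr (- (s * \<beta> / \<alpha>))"
      using D by (simp add: powr_mult powr_powr mult.commute)
    finally have le: "cmod (complex_of_real (exp (- \<tau>))) * (K * (1 + D * \<tau> powr (- (\<beta> / \<alpha>))) powr s) \<le> c \<tau>"
      using mult_left_mono[OF _ K(1)] by (simp add: c_def mult.commute[of _ "exp (- \<tau>)"])
    have "complex_of_real (exp (- \<tau>)) * complex_of_real ((1 + lamb \<xi>) powr s * exp (- \<tau> * lam \<xi>))
      = complex_of_real ((1 + lamb \<xi>) powr s * exp (- ((1 + lam \<xi>) * \<tau>)))" for \<xi>
      
    proof -
      have "exp (- \<tau>) * ((1 + lamb \<xi>) powr s * exp (- \<tau> * lam \<xi>)) = (1 + lamb \<xi>) powr s * (exp (- \<tau>) * exp (- \<tau> * lam \<xi>))"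
        by (rule mult.left_commute)
      also have "exp (- \<tau>) * exp (- \<tau> * lam \<xi>) = exp (- ((1 + lam \<xi>) * \<tau>))"
        unfolding exp_add[symmetric] by (simp add: algebra_simps)
      finally show ?thesis by (simp only: of_real_mult[symmetric])
    qed
    then have e: "(\<lambda>\<xi>. complex_of_real (exp (- \<tau>)) * complex_of_real ((1 + lamb \<xi>) powr s * exp (- \<tau> * lam \<xi>)))
      = (\<lambda>\<xi>. complex_of_real ((1 + lamb \<xi>) powr s * exp (- ((1 + lam \<xi>) * \<tau>))))"
      by (rule ext)
    from fs_bound_mono[OF fs_bound_cmult[OF K(2)[OF \<tau>]] le]
    show "fs_bound (c \<tau>) (\<lambda>\<xi>. complex_of_real ((1 + lamb \<xi>) powr s * exp (- ((1 + lam \<xi>) * \<tau>))))"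
      unfolding e .
  qed measurable
  moreover have "(CLINT \<tau>|?M. complex_of_real ((1 + lamb \<xi>) powr s * exp (- ((1 + lam \<xi>) * \<tau>))))
     = complex_of_real (Gamma t * ((1 + lamb \<xi>) powr s / (1 + lam \<xi>) powr t))" for \<xi>
  proof -
    have l: "1 + lam \<xi> > 0" using lam_nonneg[of \<xi>] by simp
    have "(\<integral>\<tau>. exp (- ((1 + lam \<xi>) * \<tau>)) \<partial>?M) = (1 + lam \<xi>) powr (- t) * Gamma t"
      using integral_powr_measure_scale(1)[of "\<lambda>\<tau>. exp (- \<tau>)" "1 + lam \<xi>" "t - 1"] l
        integral_powr_measure_exp[of "t - 1"] t by simp
    then show ?thesis
      unfolding integral_complex_of_real integral_mult_right_zero by (simp add: powr_minus_divide)
  qed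
  ultimately have "fs_bound (\<integral>\<tau>. c \<tau> \<partial>?M)
      (\<lambda>\<xi>. complex_of_real (Gamma t * ((1 + lamb \<xi>) powr s / (1 + lam \<xi>) powr t)))"
    by simp
  from fs_bound_cmult[OF this, of "complex_of_real (1 / Gamma t)"]
  have "fs_bound (cmod (complex_of_real (1 / Gamma t)) * (\<integral>\<tau>. c \<tau> \<partial>?M))
      (\<lambda>\<xi>. complex_of_real ((1 + lamb \<xi>) powr s / (1 + lam \<xi>) powr t))"
    using Gamma_real_pos[OF t] by (simp add: mult.assoc[symmetric])
  with that show thesis unfolding s_def t_def by blast
qed

end

section \<open>Stable exponents of a spherical component\<close>

lemma integral_scale_measure:
  fixes f :: "'x \<Rightarrow> real"
  assumes f: "integrable M f" and nn: "\<And>x. 0 \<le> f x" and r: "0 \<le> r"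
  shows "(\<integral>x. f x \<partial>scale_measure (ennreal r) M) = r * (\<integral>x. f x \<partial>M)"
proof -
  have [measurable]: "f \<in> borel_measurable M" using f by auto
  have "(\<integral>x. f x \<partial>scale_measure (ennreal r) M) = enn2real (\<integral>\<^sup>+x. ennreal (f x) \<partial>scale_measure (ennreal r) M)"
    by (rule integral_eq_nn_integral) (auto simp: nn)
  also have "(\<integral>\<^sup>+x. ennreal (f x) \<partial>scale_measure (ennreal r) M) = ennreal r * (\<integral>\<^sup>+x. ennreal (f x) \<partial>M)"
    by (rule nn_integral_scale_measure) simp
  also have "(\<integral>\<^sup>+x. ennreal (f x) \<partial>M) = ennreal (\<integral>x. f x \<partial>M)"
    using f nn by (intro nn_integral_eq_integral) auto
  also have "enn2real (ennreal r * ennreal (\<integral>x. f x \<partial>M)) = r * (\<integral>x. f x \<partial>M)"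
    using r nn by (simp add: ennreal_mult'[symmetric])
  finally show ?thesis .
qed

text \<open>The angle \<alpha> pi / 2 lies strictly between pi / 2 and pi, where the cosine is
  negative.\<close>

lemma spectral_constant_pos:
  assumes "1 < \<alpha>" "\<alpha> < 2"
  shows "0 < - cos (\<alpha> * pi / 2) * (Gamma (2 - \<alpha>) / (\<alpha> * (\<alpha> - 1)))"
proof -
  have "cos (\<alpha> * pi / 2) < cos (pi / 2)"
    using assms by (intro cos_monotone_0_pi) auto
  then have "0 < - cos (\<alpha> * pi / 2)" by simp
  moreover have "0 < Gamma (2 - \<alpha>) / (\<alpha> * (\<alpha> - 1))"
    using assms Gamma_real_pos[of "2 - \<alpha>"] by (intro divide_pos_pos mult_pos_pos) auto
  ultimately show ?thesis by (rule mult_pos_pos)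
qed

lemma
  fixes \<sigma> :: "'a::euclidean_space measure"
  assumes "spherical_component \<sigma>"
  shows spherical_component_finite: "finite_measure \<sigma>"
    and spherical_component_measurable: "(\<lambda>y. y) \<in> borel_measurable \<sigma>"
    and spherical_component_norm: "y \<in> space \<sigma> \<Longrightarrow> norm y = 1"
proof -
  have sets: "sets \<sigma> = sets (restrict_space borel (sphere 0 1))" and fin: "finite_measure \<sigma>"
    using assms by (auto simp: spherical_component_def)
  show "finite_measure \<sigma>" by (rule fin)
  show "(\<lambda>y. y) \<in> borel_measurable \<sigma>"
    using measurable_restrict_space1[of "\<lambda>y. y" borel borel "sphere 0 1 :: 'a set"]
    by (simp add: measurable_cong_sets[OF sets refl])
  show "y \<in> space \<sigma> \<Longrightarrow> norm y = 1"
    using sets_eq_imp_space_eq[OF sets] by (simp add: space_restrict_space)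
qed

lemma stable_exponent_eq:
  fixes \<sigma> :: "'a::euclidean_space measure" and \<xi> :: 'a
  assumes \<sigma>: "spherical_component \<sigma>" and \<alpha>: "1 < \<alpha>" "\<alpha> < 2"
  defines "b \<equiv> - cos (\<alpha> * pi / 2) * (Gamma (2 - \<alpha>) / (\<alpha> * (\<alpha> - 1)))"
  shows "stable_exponent \<alpha> \<sigma> \<xi> = - (b * (\<integral>y. \<bar>\<xi> \<bullet> y\<bar> powr \<alpha> \<partial>\<sigma>))"
    and "stable_exponent \<alpha> \<sigma> \<xi> \<ge> - (b * measure \<sigma> (space \<sigma>) * norm \<xi> powr \<alpha>)"
proof -
  interpret finite_measure \<sigma> by (rule spherical_component_finite[OF \<sigma>])
  note [measurable] = spherical_component_measurable[OF \<sigma>]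
  have b: "b > 0" unfolding b_def by (rule spectral_constant_pos[OF \<alpha>])
  have le: "\<bar>\<xi> \<bullet> y\<bar> powr \<alpha> \<le> norm \<xi> powr \<alpha>" if "y \<in> space \<sigma>" for y
    using Cauchy_Schwarz_ineq2[of \<xi> y] spherical_component_norm[OF \<sigma> that] \<alpha> by (intro powr_mono2) auto
  have i: "integrable \<sigma> (\<lambda>y. \<bar>\<xi> \<bullet> y\<bar> powr \<alpha>)"
    by (rule integrable_const_bound[of _ "norm \<xi> powr \<alpha>"]) (auto intro!: AE_I2 le)
  show eq: "stable_exponent \<alpha> \<sigma> \<xi> = - (b * (\<integral>y. \<bar>\<xi> \<bullet> y\<bar> powr \<alpha> \<partial>\<sigma>))"
    unfolding stable_exponent_def spectral_measure_def b_def[symmetric]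
    using integral_scale_measure[OF i, of b] b by simp
  have "(\<integral>y. \<bar>\<xi> \<bullet> y\<bar> powr \<alpha> \<partial>\<sigma>) \<le> (\<integral>y. norm \<xi> powr \<alpha> \<partial>\<sigma>)"
    by (rule integral_mono[OF i]) (auto intro: le)
  then have "b * (\<integral>y. \<bar>\<xi> \<bullet> y\<bar> powr \<alpha> \<partial>\<sigma>) \<le> b * (measure \<sigma> (space \<sigma>) * norm \<xi> powr \<alpha>)"
    using b by (intro mult_left_mono) auto
  then show "stable_exponent \<alpha> \<sigma> \<xi> \<ge> - (b * measure \<sigma> (space \<sigma>) * norm \<xi> powr \<alpha>)"
    unfolding eq by (simp add: mult.assoc)
qed

theorem corollary3p1:
  fixes \<alpha> \<beta> \<gamma> :: real
    and \<sigma> \<mu> :: "'a::euclidean_space measure"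
  assumes "DIM('a) \<ge> 2"
    and "1 < \<beta>" and "\<beta> < \<alpha>" and "\<alpha> < 2"
    and "1 \<le> \<gamma>" and "\<gamma> \<le> real DIM('a)"
    and "\<gamma> > real DIM('a) + 2 - 2 * \<alpha>"
    and "spherical_component \<sigma>"
    and "symmetric_stable_law \<alpha> \<sigma> \<mu>"
    and "non_degenerate \<alpha> \<sigma>"
    and "gamma_measure \<gamma> (levy_measure \<alpha> \<sigma>)"
  shows "\<forall>p::real. 1 < p \<longrightarrow>
    (\<exists>C::real. 0 \<le> C \<and>
      (\<forall>f \<in> (schwartz_space :: ('a \<Rightarrow> complex) set).
        Lp_norm p (T_op \<alpha> \<beta> \<sigma> f) \<le> ennreal C * Lp_norm p f))"
proof -
  note \<sigma> = \<open>spherical_component \<sigma>\<close>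
  have \<alpha>: "1 < \<alpha>" "\<alpha> < 2" and \<beta>: "1 < \<beta>" "\<beta> < 2" using assms by auto
  define a where "a = - cos (\<alpha> * pi / 2) * (Gamma (2 - \<alpha>) / (\<alpha> * (\<alpha> - 1)))"
  define b where "b = - cos (\<beta> * pi / 2) * (Gamma (2 - \<beta>) / (\<beta> * (\<beta> - 1)))"
  define lam where "lam \<xi> = - stable_exponent \<alpha> \<sigma> \<xi>" for \<xi>
  define lamb where "lamb \<xi> = - stable_exponent \<beta> \<sigma> \<xi>" for \<xi>
  have lam: "lam \<xi> = a * (\<integral>y. \<bar>\<xi> \<bullet> y\<bar> powr \<alpha> \<partial>\<sigma>)" for \<xi>
    using stable_exponent_eq(1)[OF \<sigma> \<alpha>, of \<xi>] by (simp add: lam_def a_def)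
  have lamb: "lamb \<xi> = b * (\<integral>y. \<bar>\<xi> \<bullet> y\<bar> powr \<beta> \<partial>\<sigma>)" for \<xi>
    using stable_exponent_eq(1)[OF \<sigma> \<beta>, of \<xi>] by (simp add: lamb_def b_def)
  have a: "a > 0" and b: "b > 0"
    unfolding a_def b_def by (rule spectral_constant_pos[OF \<alpha>], rule spectral_constant_pos[OF \<beta>])
  interpret \<sigma>: finite_measure \<sigma> by (rule spherical_component_finite[OF \<sigma>])
  note [measurable] = spherical_component_measurable[OF \<sigma>]
  have lam0: "0 \<le> lam \<xi>" for \<xi>
    unfolding lam using a by (intro mult_nonneg_nonneg integral_nonneg_AE) auto
  have scale: "lam (s *\<^sub>R \<xi>) = s powr \<alpha> * lam \<xi>" if "s > 0" for s \<xi>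
    using that by (simp add: lam abs_mult powr_mult mult.left_commute)
  \<comment> \<open>Non-degeneracy says that this infimum is positive; homogeneity of degree
    \<alpha> extends the lower bound from the sphere to all frequencies.\<close>
  define c0 where "c0 = (INF y \<in> sphere 0 1. lam y)"
  have lam_lint: "lam \<xi> = (LINT x|spectral_measure \<alpha> \<sigma>. \<bar>\<xi> \<bullet> x\<bar> powr \<alpha>)" for \<xi>
    by (simp add: lam_def stable_exponent_def)
  have c0: "c0 > 0"
    using \<open>non_degenerate \<alpha> \<sigma>\<close> by (simp add: non_degenerate_def c0_def lam_lint)
  have lower: "c0 * norm \<xi> powr \<alpha> \<le> lam \<xi>" for \<xi>
  proof (cases "\<xi> = 0")
    case False
    have "c0 \<le> lam (\<xi> /\<^sub>R norm \<xi>)"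
      unfolding c0_def using False lam0
      by (intro cINF_lower bdd_belowI2[where m=0]) auto
    then have "c0 * norm \<xi> powr \<alpha> \<le> norm \<xi> powr \<alpha> * lam (\<xi> /\<^sub>R norm \<xi>)"
      using mult_left_mono[of c0 _ "norm \<xi> powr \<alpha>"] by (metis mult.commute powr_ge_zero)
    also have "\<dots> = lam (norm \<xi> *\<^sub>R (\<xi> /\<^sub>R norm \<xi>))" using False by (intro scale[symmetric]) simp
    finally show ?thesis using False by simp
  qed (simp add: lam0)
  have \<mu>: "prob_space \<mu>" "sets \<mu> = sets borel"
    "(CLINT y|\<mu>. iexp (y \<bullet> \<xi>)) = complex_of_real (exp (- lam \<xi>))" for \<xi>
    using \<open>symmetric_stable_law \<alpha> \<sigma> \<mu>\<close>
    by (auto simp: symmetric_stable_law_def lam_def exp_of_real)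
  interpret stable_pair \<mu> lam \<alpha> c0 "a * measure \<sigma> (space \<sigma>)" \<sigma> "\<lambda>y. y" lamb b \<beta>
  proof (intro stable_pair.intro stable_char.intro stable_char_axioms.intro stable_pair_axioms.intro)
    \<comment> \<open>Stated for a generic \<open>Y\<close>, so that the inclusion of the sphere
      enters as a measurable function out of \<sigma> rather than as a bare variable.\<close>
    have "(\<lambda>(\<xi>, w). \<bar>\<xi> \<bullet> Y w\<bar> powr \<alpha>) \<in> borel_measurable ((borel :: 'a measure) \<Otimes>\<^sub>M \<sigma>)"
      if [measurable]: "Y \<in> borel_measurable \<sigma>" for Y
      unfolding case_prod_unfold by measurable
    from this[OF spherical_component_measurable[OF \<sigma>]]
    have "(\<lambda>(\<xi>, w). \<bar>\<xi> \<bullet> w\<bar> powr \<alpha>) \<in> borel_measurable ((borel :: 'a measure) \<Otimes>\<^sub>M \<sigma>)" .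
    from \<sigma>.borel_measurable_lebesgue_integral[OF this] show "lam \<in> borel_measurable borel"
      unfolding lam[abs_def] by measurable
    show "lam \<xi> \<le> a * measure \<sigma> (space \<sigma>) * norm \<xi> powr \<alpha>" for \<xi>
      using stable_exponent_eq(2)[OF \<sigma> \<alpha>, of \<xi>] by (simp add: lam_def a_def)
  qed (use \<mu> scale c0 lower \<alpha> \<beta> b lamb \<sigma>.finite_measure_axioms spherical_component_norm[OF \<sigma>]
         spherical_component_measurable[OF \<sigma>] in auto)
  obtain C where C: "fs_bound C (\<lambda>\<xi>. complex_of_real
     ((1 + lamb \<xi>) powr ((\<beta> - 1) / \<beta>) / (1 + lam \<xi>) powr ((\<alpha> - 1) / \<alpha>)))"
    using multiplier_bound[OF \<open>\<beta> < \<alpha>\<close>] .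
  \<comment> \<open>The transfer to L^p asks for a strictly positive constant, hence
    \<open>C + 1\<close>. It does not depend on p.\<close>
  have C1: "fs_bound (C + 1) (\<lambda>\<xi>. complex_of_real
     ((1 - stable_exponent \<beta> \<sigma> \<xi>) powr ((\<beta> - 1) / \<beta>) / (1 - stable_exponent \<alpha> \<sigma> \<xi>) powr ((\<alpha> - 1) / \<alpha>)))"
    using fs_bound_mono[OF C, of "C + 1"] by (simp add: lam_def lamb_def)
  have C0: "C + 1 > 0" using fs_bound_nonneg[OF C] by simp
  show ?thesis
  proof (intro allI impI exI[of _ "C + 1"] conjI ballI)
    show "0 \<le> C + 1" using C0 by simp
    fix p :: real and f :: "'a \<Rightarrow> complex"
    assume "1 < p" "f \<in> schwartz_space"
    then show "Lp_norm p (T_op \<alpha> \<beta> \<sigma> f) \<le> ennreal (C + 1) * Lp_norm p f"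
      using Lp_norm_multiplier_le[OF C1 C0 schwartz_space_integrable]
      by (simp add: T_op_def[abs_def])
  qed
qed

end
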